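(* Let $N_c\ge 2$ and $N_f\ge 1$ be integers, let $0\le t,\tilde t<1$, and let $x,y$ be $SU(N_f)$ fugacities. Then the Hilbert series of $SU(N_c)$ SQCD with $N_f$ flavours is $$g_{N_f,SU(N_c)}(t,\tilde t,x,y)=g_{N_f,U(N_c)}(t,\tilde t,x,y)+\sum_{k=1}^\infty\left[D_{N_c}\big(z^k\phi(t,\tilde t,x,y,z)\big)+D_{N_c}\big(z^{-k}\phi(t,\tilde t,x,y,z)\big)\right].$$
   Context: Fugacities: $x=(x_1,\dots,x_{N_f-1})$ and $y=(y_1,\dots,y_{N_f-1})$ are complex numbers of modulus $1$. Put $\xi_1=x_1$, $\xi_k=x_k/x_{k-1}$ for $2\le k\le N_f-1$, $\xi_{N_f}=1/x_{N_f-1}$, and define $\eta_1,\dots,\eta_{N_f}$ from $y$ in the same way (for $N_f=1$: $\xi_1=\eta_1=1$). Symbol: $\phi(t,\tilde t,x,y,z)=\prod_{i=1}^{N_f}\frac{1}{1-t\,\xi_i z^{-1}}\prod_{j=1}^{N_f}\frac{1}{1-\tilde t\,\eta_j^{-1}z}$. Hilbert series: for $G=U(N_c)$ or $G=SU(N_c)$, $$g_{N_f,G}(t,\tilde t,x,y)=\int_{G}\prod_{a=1}^{N_c}\phi(t,\tilde t,x,y,z_a)\,d\mu_G,$$ where $\mu_G$ is the normalised Haar measure on $G$ and $z_1,\dots,z_{N_c}$ are the eigenvalues of the group element (so $z_1\cdots z_{N_c}=1$ for $SU(N_c)$). For $G=U(N_c)$ this is $\frac{1}{N_c!(2\pi i)^{N_c}}\oint_{|z_1|=1}\frac{dz_1}{z_1}\cdots\oint_{|z_{N_c}|=1}\frac{dz_{N_c}}{z_{N_c}}\prod_{a<b}|z_a-z_b|^2\prod_a\phi(t,\tilde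 t,x,y,z_a)$. Toeplitz determinant: for a continuous function $f$ on the unit circle with Fourier coefficients $f_k=\frac{1}{2\pi i}\oint_{|z|=1}\frac{dz}{z}z^{-k}f(z)$, $D_n(f)=\det(f_{j-k})_{j,k=1}^n$. *)

theory Defs
  imports
    "HOL-Complex_Analysis.Complex_Analysis"
    "HOL-Probability.Probability_Measure"
    "Jordan_Normal_Form.Determinant"
begin

section \<open>Unitary groups and Haar measure\<close>

definition conj_transpose :: "complex^'n^'n \<Rightarrow> complex^'n^'n" where
  "conj_transpose A = map_matrix cnj (transpose A)"

definition unitary_group :: "(complex^'n^'n) set" where
  "unitary_group = {A. A ** conj_transpose A = Finite_Cartesian_Product.mat 1 \<and>
                       conj_transpose A ** A = Finite_Cartesian_Product.mat 1}"

definition special_unitary_group :: "(complex^'n^'n) set" where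
  "special_unitary_group = {A \<in> unitary_group. Determinants.det A = 1}"

text \<open>For a compact matrix group \<open>G\<close> this determines \<open>\<mu>\<close> uniquely. Such a measure is
  automatically regular and also right invariant, so neither property is required here.\<close>

definition normalized_haar_measure ::
    "(complex^'n^'n) set \<Rightarrow> (complex^'n^'n) measure \<Rightarrow> bool" where
  "normalized_haar_measure G \<mu> \<longleftrightarrow>
     sets \<mu> = sets (restrict_space borel G) \<and> prob_space \<mu> \<and>
     (\<forall>g\<in>G. \<forall>S\<in>sets \<mu>. emeasure \<mu> ((\<lambda>h. g ** h) ` S) = emeasure \<mu> S)"

definition charpoly :: "complex^'n^'n \<Rightarrow> complex poly" where
  "charpoly A =
     Determinants.det (Finite_Cartesian_Product.mat [:0, 1:] - map_matrix (\<lambda>c. [:c:]) A)"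

text \<open>Eigenvalues, repeated according to algebraic multiplicity.\<close>

definition eigenvalues :: "complex^'n^'n \<Rightarrow> complex multiset" where
  "eigenvalues A = proots (charpoly A)"


section \<open>The symbol and the Hilbert series\<close>

text \<open>\<open>fugacity_ratio N x k\<close> is \<open>\<xi>\<^sub>k\<close> (for \<open>1 \<le> k \<le> N\<close>) in terms of \<open>x 1, \<dots>, x (N - 1)\<close>.\<close>

definition fugacity_ratio :: "nat \<Rightarrow> (nat \<Rightarrow> complex) \<Rightarrow> nat \<Rightarrow> complex" where
  "fugacity_ratio N x k =
     (if N = 1 then 1
      else if k = 1 then x 1
      else if k = N then 1 / x (N - 1)
      else x k / x (k - 1))"

definition sqcd_symbol ::
    "nat \<Rightarrow> real \<Rightarrow> real \<Rightarrow> (nat \<Rightarrow> complex) \<Rightarrow> (nat \<Rightarrow> complex) \<Rightarrow> complex \<Rightarrow> complex" where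
  "sqcd_symbol Nf t t' x y z =
     (\<Prod>i=1..Nf. 1 / (1 - complex_of_real t * fugacity_ratio Nf x i * inverse z)) *
     (\<Prod>j=1..Nf. 1 / (1 - complex_of_real t' * inverse (fugacity_ratio Nf y j) * z))"

text \<open>The gauge group enters through its normalised Haar measure \<open>\<mu>\<close>, which lives on it.\<close>

definition hilbert_series ::
    "nat \<Rightarrow> (complex^'n^'n) measure \<Rightarrow> real \<Rightarrow> real \<Rightarrow>
     (nat \<Rightarrow> complex) \<Rightarrow> (nat \<Rightarrow> complex) \<Rightarrow> complex" where
  "hilbert_series Nf \<mu> t t' x y =
     (LINT A|\<mu>. (\<Prod>z\<in>#eigenvalues A. sqcd_symbol Nf t t' x y z))"


section \<open>Toeplitz determinants\<close>

definition fourier_coeff :: "(complex \<Rightarrow> complex) \<Rightarrow> int \<Rightarrow> complex" where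
  "fourier_coeff f k =
     1 / (2 * of_real pi * \<i>) * contour_integral (circlepath 0 1) (\<lambda>z. z powi (- k) * f z / z)"

definition toeplitz_det :: "nat \<Rightarrow> (complex \<Rightarrow> complex) \<Rightarrow> complex" where
  "toeplitz_det n f =
     Determinant.det (Matrix.mat n n (\<lambda>(j, k). fourier_coeff f (int j - int k)))"

end

theory Submission
  imports Defs "HOL-Computational_Algebra.Fundamental_Theorem_Algebra"
begin

text \<open>Truncating the geometric series in the symbol turns it, up to a power of \<open>z\<close>, into a
  polynomial with roots \<open>u\<^sub>1, \<dots>, u\<^sub>n\<close>, so the integrand becomes a power of \<open>det A\<close> times
  \<open>\<Prod>\<^sub>j det (u\<^sub>j - A)\<close>. Invariance of Haar measure under \<open>SU(N)\<close> gives a Schwinger-Dyson (loop) equation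
  for the averages of products of coefficients of \<open>det (1 - s A)\<close>. This equation is a recursion
  whose solutions are determined by the averages of the powers of \<open>det A\<close>. Integration over the
  diagonal torus against \<open>\<Prod>|z\<^sub>i - z\<^sub>j|\<^sup>2 \<Prod> z\<^sub>i\<^sup>-\<^sup>m\<close> satisfies the same equation, sees exactly the power \<open>m\<close> of the
  determinant, and evaluates products of one-variable functions to Toeplitz determinants. Hence an
  average over \<open>SU(N)\<close>, where every power of the determinant has mean \<open>1\<close>, is the sum over all \<open>m\<close>, and
  an average over \<open>U(N)\<close> is the single term \<open>m = 0\<close>. The truncation error of the Toeplitz determinants is geometric,
  uniformly in \<open>m\<close>, so it can be summed over the growing range of \<open>m\<close>.\<close>

no_notation Matrix.vec_index (infixl \<open>$\<close> 100)
no_notation fps_nth (infixl \<open>$\<close> 75)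

section \<open>Coefficients of the reversed characteristic polynomial\<close>

text \<open>The Haar measures are given only by invariance, so no eigenvalue density is available
  for them; group and torus averages are compared through an equation that both satisfy. Only
  traceless directions enter. This produces the term divided by \<open>N\<close>, and that term
  cancels the derivative of any power of the determinant in the weight, so a single equation serves
  \<open>SU(N)\<close>, \<open>U(N)\<close> weighted by a power of \<open>inverse (det A)\<close>,
  and every torus weight. Coefficients of \<open>det (1 - s A)\<close> are used because they vanish
  beyond index \<open>N\<close>: among lists with entries at most \<open>N\<close> the leading
  factor for a first entry \<open>i > 0\<close> is then positive unless every entry equals
  \<open>N\<close>. On the torus only the diagonal directions can be differentiated; the
  off-diagonal ones are supplied by the logarithmic derivative of the Vandermonde factor, through a
  divided-difference identity. The truncated symbol is a Laurent polynomial while the recursion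
  treats polynomials, so a factor \<open>z ^ L\<close> is carried along: it is invisible on
  \<open>SU(N)\<close> and cancelled by the weight on \<open>U(N)\<close>.\<close>

abbreviation trace :: "complex^'n^'n \<Rightarrow> complex" where "trace \<equiv> Determinants.trace"

abbreviation scalar_mat :: "'a::zero \<Rightarrow> 'a^'n^'n" where
  "scalar_mat \<equiv> Finite_Cartesian_Product.mat"

lemmas scalar_mat_def = Finite_Cartesian_Product.mat_def

lemmas matrix_eq_iff = Finite_Cartesian_Product.vec_eq_iff

definition scale_mat :: "complex \<Rightarrow> complex^'n^'n \<Rightarrow> complex^'n^'n" where
  "scale_mat c A = (\<chi> p q. c * A $ p $ q)"

lemma scale_mat_nth [simp]: "scale_mat c A $ p $ q = c * A $ p $ q"
  by (simp add: scale_mat_def)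

lemma matrix_add_rdist: "((B :: complex^'n^'n) + C) ** A = B ** A + C ** A"
  and matrix_diff_ldist: "A ** (B - C) = A ** B - A ** C"
  by (vector matrix_matrix_mult_def sum.distrib[symmetric] sum_subtractf[symmetric] ring_distribs)+

lemma scale_mat_mult_left: "scale_mat c A ** B = scale_mat c (A ** B)"
  and scale_mat_mult_right: "A ** scale_mat c B = scale_mat c (A ** B)"
  by (simp_all add: vec_eq_iff matrix_matrix_mult_def scale_mat_def sum_distrib_left mult_ac)

lemma trace_scale_mat: "trace (scale_mat c A) = c * trace A"
  by (simp add: Determinants.trace_def sum_distrib_left)

lemma trace_sum: "trace (sum F S) = (\<Sum>s\<in>S. trace (F s))"
  by (induction S rule: infinite_finite_induct) (auto simp: trace_add trace_0[unfolded mat_0])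

abbreviation cdet :: "'a::comm_ring_1^'n^'n \<Rightarrow> 'a" where
  "cdet \<equiv> Determinants.det"

text \<open>The first component is the coefficient of \<open>s\<^sup>i\<close> in \<open>det (1 - s A)\<close>, defined through Newton's
  identities so that it is visibly a polynomial in the entries of \<open>A\<close>.\<close>

primrec newton :: "nat \<Rightarrow> complex^'n^'n \<Rightarrow> complex \<times> (complex^'n^'n)" where
  "newton 0 A = (1, 0)"
| "newton (Suc i) A =
     (let C = scale_mat (fst (newton i A)) A + A ** snd (newton i A)
      in (- trace C / of_nat (Suc i), C))"

definition newton_coeff :: "nat \<Rightarrow> complex^'n^'n \<Rightarrow> complex" where
  "newton_coeff i A = fst (newton i A)"

text \<open>Up to sign this matrix is the gradient of \<open>newton_coeff i\<close>: along
  \<open>A \<mapsto> exp (\<epsilon> X) A\<close> the coefficient changes at the rate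
  \<open>- trace (X ** newton_mat i A)\<close>. Its closed form is
  \<open>newton_mat_eq_sum\<close>.\<close>

definition newton_mat :: "nat \<Rightarrow> complex^'n^'n \<Rightarrow> complex^'n^'n" where
  "newton_mat i A = snd (newton i A)"

lemma newton_coeff_0 [simp]: "newton_coeff 0 A = 1"
  and newton_mat_0 [simp]: "newton_mat 0 A = 0"
  by (simp_all add: newton_coeff_def newton_mat_def)

lemma newton_mat_Suc:
  "newton_mat (Suc i) A = scale_mat (newton_coeff i A) A + A ** newton_mat i A"
  by (simp add: newton_coeff_def newton_mat_def Let_def)

lemma newton_coeff_Suc:
  "newton_coeff (Suc i) A = - trace (newton_mat (Suc i) A) / of_nat (Suc i)"
  by (simp add: newton_coeff_def newton_mat_def Let_def)

lemma trace_newton_mat: "trace (newton_mat i A) = - of_nat i * newton_coeff i A"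
proof (cases i)
  case 0
  then show ?thesis by (simp add: trace_0[unfolded mat_0])
next
  case (Suc j)
  have "of_nat (Suc j) \<noteq> (0::complex)" by (rule of_nat_neq_0)
  then show ?thesis unfolding Suc newton_coeff_Suc by (simp del: of_nat_Suc)
qed

lemma newton_mat_commute: "A ** newton_mat i A = newton_mat i A ** A"
proof (induction i)
  case (Suc i)
  then show ?case
    by (simp add: newton_mat_Suc matrix_add_ldistrib matrix_add_rdist scale_mat_mult_left
        scale_mat_mult_right matrix_mul_assoc)
qed auto

text \<open>Expanding the factor of higher index on each side produces the same term
  \<open>A ** newton_mat i A ** newton_mat k A\<close>, which cancels. What remains are traces of
  \<open>A ** newton_mat j A\<close>, and Newton's identity at \<open>Suc j\<close> expresses these
  by coefficients.\<close>

lemma trace_newton_mat_mult_step: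
  "trace (newton_mat (Suc i) A ** newton_mat k A) - trace (newton_mat i A ** newton_mat (Suc k) A)
   = of_nat (Suc i) * newton_coeff (Suc i) A * newton_coeff k A
     - of_nat (Suc k) * newton_coeff i A * newton_coeff (Suc k) A"
proof -
  have 1: "newton_mat (Suc i) A ** newton_mat k A =
    scale_mat (newton_coeff i A) (A ** newton_mat k A) + A ** newton_mat i A ** newton_mat k A"
    by (simp add: newton_mat_Suc matrix_add_rdist scale_mat_mult_left)
  have 2: "newton_mat i A ** newton_mat (Suc k) A =
    scale_mat (newton_coeff k A) (A ** newton_mat i A) + A ** newton_mat i A ** newton_mat k A"
    by (simp add: newton_mat_Suc matrix_add_ldistrib scale_mat_mult_right
        newton_mat_commute[symmetric] matrix_mul_assoc)
  have 3: "trace (A ** newton_mat j A) = - of_nat (Suc j) * newton_coeff (Suc j) A - newton_coeff j A * trace A" for j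
    using trace_newton_mat[of "Suc j" A]
    by (simp add: newton_mat_Suc trace_add trace_scale_mat algebra_simps del: of_nat_Suc)
  show ?thesis
    unfolding 1 2 trace_add trace_scale_mat 3 by (simp add: algebra_simps)
qed

text \<open>Iterating the previous step lowers \<open>i\<close> to \<open>0\<close>, where the
  matrix vanishes. The trace thereby becomes a quadratic polynomial in the coefficients, which is
  what keeps the loop equation inside the products of coefficients.\<close>

lemma trace_newton_mat_mult:
  "trace (newton_mat i A ** newton_mat k A) = of_nat i * newton_coeff i A * newton_coeff k A
     - (\<Sum>r=1..i. (of_nat k - of_nat i + 2 * of_nat r) * newton_coeff (i - r) A * newton_coeff (k + r) A)"
proof (induction i arbitrary: k)
  case 0
  then show ?case by (simp add: trace_0[unfolded mat_0])
next
  case (Suc i)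
  have s: "(\<Sum>r=1..Suc i. (of_nat k - of_nat (Suc i) + 2 * of_nat r) * newton_coeff (Suc i - r) A * newton_coeff (k + r) A)
     = (of_nat k - of_nat i + 1) * newton_coeff i A * newton_coeff (Suc k) A
     + (\<Sum>r=1..i. (of_nat (Suc k) - of_nat i + 2 * of_nat r) * newton_coeff (i - r) A * newton_coeff (Suc k + r) A)"
    by (subst sum.atLeast_Suc_atMost, simp, subst sum.shift_bounds_cl_Suc_ivl)
       (simp add: algebra_simps)
  show ?case
    using trace_newton_mat_mult_step[of i A k] Suc.IH[of "Suc k"]
    unfolding s by (simp add: algebra_simps)
qed

text \<open>Derivative of \<^const>\<open>newton_mat\<close> along \<open>A \<mapsto> exp (\<epsilon> X) A\<close>.\<close>

primrec newton_deriv :: "nat \<Rightarrow> complex^'n^'n \<Rightarrow> complex^'n^'n \<Rightarrow> complex^'n^'n" where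
  "newton_deriv 0 A X = 0"
| "newton_deriv (Suc i) A X =
     X ** newton_mat (Suc i) A - scale_mat (trace (X ** newton_mat i A)) A + A ** newton_deriv i A X"

definition unit_mat :: "'n \<Rightarrow> 'n \<Rightarrow> complex^'n^'n" where
  "unit_mat p q = (\<chi> a b. if a = p \<and> b = q then 1 else 0)"

lemma mult_unit_mat: "(Z ** unit_mat p q) $ a $ b = (if b = q then Z $ a $ p else 0)"
  by (simp add: matrix_matrix_mult_def unit_mat_def if_distrib cong: if_cong)

lemma unit_mat_mult: "(unit_mat p q ** Z) $ a $ b = (if a = p then Z $ q $ b else 0)"
proof -
  have "(unit_mat p q ** Z) $ a $ b = (\<Sum>k\<in>UNIV. if k = q then (if a = p then Z $ k $ b else 0) else 0)"
    by (auto simp: matrix_matrix_mult_def unit_mat_def if_distrib[of "\<lambda>x. x * _"] cong: if_cong)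
  then show ?thesis by simp
qed

lemma mult_unit_mat_mult: "(Z ** unit_mat p q ** W) $ a $ b = Z $ a $ p * W $ q $ b"
  unfolding matrix_matrix_mult_def[of "Z ** unit_mat p q"]
  by (simp add: mult_unit_mat if_distrib[of "\<lambda>x. x * _"] cong: if_cong)

lemma trace_unit_mat_mult: "trace (unit_mat p q ** Z) = Z $ q $ p"
  by (simp add: Determinants.trace_def unit_mat_mult)

lemma trace_mult_eq: "trace (Z ** W) = (\<Sum>p\<in>UNIV. \<Sum>q\<in>UNIV. Z $ p $ q * W $ q $ p)"
  by (simp add: Determinants.trace_def matrix_matrix_mult_def)

text \<open>The matrix \<open>Z\<close> is a parameter because the recursive term of
  \<open>newton_deriv\<close> has a factor \<open>A\<close> on its left: the induction hypothesis is
  applied to \<open>Z ** A\<close>. Only \<open>Z = scalar_mat 1\<close> is used afterwards.\<close>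

lemma newton_deriv_contraction:
  "(\<Sum>p\<in>UNIV. \<Sum>q\<in>UNIV. (Z ** newton_deriv i A (unit_mat p q)) $ p $ q)
   = - of_nat i * newton_coeff i A * trace Z - (of_nat i - 1) * trace (Z ** newton_mat i A)"
proof (induction i arbitrary: Z)
  case 0
  then show ?case by (simp add: trace_0[unfolded mat_0])
next
  case (Suc i)
  have "(Z ** newton_deriv (Suc i) A (unit_mat p q)) $ p $ q
     = Z $ p $ p * newton_mat (Suc i) A $ q $ q - (Z ** A) $ p $ q * newton_mat i A $ q $ p
       + (Z ** A ** newton_deriv i A (unit_mat p q)) $ p $ q" for p q
  proof -
    have "Z ** newton_deriv (Suc i) A (unit_mat p q) =
      Z ** unit_mat p q ** newton_mat (Suc i) A - scale_mat (newton_mat i A $ q $ p) (Z ** A)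
      + Z ** A ** newton_deriv i A (unit_mat p q)"
      by (simp add: matrix_add_ldistrib matrix_diff_ldist scale_mat_mult_right matrix_mul_assoc trace_unit_mat_mult)
    then show ?thesis by (simp add: mult_unit_mat_mult)
  qed
  then have "(\<Sum>p\<in>UNIV. \<Sum>q\<in>UNIV. (Z ** newton_deriv (Suc i) A (unit_mat p q)) $ p $ q)
     = trace Z * trace (newton_mat (Suc i) A) - trace (Z ** A ** newton_mat i A)
       + (- of_nat i * newton_coeff i A * trace (Z ** A) - (of_nat i - 1) * trace (Z ** A ** newton_mat i A))"
    by (simp only: Suc.IH sum.distrib sum_subtractf trace_mult_eq[of "Z ** A" "newton_mat i A", symmetric]
        Determinants.trace_def[of Z] Determinants.trace_def[of "newton_mat (Suc i) A"] sum_product)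
  moreover have "trace (Z ** newton_mat (Suc i) A) = newton_coeff i A * trace (Z ** A) + trace (Z ** A ** newton_mat i A)"
    by (simp add: newton_mat_Suc matrix_add_ldistrib scale_mat_mult_right trace_add trace_scale_mat matrix_mul_assoc)
  ultimately show ?case
    by (simp add: trace_newton_mat algebra_simps)
qed

primrec mat_pow :: "complex^'n^'n \<Rightarrow> nat \<Rightarrow> complex^'n^'n" where
  "mat_pow A 0 = scalar_mat 1"
| "mat_pow A (Suc k) = A ** mat_pow A k"

lemma mat_pow_commute: "A ** mat_pow A k = mat_pow A k ** A"
  by (induction k) (auto simp: matrix_mul_assoc)

lemma mat_pow_add: "mat_pow A (k + l) = mat_pow A k ** mat_pow A l"
  by (induction k) (auto simp: matrix_mul_assoc)

lemma mult_sum_right: "(A :: complex^'n^'n) ** sum F S = (\<Sum>s\<in>S. A ** F s)"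
  by (induction S rule: infinite_finite_induct) (auto simp: matrix_add_ldistrib)

lemma newton_mat_eq_sum:
  "newton_mat i A = (\<Sum>j=1..i. scale_mat (newton_coeff (i - j) A) (mat_pow A j))"
proof (induction i)
  case (Suc i)
  have "(\<Sum>j=1..Suc i. scale_mat (newton_coeff (Suc i - j) A) (mat_pow A j))
     = scale_mat (newton_coeff i A) A + (\<Sum>j=1..i. scale_mat (newton_coeff (i - j) A) (A ** mat_pow A j))"
    by (subst sum.atLeast_Suc_atMost, simp, subst sum.shift_bounds_cl_Suc_ivl) simp
  then show ?case
    by (simp add: newton_mat_Suc Suc.IH mult_sum_right scale_mat_mult_right)
qed auto

lemma trace_mult_newton_mat:
  "trace (X ** mat_pow A s ** newton_mat i A) =
    (\<Sum>j=1..i. newton_coeff (i - j) A * trace (X ** mat_pow A (s + j)))"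
  by (simp add: newton_mat_eq_sum mult_sum_right trace_sum scale_mat_mult_right trace_scale_mat
      mat_pow_add matrix_mul_assoc)

lemma newton_mat_mat_pow_commute: "mat_pow A s ** newton_mat i A = newton_mat i A ** mat_pow A s"
proof (induction s)
  case (Suc s)
  have "mat_pow A (Suc s) ** newton_mat i A = A ** (newton_mat i A ** mat_pow A s)"
    by (simp add: Suc matrix_mul_assoc[symmetric])
  then show ?case by (simp add: matrix_mul_assoc newton_mat_commute)
qed auto

text \<open>The power \<open>mat_pow A s\<close> on the left absorbs the factor \<open>A\<close>
  that each unrolling of \<open>newton_deriv\<close> produces. Cyclicity of the trace then brings
  \<open>X\<close> to the front.\<close>

lemma trace_mat_pow_newton_deriv:
  "trace (mat_pow A s ** newton_deriv i A X) =
    (\<Sum>t<i. trace (X ** mat_pow A (s + t) ** newton_mat (i - t) A)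
      - trace (mat_pow A (s + t + 1)) * trace (X ** newton_mat (i - t - 1) A))"
proof (induction i arbitrary: s)
  case 0
  then show ?case by (simp add: trace_0[unfolded mat_0])
next
  case (Suc i)
  have "trace (mat_pow A s ** newton_deriv (Suc i) A X)
    = trace (mat_pow A s ** (X ** newton_mat (Suc i) A)) - trace (X ** newton_mat i A) * trace (mat_pow A s ** A)
      + trace (mat_pow A (Suc s) ** newton_deriv i A X)"
    by (simp add: matrix_add_ldistrib matrix_diff_ldist scale_mat_mult_right trace_add trace_sub
        trace_scale_mat mat_pow_commute matrix_mul_assoc)
  also have "trace (mat_pow A s ** (X ** newton_mat (Suc i) A)) = trace (X ** mat_pow A s ** newton_mat (Suc i) A)"
    by (subst trace_mul_sym) (simp add: newton_mat_mat_pow_commute matrix_mul_assoc[symmetric])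
  also have "mat_pow A s ** A = mat_pow A (Suc s)"
    by (simp add: mat_pow_commute)
  finally show ?case
    unfolding Suc.IH sum.lessThan_Suc_shift by (simp add: algebra_simps)
qed

text \<open>This is the consistency condition between \<open>trace_newton_mat\<close> and the
  gradient formula for the coefficients: it lets the derivative of
  \<open>newton_coeff (Suc i)\<close>, defined through a trace, be evaluated again as a gradient. In
  the expansion by \<open>trace (X ** mat_pow A w)\<close> one sum contributes the weight
  \<open>w\<close>, the other \<open>i - w\<close>.\<close>

lemma trace_newton_deriv: "trace (newton_deriv i A X) = of_nat i * trace (X ** newton_mat i A)"
proof -
  let ?\<tau> = "\<lambda>k. trace (mat_pow A k)" and ?\<xi> = "\<lambda>k. trace (X ** mat_pow A k)"
  let ?f = "\<lambda>k. newton_coeff k A"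
  have nf: "(\<Sum>j=1..k. ?f (k - j) * ?\<tau> j) = - of_nat k * ?f k" for k
    using trace_mult_newton_mat[of "scalar_mat 1" A 0 k] by (simp add: trace_newton_mat)
  have xf: "trace (X ** newton_mat k A) = (\<Sum>j=1..k. ?f (k - j) * ?\<xi> j)" for k
    using trace_mult_newton_mat[of X A 0 k] by simp
  \<comment> \<open>The value \<open>w = t + j\<close> arises from exactly \<open>w\<close> pairs,
    all with the same summand.\<close>
  have A1: "(\<Sum>t<i. trace (X ** mat_pow A t ** newton_mat (i - t) A)) = (\<Sum>w=1..i. of_nat w * ?f (i - w) * ?\<xi> w)"
  proof -
    have "(\<Sum>t<i. trace (X ** mat_pow A t ** newton_mat (i - t) A)) = (\<Sum>t<i. \<Sum>j=1..i - t. ?f (i - t - j) * ?\<xi> (t + j))"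
      by (simp add: trace_mult_newton_mat)
    also have "\<dots> = (\<Sum>(t,j)\<in>(SIGMA t:{..<i}. {1..i-t}). ?f (i - t - j) * ?\<xi> (t + j))"
      by (subst sum.Sigma) auto
    also have "\<dots> = (\<Sum>(w,t)\<in>(SIGMA w:{1..i}. {..<w}). ?f (i - w) * ?\<xi> w)"
      by (rule sum.reindex_bij_witness[of _ "\<lambda>(w,t). (t, w - t)" "\<lambda>(t,j). (t + j, t)"]) auto
    also have "\<dots> = (\<Sum>w=1..i. \<Sum>t<w. ?f (i - w) * ?\<xi> w)"
      by (subst sum.Sigma) auto
    finally show ?thesis by (simp add: mult.assoc)
  qed
  \<comment> \<open>For fixed \<open>j = v\<close> the sum over \<open>s = t + 1\<close> is the left
    side of Newton's identity at \<open>i - v\<close>, which provides the complementary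
    weight.\<close>
  have A2: "(\<Sum>t<i. ?\<tau> (t + 1) * trace (X ** newton_mat (i - t - 1) A)) = (\<Sum>v=1..i. - of_nat (i - v) * ?f (i - v) * ?\<xi> v)"
  proof -
    have "(\<Sum>t<i. ?\<tau> (t + 1) * trace (X ** newton_mat (i - t - 1) A))
      = (\<Sum>t<i. \<Sum>j=1..i - t - 1. ?\<tau> (t + 1) * (?f (i - t - 1 - j) * ?\<xi> j))"
      by (simp add: xf sum_distrib_left)
    also have "\<dots> = (\<Sum>(t,j)\<in>(SIGMA t:{..<i}. {1..i-t-1}). ?\<tau> (t + 1) * (?f (i - t - 1 - j) * ?\<xi> j))"
      by (subst sum.Sigma) auto
    also have "\<dots> = (\<Sum>(v,s)\<in>(SIGMA v:{1..i}. {1..i-v}). ?f (i - v - s) * ?\<tau> s * ?\<xi> v)"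
      by (rule sum.reindex_bij_witness[of _ "\<lambda>(v,s). (s - 1, v)" "\<lambda>(t,j). (j, t + 1)"])
         (auto simp: algebra_simps)
    also have "\<dots> = (\<Sum>v=1..i. (\<Sum>s=1..i-v. ?f (i - v - s) * ?\<tau> s) * ?\<xi> v)"
      by (subst sum.Sigma[symmetric]) (auto simp: sum_distrib_right)
    finally show ?thesis unfolding nf .
  qed
  have "trace (newton_deriv i A X) = (\<Sum>w=1..i. of_nat w * ?f (i - w) * ?\<xi> w) - (\<Sum>v=1..i. - of_nat (i - v) * ?f (i - v) * ?\<xi> v)"
    using trace_mat_pow_newton_deriv[of A 0 i X] unfolding A1[symmetric] A2[symmetric]
    by (simp add: sum_subtractf)
  also have "\<dots> = (\<Sum>w=1..i. of_nat i * (?f (i - w) * ?\<xi> w))"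
    unfolding sum_subtractf[symmetric] by (intro sum.cong) (auto simp: of_nat_diff algebra_simps)
  finally show ?thesis by (simp add: xf sum_distrib_left)
qed

section \<open>The loop equation as a recursion\<close>

definition newton_prod :: "nat list \<Rightarrow> complex^'n^'n \<Rightarrow> complex" where
  "newton_prod as A = (\<Prod>a\<leftarrow>as. newton_coeff a A)"

lemma newton_prod_Nil [simp]: "newton_prod [] A = 1"
  and newton_prod_Cons [simp]: "newton_prod (a # as) A = newton_coeff a A * newton_prod as A"
  by (simp_all add: newton_prod_def)

text \<open>Derivative of \<^const>\<open>newton_prod\<close> along \<open>A \<mapsto> exp (\<epsilon> X) A\<close>.\<close>

primrec newton_prod_deriv :: "nat list \<Rightarrow> complex^'n^'n \<Rightarrow> complex^'n^'n \<Rightarrow> complex" where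
  "newton_prod_deriv [] A X = 0"
| "newton_prod_deriv (a # as) A X =
     - trace (X ** newton_mat a A) * newton_prod as A + newton_coeff a A * newton_prod_deriv as A X"

text \<open>With \<open>D\<^sub>X\<close> the derivative along \<open>exp (\<epsilon> X) A\<close>, \<open>C = newton_mat i A\<close> and \<open>Q = newton_prod as A\<close>, this is
  \<open>\<Sum>\<^sub>p\<^sub>q D\<^sub>X (C\<^sub>p\<^sub>q Q)\<close> for \<open>X = unit_mat p q\<close>, corrected by the trace part because only traceless \<open>X\<close>
  generate \<open>SU(N)\<close>.\<close>

definition sd_term :: "nat \<Rightarrow> nat list \<Rightarrow> complex^'n^'n \<Rightarrow> complex" where
  "sd_term i as A =
     (\<Sum>p\<in>UNIV. \<Sum>q\<in>UNIV. newton_deriv i A (unit_mat p q) $ p $ q * newton_prod as A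
        + newton_mat i A $ p $ q * newton_prod_deriv as A (unit_mat p q))
     - (trace (newton_deriv i A (scalar_mat 1)) * newton_prod as A
        + trace (newton_mat i A) * newton_prod_deriv as A (scalar_mat 1))
       / of_nat CARD('n)"

lemma newton_prod_deriv_one:
  "newton_prod_deriv as A (scalar_mat 1) = of_nat (sum_list as) * newton_prod as A"
  by (induction as) (auto simp: trace_newton_mat algebra_simps)

lemma sum_lessThan_length_Cons:
  "(\<Sum>j<length (a # as). g j) = g 0 + (\<Sum>j<length as. g (Suc j))"
  unfolding length_Cons by (rule sum.lessThan_Suc_shift)

text \<open>By the product rule each factor of index \<open>a\<close> contributes
  \<open>- trace (newton_mat i A ** newton_mat a A)\<close>. The quadratic formula for this trace
  moves \<open>r\<close> units from \<open>i\<close> to one entry of the list.\<close>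

lemma newton_prod_deriv_contraction:
  fixes A :: "complex^'n^'n"
  shows "newton_coeff 0 A * (\<Sum>p\<in>UNIV. \<Sum>q\<in>UNIV. newton_mat i A $ p $ q * newton_prod_deriv as A (unit_mat p q))
    = - of_nat (i * length as) * newton_coeff i A * newton_prod as A
      + (\<Sum>j<length as. \<Sum>r=1..i. (of_nat (as ! j) - of_nat i + 2 * of_nat r)
          * (newton_coeff (i - r) A * newton_prod (as[j := as ! j + r]) A))"
proof (induction as)
  case (Cons a as)
  let ?S = "\<lambda>as. \<Sum>p\<in>UNIV. \<Sum>q\<in>UNIV. newton_mat i A $ p $ q * newton_prod_deriv as A (unit_mat p q)"
  have "?S (a # as) = (\<Sum>p\<in>UNIV. \<Sum>q\<in>UNIV.
      - (newton_prod as A) * (newton_mat i A $ p $ q * newton_mat a A $ q $ p)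
      + newton_coeff a A * (newton_mat i A $ p $ q * newton_prod_deriv as A (unit_mat p q)))"
    by (simp add: trace_unit_mat_mult algebra_simps)
  also have "\<dots> = - (newton_prod as A) * trace (newton_mat i A ** newton_mat a A) + newton_coeff a A * ?S as"
    by (simp only: sum.distrib sum_distrib_left[symmetric] trace_mult_eq)
  finally have S: "?S (a # as) = - (newton_prod as A) * trace (newton_mat i A ** newton_mat a A) + newton_coeff a A * ?S as" .
  have T: "newton_coeff a A * (\<Sum>j<length as. \<Sum>r=1..i. (of_nat (as ! j) - of_nat i + 2 * of_nat r)
          * (newton_coeff (i - r) A * newton_prod (as[j := as ! j + r]) A))
     = (\<Sum>j<length as. \<Sum>r=1..i. (of_nat (as ! j) - of_nat i + 2 * of_nat r)
          * (newton_coeff (i - r) A * (newton_coeff a A * newton_prod (as[j := as ! j + r]) A)))"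
    by (simp add: sum_distrib_left mult_ac)
  have U: "- (newton_prod as A) * trace (newton_mat i A ** newton_mat a A) =
      - of_nat i * newton_coeff i A * newton_prod (a # as) A
      + (\<Sum>r=1..i. (of_nat a - of_nat i + 2 * of_nat r)
          * (newton_coeff (i - r) A * newton_prod ((a # as)[0 := a + r]) A))"
  proof -
    have "newton_prod as A * (\<Sum>r=1..i. (of_nat a - of_nat i + 2 * of_nat r) * newton_coeff (i - r) A * newton_coeff (a + r) A)
      = (\<Sum>r=1..i. (of_nat a - of_nat i + 2 * of_nat r)
          * (newton_coeff (i - r) A * newton_prod ((a # as)[0 := a + r]) A))"
      by (simp add: sum_distrib_left mult_ac)
    then show ?thesis
      unfolding trace_newton_mat_mult by (simp only: right_diff_distrib newton_prod_Cons) (simp add: algebra_simps)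
  qed
  define R where "R = (\<Sum>j<length as. \<Sum>r=1..i. (of_nat (as ! j) - of_nat i + 2 * of_nat r)
          * (newton_coeff (i - r) A * newton_prod (as[j := as ! j + r]) A))"
  define R0 where "R0 = (\<Sum>r=1..i. (of_nat a - of_nat i + 2 * of_nat r)
          * (newton_coeff (i - r) A * newton_prod ((a # as)[0 := a + r]) A))"
  have IH: "?S as = - of_nat (i * length as) * newton_coeff i A * newton_prod as A + R"
    using Cons.IH by (simp add: R_def)
  have "(\<Sum>j<length (a # as). \<Sum>r=1..i. (of_nat ((a # as) ! j) - of_nat i + 2 * of_nat r)
          * (newton_coeff (i - r) A * newton_prod ((a # as)[j := (a # as) ! j + r]) A))
      = R0 + newton_coeff a A * R"
    unfolding sum_lessThan_length_Cons R_def R0_def T by simp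
  then show ?case
    unfolding S IH U[folded R0_def] by (simp add: algebra_simps)
qed simp

text \<open>Origin of the leading factor: the derivative of \<open>newton_mat i\<close> itself gives
  \<open>N + 1 - i\<close>, each factor of \<open>newton_prod as\<close> gives one more unit, and
  the trace correction subtracts the total index divided by \<open>N\<close>.\<close>

lemma sd_term_eq:
  fixes A :: "complex^'n^'n"
  shows "sd_term i as A =
    - (of_nat i * (of_nat CARD('n) + of_nat (Suc (length as)) - of_nat i
        - of_nat (i + sum_list as) / of_nat CARD('n))) * newton_prod (i # as) A
    + (\<Sum>j<length as. \<Sum>r=1..i. (of_nat (as ! j) - of_nat i + 2 * of_nat r)
        * newton_prod ((i - r) # as[j := as ! j + r]) A)"
proof -
  have "sd_term i as A =
     (\<Sum>p\<in>UNIV. \<Sum>q\<in>UNIV. newton_deriv i A (unit_mat p q) $ p $ q) * newton_prod as A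
     + (\<Sum>p\<in>UNIV. \<Sum>q\<in>UNIV. newton_mat i A $ p $ q * newton_prod_deriv as A (unit_mat p q))
     - (trace (newton_deriv i A (scalar_mat 1)) * newton_prod as A
        + trace (newton_mat i A) * newton_prod_deriv as A (scalar_mat 1))
       / of_nat CARD('n)"
    by (simp add: sd_term_def sum.distrib sum_distrib_right)
  moreover define R where "R = (\<Sum>j<length as. \<Sum>r=1..i. (of_nat (as ! j) - of_nat i + 2 * of_nat r)
        * newton_prod ((i - r) # as[j := as ! j + r]) A)"
  ultimately have "sd_term i as A =
     (- of_nat i * newton_coeff i A * of_nat CARD('n) - (of_nat i - 1) * (- of_nat i * newton_coeff i A))
       * newton_prod as A
     + (- of_nat (i * length as) * newton_coeff i A * newton_prod as A + R)
     - (of_nat i * (- of_nat i * newton_coeff i A) * newton_prod as A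
        + - of_nat i * newton_coeff i A * (of_nat (sum_list as) * newton_prod as A)) / of_nat CARD('n)"
    using newton_prod_deriv_contraction[of A i as] newton_deriv_contraction[of "scalar_mat 1" i A]
    by (simp add: trace_newton_deriv trace_newton_mat newton_prod_deriv_one trace_I)
  then show ?thesis
    unfolding R_def[symmetric] by (simp add: algebra_simps add_divide_distrib diff_divide_distrib)
qed

lemma sum_list_eq_max:
  fixes N :: nat
  assumes "\<forall>a\<in>set as. a \<le> N" "sum_list as \<ge> N * length as"
  shows "as = replicate (length as) N"
  using assms
proof (induction as)
  case (Cons a as)
  have "sum_list as \<le> N * length as"
    using sum_list_mono[of as "\<lambda>a. a" "\<lambda>_. N"] Cons.prems(1) by (simp add: sum_list_triv mult.commute)
  then have "a = N \<and> sum_list as \<ge> N * length as" using Cons.prems by auto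
  then show ?case using Cons by auto
qed simp

text \<open>The recursion lowers the first entry until it is \<open>0\<close>, where the entry can be dropped; its
  leading factor vanishes only when all entries are maximal.\<close>

lemma recursion_unique:
  fixes c :: "nat list \<Rightarrow> complex"
  assumes N: "N \<ge> 1"
    and c0: "\<And>as. length as < K \<Longrightarrow> c (0 # as) = c as"
    and cN: "\<And>as. length as \<le> K \<Longrightarrow> \<exists>a\<in>set as. a > N \<Longrightarrow> c as = 0"
    and rec: "\<And>i as. length as < K \<Longrightarrow>
      of_nat i * (of_nat N + of_nat (Suc (length as)) - of_nat i
        - of_nat (i + sum_list as) / of_nat N) * c (i # as)
      = (\<Sum>j<length as. \<Sum>r=1..i. (of_nat (as ! j) - of_nat i + 2 * of_nat r)
          * c ((i - r) # as[j := as ! j + r]))"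
    and cmax: "\<And>n. n \<le> K \<Longrightarrow> c (replicate n N) = 0"
    and len: "length as \<le> K"
  shows "c as = 0"
  using len
proof (induction "length as" arbitrary: as)
  case 0
  then show ?case using cmax[of 0] by simp
next
  case (Suc n)
  have "c (i # bs) = 0" if "length bs = n" for i bs
    using that
  proof (induction i arbitrary: bs rule: less_induct)
    case (less i)
    have lb: "length bs < K" using less.prems Suc by simp
    consider "i = 0" | "\<exists>a\<in>set (i # bs). a > N" | "i # bs = replicate (Suc n) N"
      | "i > 0" "\<forall>a\<in>set (i # bs). a \<le> N" "i # bs \<noteq> replicate (Suc n) N" by force
    then show ?case
    proof cases
      case 1
      then show ?thesis using c0[of bs] lb less.prems Suc by simp
    next
      case 2
      then show ?thesis using cN[of "i # bs"] lb by simp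
    next
      case 3
      then show ?thesis using cmax[of "Suc n"] lb less.prems by simp
    next
      case 4
      have "(\<Sum>j<length bs. \<Sum>r=1..i. (of_nat (bs ! j) - of_nat i + 2 * of_nat r)
          * c ((i - r) # bs[j := bs ! j + r])) = 0"
        using less 4 by (intro sum.neutral ballI) simp
      then have z: "of_nat i * (of_nat N + of_nat (Suc (length bs)) - of_nat i
        - of_nat (i + sum_list bs) / of_nat N) * c (i # bs) = 0"
        using rec[OF lb, of i] by simp
      \<comment> \<open>Not all entries are maximal, so the total is strictly below
        \<open>N * Suc n\<close>, and its quotient by \<open>N\<close> is below
        \<open>Suc n\<close>. Together with \<open>i \<le> N\<close> this makes the leading factor
        positive.\<close>
      have lt: "i + sum_list bs < N * Suc n"
        using sum_list_eq_max[of "i # bs" N] 4 less.prems by fastforce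
      have "i \<le> N" using 4 by simp
      then have "i + sum_list bs + N * i < N * Suc n + N * N"
        by (intro add_less_le_mono lt mult_le_mono2)
      then have "i + sum_list bs + N * i < N * N + N * Suc n"
        by (simp only: add.commute[of "N * N"])
      then have "real (i + sum_list bs) + real N * real i < real N * real N + real N * real (Suc n)"
        by (metis of_nat_add of_nat_less_iff of_nat_mult)
      then have "real N + real (Suc n) - real i - real (i + sum_list bs) / real N > 0"
        using N by (simp add: field_simps)
      then have "complex_of_real (real N + real (Suc n) - real i - real (i + sum_list bs) / real N) \<noteq> 0"
        by (metis of_real_eq_0_iff less_irrefl)
      then show ?thesis using z 4 less.prems by (auto simp del: of_nat_Suc of_nat_add)
    qed
  qed
  then show ?case using Suc by (cases as) auto
qed

section \<open>Derivatives and the characteristic polynomial\<close>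

text \<open>The hypothesis says that \<open>B\<close> follows the flow of left multiplication by
  \<open>exp (s X)\<close>. Matrix and coefficient must be differentiated together, since each is
  defined from the other one step earlier; \<open>trace_newton_deriv\<close> closes the
  induction.\<close>

lemma newton_has_derivative:
  fixes B :: "complex \<Rightarrow> complex^'n^'n"
  assumes B: "\<And>p q. ((\<lambda>s. B s $ p $ q) has_field_derivative (X ** B s) $ p $ q) (at s)"
  shows "((\<lambda>s. newton_mat i (B s) $ p $ q) has_field_derivative newton_deriv i (B s) X $ p $ q) (at s)"
    and "((\<lambda>s. newton_coeff i (B s)) has_field_derivative - trace (X ** newton_mat i (B s))) (at s)"
proof (induction i arbitrary: p q)
  case 0
  { case 1 show ?case by simp }
  { case 2 show ?case by (simp add: trace_0[unfolded mat_0]) }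
next
  case (Suc i)
  have mat: "((\<lambda>s. newton_mat (Suc i) (B s) $ p $ q) has_field_derivative newton_deriv (Suc i) (B s) X $ p $ q) (at s)" for p q
  proof -
    have "((\<lambda>s. newton_coeff i (B s) * B s $ p $ q + (\<Sum>r\<in>UNIV. B s $ p $ r * newton_mat i (B s) $ r $ q))
      has_field_derivative
        (- trace (X ** newton_mat i (B s)) * B s $ p $ q + newton_coeff i (B s) * (X ** B s) $ p $ q
        + (\<Sum>r\<in>UNIV. (X ** B s) $ p $ r * newton_mat i (B s) $ r $ q + B s $ p $ r * newton_deriv i (B s) X $ r $ q))) (at s)"
      by (rule DERIV_cong, rule DERIV_add[OF DERIV_mult[OF Suc(2) B] DERIV_sum[OF DERIV_mult[OF B Suc(1)]]])
         (simp add: mult.commute)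
    moreover have "newton_deriv (Suc i) (B s) X $ p $ q =
       (- trace (X ** newton_mat i (B s)) * B s $ p $ q + newton_coeff i (B s) * (X ** B s) $ p $ q
        + (\<Sum>r\<in>UNIV. (X ** B s) $ p $ r * newton_mat i (B s) $ r $ q + B s $ p $ r * newton_deriv i (B s) X $ r $ q))"
    proof -
      have "newton_deriv (Suc i) (B s) X = scale_mat (newton_coeff i (B s)) (X ** B s) + X ** B s ** newton_mat i (B s)
        - scale_mat (trace (X ** newton_mat i (B s))) (B s) + B s ** newton_deriv i (B s) X"
        by (simp add: newton_mat_Suc matrix_add_ldistrib scale_mat_mult_right matrix_mul_assoc)
      then show ?thesis
        by (simp add: sum.distrib matrix_matrix_mult_def[of "X ** B s"] matrix_matrix_mult_def[of "B s"])
    qed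
    moreover have "(\<lambda>s. newton_mat (Suc i) (B s) $ p $ q) =
      (\<lambda>s. newton_coeff i (B s) * B s $ p $ q + (\<Sum>r\<in>UNIV. B s $ p $ r * newton_mat i (B s) $ r $ q))"
      by (simp add: newton_mat_Suc matrix_matrix_mult_def)
    ultimately show ?thesis by (simp only:)
  qed
  { case 1 show ?case by (rule mat) }
  { case 2
    have ne: "of_nat (Suc i) \<noteq> (0::complex)" by (rule of_nat_neq_0)
    have "((\<lambda>s. - trace (newton_mat (Suc i) (B s)) / of_nat (Suc i)) has_field_derivative
      - trace (newton_deriv (Suc i) (B s) X) / of_nat (Suc i)) (at s)"
      unfolding Determinants.trace_def by (intro DERIV_cdivide DERIV_minus DERIV_sum mat)
    then show ?case
      unfolding newton_coeff_Suc trace_newton_deriv using ne by (simp del: of_nat_Suc) }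
qed

lemma newton_prod_has_derivative:
  fixes B :: "complex \<Rightarrow> complex^'n^'n"
  assumes B: "\<And>p q. ((\<lambda>s. B s $ p $ q) has_field_derivative (X ** B s) $ p $ q) (at s)"
  shows "((\<lambda>s. newton_prod as (B s)) has_field_derivative newton_prod_deriv as (B s) X) (at s)"
  by (induction as) (auto intro!: derivative_eq_intros newton_has_derivative[OF B])

section \<open>Continuity of the polynomial functions of a matrix\<close>

lemma continuous_on_matrix:
  fixes F :: "'a::topological_space \<Rightarrow> complex^'n^'n"
  assumes "\<And>p q. continuous_on S (\<lambda>x. F x $ p $ q)"
  shows "continuous_on S F"
proof -
  have "continuous_on S (\<lambda>x. \<chi> p. \<chi> q. F x $ p $ q)"
    by (intro continuous_on_vec_lambda assms)
  then show ?thesis by simp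
qed

lemma continuous_on_mult_matrix [continuous_intros]:
  fixes F G :: "'a::topological_space \<Rightarrow> complex^'n^'n"
  assumes "continuous_on S F" "continuous_on S G"
  shows "continuous_on S (\<lambda>x. F x ** G x)"
  by (rule continuous_on_matrix) (simp add: matrix_matrix_mult_def, intro continuous_intros assms)

lemma continuous_on_scale_mat [continuous_intros]:
  fixes F :: "'a::topological_space \<Rightarrow> complex^'n^'n"
  assumes "continuous_on S c" "continuous_on S F"
  shows "continuous_on S (\<lambda>x. scale_mat (c x) (F x))"
  by (rule continuous_on_matrix) (simp, intro continuous_intros assms)

lemma continuous_on_trace [continuous_intros]:
  fixes F :: "'a::topological_space \<Rightarrow> complex^'n^'n"
  assumes "continuous_on S F"
  shows "continuous_on S (\<lambda>x. trace (F x))"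
  unfolding Determinants.trace_def by (intro continuous_intros assms)

lemma continuous_on_newton_aux:
  "continuous_on UNIV (newton_coeff i :: complex^'n^'n \<Rightarrow> complex) \<and>
   continuous_on UNIV (newton_mat i :: complex^'n^'n \<Rightarrow> _)"
proof (induction i)
  case 0
  show ?case by (simp add: newton_coeff_0[abs_def] newton_mat_0[abs_def] continuous_on_const)
next
  case (Suc i)
  have "continuous_on UNIV (newton_mat (Suc i) :: complex^'n^'n \<Rightarrow> _)"
    unfolding newton_mat_Suc[abs_def] using Suc by (intro continuous_intros) auto
  then show ?case
    unfolding newton_coeff_Suc[abs_def] by (auto intro!: continuous_intros simp del: of_nat_Suc)
qed

lemma continuous_on_newton [continuous_intros]:
  fixes F :: "'a::topological_space \<Rightarrow> complex^'n^'n"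
  assumes F: "continuous_on S F"
  shows "continuous_on S (\<lambda>x. newton_coeff i (F x))" "continuous_on S (\<lambda>x. newton_mat i (F x))"
  using continuous_on_newton_aux
  by (auto intro!: continuous_on_compose2[OF _ F])

lemma continuous_on_newton_deriv [continuous_intros]:
  fixes F :: "'a::topological_space \<Rightarrow> complex^'n^'n"
  assumes F: "continuous_on S F"
  shows "continuous_on S (\<lambda>x. newton_deriv i (F x) X)"
  by (induction i) (auto intro!: continuous_intros F)

lemma continuous_on_newton_prod [continuous_intros]:
  fixes F :: "'a::topological_space \<Rightarrow> complex^'n^'n"
  assumes F: "continuous_on S F"
  shows "continuous_on S (\<lambda>x. newton_prod as (F x))"
  by (induction as) (auto intro!: continuous_intros F)

lemma continuous_on_newton_prod_deriv [continuous_intros]: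
  fixes F :: "'a::topological_space \<Rightarrow> complex^'n^'n"
  assumes F: "continuous_on S F"
  shows "continuous_on S (\<lambda>x. newton_prod_deriv as (F x) X)"
  by (induction as) (auto intro!: continuous_intros F)

section \<open>Jacobi's formula and Newton's identities for \<open>det (1 - s A)\<close>\<close>

lemma has_field_derivative_det:
  fixes M :: "complex \<Rightarrow> complex^'n^'n"
  assumes M: "\<And>p q. ((\<lambda>s. M s $ p $ q) has_field_derivative M' $ p $ q) (at s)"
  shows "((\<lambda>s. cdet (M s)) has_field_derivative
    (\<Sum>k\<in>UNIV. cdet (\<chi> a. if a = k then M' $ a else M s $ a))) (at s)"
proof -
  have prod: "((\<lambda>s. \<Prod>a\<in>UNIV. M s $ a $ \<sigma> a) has_field_derivative
     (\<Sum>k\<in>UNIV. \<Prod>a\<in>UNIV. (if a = k then M' $ a else M s $ a) $ \<sigma> a)) (at s)" for \<sigma>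
  proof -
    have "((\<lambda>s. \<Prod>a\<in>UNIV. M s $ a $ \<sigma> a) has_field_derivative
     (\<Sum>k\<in>UNIV. M' $ k $ \<sigma> k * (\<Prod>a\<in>UNIV - {k}. M s $ a $ \<sigma> a))) (at s)"
      by (rule has_field_derivative_prod[THEN DERIV_cong]) (auto intro!: M)
    moreover have "(\<Prod>a\<in>UNIV. (if a = k then M' $ a else M s $ a) $ \<sigma> a) =
      M' $ k $ \<sigma> k * (\<Prod>a\<in>UNIV - {k}. M s $ a $ \<sigma> a)" for k
      by (subst prod.remove[of _ k]) (auto intro!: prod.cong)
    ultimately show ?thesis by simp
  qed
  show ?thesis
    unfolding Determinants.det_def
    by (rule DERIV_cong[OF DERIV_sum[OF DERIV_cmult[OF prod]]])
       (simp add: sum_distrib_left sum.swap[of _ UNIV])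
qed

text \<open>Row \<open>k\<close> of \<open>P ** M\<close> is a combination of the rows of
  \<open>M\<close>, and only its multiple of row \<open>k\<close> itself survives in the
  determinant. Summed over \<open>k\<close> this yields \<open>trace P * cdet M\<close>, the form of
  Jacobi's formula used below.\<close>

lemma det_replace_row_combination:
  fixes M P :: "complex^'n^'n"
  shows "cdet (\<chi> a. if a = k then (P ** M) $ a else M $ a) = P $ k $ k * cdet M"
proof -
  have "(\<chi> a. if a = k then (P ** M) $ a else M $ a) =
     (\<chi> i. if i = k then sum (\<lambda>i. (P $ k) $ i *s Finite_Cartesian_Product.row i M) UNIV else Finite_Cartesian_Product.row i M)"
    by (auto simp: matrix_eq_iff Finite_Cartesian_Product.row_def matrix_matrix_mult_def sum_component)
  then show ?thesis using cramer_lemma_transpose[of k "P $ k" M] by simp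
qed

lemma poly_det: "poly (cdet M) s = cdet (\<chi> p q. poly (M $ p $ q) s)"
  for M :: "complex poly^'n^'n"
proof -
  have "poly (of_int k :: complex poly) s = of_int k" for k
    by (simp add: poly_of_int)
  then show ?thesis
    unfolding Determinants.det_def by (simp add: poly_sum poly_prod)
qed

definition rev_charpoly :: "complex^'n^'n \<Rightarrow> complex poly" where
  "rev_charpoly A = cdet (\<chi> p q. [:if p = q then 1 else 0, - A $ p $ q:])"

lemma poly_rev_charpoly: "poly (rev_charpoly A) s = cdet (scalar_mat 1 - scale_mat s A)"
  unfolding rev_charpoly_def poly_det
  by (rule arg_cong[where f = cdet]) (simp add: matrix_eq_iff scalar_mat_def)

lemma degree_rev_charpoly: "degree (rev_charpoly (A :: complex^'n^'n)) \<le> CARD('n)"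
proof -
  let ?e = "\<lambda>\<sigma> i. (\<chi> p q. [:if p = q then 1 else 0, - A $ p $ q:]) $ i $ \<sigma> i"
  have "degree (of_int (sign \<sigma>) * (\<Prod>i\<in>UNIV. ?e \<sigma> i)) \<le> CARD('n)"
    for \<sigma> :: "'n \<Rightarrow> 'n"
  proof -
    have "degree (\<Prod>i\<in>UNIV. ?e \<sigma> i)
      \<le> (\<Sum>i\<in>UNIV. degree (?e \<sigma> i))"
      using degree_prod_sum_le[of UNIV "\<lambda>i. ?e \<sigma> i"]
      by (simp add: o_def)
    also have "\<dots> \<le> (\<Sum>i\<in>(UNIV::'n set). 1)"
      by (intro sum_mono) (simp add: degree_pCons_eq_if)
    finally have "degree (\<Prod>i\<in>UNIV. ?e \<sigma> i) \<le> CARD('n)"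
      by simp
    then show ?thesis
      by (simp add: sign_def)
  qed
  then show ?thesis
    unfolding rev_charpoly_def Determinants.det_def by (intro degree_sum_le) auto
qed

text \<open>Newton's identities follow by differentiating \<open>cdet (1 - s A)\<close>. The inverse
  of \<open>1 - s A\<close> in Jacobi's formula is replaced by a truncated Neumann series, so
  singular matrices need no separate treatment.\<close>

lemma coeff_rev_charpoly_Suc:
  fixes A :: "complex^'n^'n"
  shows "of_nat (Suc i) * coeff (rev_charpoly A) (Suc i) =
    - (\<Sum>k\<le>i. coeff (rev_charpoly A) (i - k) * trace (mat_pow A (Suc k)))"
proof -
  let ?M = "\<lambda>s. scalar_mat 1 - scale_mat s A"
  \<comment> \<open>With \<open>Suc i\<close> terms of the Neumann series the remainder carries the
    factor \<open>s ^ Suc i\<close>, which does not reach the coefficient of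
    \<open>s ^ i\<close>.\<close>
  define K where "K = Suc i"
  define P where "P s = (\<Sum>k<K. scale_mat (s ^ k) (mat_pow A (Suc k)))" for s
  have PM: "P s ** ?M s = A - scale_mat (s ^ K) (mat_pow A (Suc K))" for s
    unfolding P_def
  proof (induction K)
    case (Suc K)
    have "scale_mat (s ^ K) (mat_pow A (Suc K)) ** ?M s =
       scale_mat (s ^ K) (mat_pow A (Suc K)) - scale_mat (s ^ Suc K) (mat_pow A (Suc (Suc K)))"
      by (simp add: matrix_diff_ldist scale_mat_mult_left scale_mat_mult_right mat_pow_commute
          matrix_mul_assoc matrix_eq_iff)
    then show ?case using Suc by (simp add: matrix_add_rdist)
  qed (simp add: matrix_eq_iff)
  define R where "R = (\<Sum>k\<in>UNIV. cdet (\<chi> a b. if a = k then [:mat_pow A (Suc K) $ a $ b:] else [:if a = b then 1 else 0, - A $ a $ b:]))"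
  have R: "poly R s = (\<Sum>k\<in>UNIV. cdet (\<chi> a. if a = k then mat_pow A (Suc K) $ a else ?M s $ a))" for s
    unfolding R_def poly_sum poly_det
    by (intro sum.cong refl arg_cong[where f = cdet])
       (auto simp: matrix_eq_iff scalar_mat_def)
  have deriv: "poly (pderiv (rev_charpoly A)) s = - trace (P s) * poly (rev_charpoly A) s - s ^ K * poly R s" for s
  proof -
    have row: "cdet (\<chi> a. if a = k then (- A) $ a else ?M s $ a) =
      - (P s $ k $ k) * cdet (?M s)
      - s ^ K * cdet (\<chi> a. if a = k then mat_pow A (Suc K) $ a else ?M s $ a)" for k
    proof -
      \<comment> \<open>The derivative \<open>- A\<close> of \<open>1 - s A\<close> is split into a
        left multiple of that matrix and the remainder of the series; multilinearity in row
        \<open>k\<close> separates the two.\<close>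
      have A: "(- A) $ a = (scale_mat (-1) (P s) ** ?M s) $ a + (- (s ^ K)) *s (mat_pow A (Suc K) $ a)" for a
        unfolding scale_mat_mult_left PM by (simp add: matrix_eq_iff)
      show ?thesis unfolding A Determinants.det_row_add Determinants.det_row_mul det_replace_row_combination by simp
    qed
    have "((\<lambda>s. cdet (?M s)) has_field_derivative
      (\<Sum>k\<in>UNIV. cdet (\<chi> a. if a = k then (- A) $ a else ?M s $ a))) (at s)"
      by (rule has_field_derivative_det) (auto intro!: derivative_eq_intros)
    moreover have "((\<lambda>s. cdet (?M s)) has_field_derivative poly (pderiv (rev_charpoly A)) s) (at s)"
      unfolding poly_rev_charpoly[symmetric] by (rule poly_DERIV)
    ultimately have "poly (pderiv (rev_charpoly A)) s = (\<Sum>k\<in>UNIV. cdet (\<chi> a. if a = k then (- A) $ a else ?M s $ a))"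
      by (rule DERIV_unique[rotated])
    then show ?thesis
      unfolding row R poly_rev_charpoly
      by (simp add: sum_subtractf sum_negf sum_distrib_left sum_distrib_right Determinants.trace_def)
  qed
  let ?T = "\<Sum>k<K. monom (trace (mat_pow A (Suc k))) k"
  have "pderiv (rev_charpoly A) = - ?T * rev_charpoly A - monom 1 K * R"
    unfolding poly_eq_poly_eq_iff[symmetric] fun_eq_iff deriv
    by (simp add: P_def trace_sum trace_scale_mat poly_sum poly_monom mult_ac del: mat_pow.simps)
  then have "coeff (pderiv (rev_charpoly A)) i = coeff (- ?T * rev_charpoly A - monom 1 K * R) i"
    by simp
  also have "\<dots> = - (\<Sum>k<K. coeff (rev_charpoly A) (i - k) * trace (mat_pow A (Suc k)))"
  proof -
    have "coeff (?T * rev_charpoly A) i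
      = (\<Sum>k<K. coeff (monom (trace (mat_pow A (Suc k))) k * rev_charpoly A) i)"
      by (simp only: sum_distrib_right coeff_sum)
    also have "\<dots> = (\<Sum>k<K. coeff (rev_charpoly A) (i - k) * trace (mat_pow A (Suc k)))"
      by (intro sum.cong refl) (simp add: K_def coeff_monom_mult del: mat_pow.simps)
    finally have "coeff (- ?T * rev_charpoly A) i
      = - (\<Sum>k<K. coeff (rev_charpoly A) (i - k) * trace (mat_pow A (Suc k)))"
      by (simp only: mult_minus_left coeff_minus)
    moreover have "coeff (monom 1 K * R) i = 0"
      by (simp add: K_def coeff_monom_mult)
    ultimately show ?thesis by (simp only: coeff_diff diff_zero)
  qed
  finally show ?thesis by (simp add: coeff_pderiv K_def lessThan_Suc_atMost del: of_nat_Suc)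
qed

text \<open>Both sequences start at \<open>1\<close> and obey Newton's identities, which determine
  each term from the earlier ones after division by its index. This gives access to the degree bound
  and to the determinant.\<close>

lemma newton_coeff_eq_coeff: "newton_coeff i A = coeff (rev_charpoly A) i"
proof (induction i rule: less_induct)
  case (less i)
  show ?case
  proof (cases i)
    case 0
    have "coeff (rev_charpoly A) 0 = poly (rev_charpoly A) 0" by (simp add: poly_0_coeff_0)
    also have "scalar_mat 1 - scale_mat 0 A = scalar_mat 1"
      by (simp add: matrix_eq_iff)
    then have "poly (rev_charpoly A) 0 = 1"
      unfolding poly_rev_charpoly by simp
    finally show ?thesis using 0 by simp
  next
    case (Suc j)
    have "trace (newton_mat (Suc j) A) = (\<Sum>k=1..Suc j. newton_coeff (Suc j - k) A * trace (mat_pow A k))"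
      using trace_mult_newton_mat[of "scalar_mat 1" A 0 "Suc j"] by simp
    also have "\<dots> = (\<Sum>k\<le>j. newton_coeff (j - k) A * trace (mat_pow A (Suc k)))"
      by (rule sum.reindex_bij_witness[of _ Suc "\<lambda>k. k - 1"]) auto
    also have "\<dots> = (\<Sum>k\<le>j. coeff (rev_charpoly A) (j - k) * trace (mat_pow A (Suc k)))"
      using less Suc by (intro sum.cong refl) simp
    also have "\<dots> = - (of_nat (Suc j) * coeff (rev_charpoly A) (Suc j))"
      by (simp add: coeff_rev_charpoly_Suc del: mat_pow.simps of_nat_Suc)
    finally have "of_nat (Suc j) * newton_coeff (Suc j) A = of_nat (Suc j) * coeff (rev_charpoly A) (Suc j)"
      unfolding trace_newton_mat by (simp del: of_nat_Suc)
    then show ?thesis unfolding Suc by (simp del: of_nat_Suc)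
  qed
qed

lemma newton_coeff_eq_0: "i > CARD('n) \<Longrightarrow> newton_coeff i (A :: complex^'n^'n) = 0"
  using degree_rev_charpoly[of A] by (simp add: newton_coeff_eq_coeff coeff_eq_0)

lemma poly_charpoly: "poly (charpoly A) u = cdet (scalar_mat u - A)"
  unfolding charpoly_def poly_det
  by (rule arg_cong[where f = cdet])
     (auto simp: matrix_eq_iff scalar_mat_def map_matrix_def)

lemma det_scale_mat: "cdet (scale_mat c A) = c ^ CARD('n) * cdet (A :: complex^'n^'n)"
  by (simp add: Determinants.det_def prod.distrib sum_distrib_left mult_ac)

text \<open>For \<open>u \<noteq> 0\<close> one has
  \<open>det (u - A) = u ^ N * det (1 - A / u)\<close>, and two polynomials that agree off
  \<open>0\<close> coincide.\<close>

lemma charpoly_eq_sum: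
  fixes A :: "complex^'n^'n"
  shows "charpoly A = (\<Sum>i\<le>CARD('n). monom (newton_coeff i A) (CARD('n) - i))"
proof -
  let ?S = "\<Sum>i\<le>CARD('n). monom (newton_coeff i A) (CARD('n) - i)"
  have "poly (charpoly A) u = poly ?S u" if "u \<noteq> 0" for u
  proof -
    have "scalar_mat u - A = scale_mat u (scalar_mat 1 - scale_mat (inverse u) A)"
      using that by (auto simp: matrix_eq_iff scalar_mat_def algebra_simps)
    then have "poly (charpoly A) u = u ^ CARD('n) * poly (rev_charpoly A) (inverse u)"
      by (simp add: poly_charpoly det_scale_mat poly_rev_charpoly)
    also have "poly (rev_charpoly A) (inverse u) = (\<Sum>i\<le>CARD('n). newton_coeff i A * inverse u ^ i)"
      unfolding newton_coeff_eq_coeff poly_altdef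
      by (rule sum.mono_neutral_left) (use degree_rev_charpoly[of A] in \<open>auto simp: coeff_eq_0\<close>)
    also have "u ^ CARD('n) * \<dots> = (\<Sum>i\<le>CARD('n). newton_coeff i A * u ^ (CARD('n) - i))"
      unfolding sum_distrib_left using that by (intro sum.cong) (auto simp: power_diff field_simps)
    finally show ?thesis by (simp add: poly_sum poly_monom)
  qed
  then have "- {0} \<subseteq> {u. poly (charpoly A - ?S) u = 0}"
    by (intro subsetI) (simp add: poly_diff)
  moreover have "infinite (- {0 :: complex})"
    by (simp add: infinite_UNIV_char_0)
  ultimately have "infinite {u. poly (charpoly A - ?S) u = 0}"
    by (rule infinite_super)
  then have "charpoly A - ?S = 0"
    using poly_roots_finite by blast
  then show ?thesis by simp
qed

lemma coeff_charpoly: "coeff (charpoly (A :: complex^'n^'n)) CARD('n) = 1"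
proof -
  have "coeff (charpoly A) CARD('n) = (\<Sum>i\<le>CARD('n). if i = 0 then newton_coeff i A else 0)"
    unfolding charpoly_eq_sum coeff_sum coeff_monom by (intro sum.cong) auto
  then show ?thesis by simp
qed

lemma degree_charpoly: "degree (charpoly (A :: complex^'n^'n)) = CARD('n)"
proof (rule antisym)
  show "degree (charpoly A) \<le> CARD('n)"
    unfolding charpoly_eq_sum by (intro degree_sum_le) (auto intro: order_trans[OF degree_monom_le])
  show "CARD('n) \<le> degree (charpoly A)"
    using coeff_charpoly[of A] by (intro le_degree) simp
qed

lemma charpoly_eq_prod: "charpoly A = (\<Prod>z\<in>#eigenvalues A. [:- z, 1:])"
  using complex_poly_decompose_multiset[of "charpoly A"] coeff_charpoly[of A]
  by (simp add: eigenvalues_def degree_charpoly)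

lemma size_eigenvalues: "size (eigenvalues (A :: complex^'n^'n)) = CARD('n)"
  by (simp add: eigenvalues_def size_proots_complex degree_charpoly)

section \<open>Unitary groups\<close>

lemma conj_transpose_nth [simp]: "conj_transpose A $ p $ q = cnj (A $ q $ p)"
  by (simp add: conj_transpose_def map_matrix_def Finite_Cartesian_Product.transpose_def)

lemma conj_transpose_mult: "conj_transpose (A ** B) = conj_transpose B ** conj_transpose A"
  by (simp add: matrix_eq_iff matrix_matrix_mult_def mult.commute)

lemma conj_transpose_conj_transpose [simp]: "conj_transpose (conj_transpose A) = A"
  by (simp add: matrix_eq_iff)

lemma continuous_on_conj_transpose [continuous_intros]:
  fixes F :: "'a::topological_space \<Rightarrow> complex^'n^'n"
  assumes "continuous_on S F"
  shows "continuous_on S (\<lambda>x. conj_transpose (F x))"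
  by (rule continuous_on_matrix) (simp, intro continuous_intros assms)

lemma unitary_group_mult: "A \<in> unitary_group \<Longrightarrow> B \<in> unitary_group \<Longrightarrow> A ** B \<in> unitary_group"
proof -
  assume A: "A \<in> unitary_group" and B: "B \<in> unitary_group"
  have "A ** B ** (conj_transpose B ** conj_transpose A) = A ** (B ** conj_transpose B) ** conj_transpose A"
    by (simp only: matrix_mul_assoc)
  moreover have "conj_transpose B ** conj_transpose A ** (A ** B) = conj_transpose B ** (conj_transpose A ** A) ** B"
    by (simp only: matrix_mul_assoc)
  ultimately show ?thesis using A B by (simp add: unitary_group_def conj_transpose_mult)
qed

lemma unitary_group_conj_transpose: "A \<in> unitary_group \<Longrightarrow> conj_transpose A \<in> unitary_group"
  by (simp add: unitary_group_def)

lemma det_conj_transpose: "cdet (conj_transpose A) = cnj (cdet A)"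
proof -
  have "conj_transpose A = Finite_Cartesian_Product.transpose (map_matrix cnj A)"
    by (simp add: matrix_eq_iff Finite_Cartesian_Product.transpose_def map_matrix_def)
  moreover have "cnj (of_int k) = of_int k" for k by simp
  ultimately show ?thesis
    by (simp add: det_transpose) (simp add: Determinants.det_def map_matrix_def)
qed

lemma norm_det_unitary: "A \<in> unitary_group \<Longrightarrow> norm (cdet A) = 1"
proof -
  assume "A \<in> unitary_group"
  then have "cdet A * cnj (cdet A) = 1"
    using det_mul[of A "conj_transpose A"] by (simp add: unitary_group_def det_conj_transpose)
  then have "complex_of_real ((norm (cdet A))\<^sup>2) = 1"
    by (simp only: complex_norm_square)
  then have "(norm (cdet A))\<^sup>2 = 1"
    using of_real_eq_1_iff by blast
  then show ?thesis using norm_ge_zero[of "cdet A"] by (auto simp: power2_eq_1_iff)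
qed

lemma special_unitary_group_mult:
  "A \<in> special_unitary_group \<Longrightarrow> B \<in> special_unitary_group \<Longrightarrow> A ** B \<in> special_unitary_group"
  by (simp add: special_unitary_group_def unitary_group_mult det_mul)

lemma special_unitary_group_conj_transpose:
  "A \<in> special_unitary_group \<Longrightarrow> conj_transpose A \<in> special_unitary_group"
  by (simp add: special_unitary_group_def unitary_group_conj_transpose det_conj_transpose)

lemma norm_unitary_entry_le: "A \<in> unitary_group \<Longrightarrow> norm (A $ p $ q) \<le> 1"
proof -
  assume "A \<in> unitary_group"
  then have "(A ** conj_transpose A) $ p $ p = 1"
    by (simp add: unitary_group_def scalar_mat_def)
  then have "complex_of_real (\<Sum>r\<in>UNIV. (norm (A $ p $ r))\<^sup>2) = 1"
    by (simp add: matrix_matrix_mult_def complex_norm_square del: of_real_power)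
  then have "(\<Sum>r\<in>UNIV. (norm (A $ p $ r))\<^sup>2) = 1"
    using of_real_eq_1_iff by blast
  moreover have "(norm (A $ p $ q))\<^sup>2 \<le> (\<Sum>r\<in>UNIV. (norm (A $ p $ r))\<^sup>2)"
    by (rule member_le_sum) auto
  ultimately show ?thesis by (simp add: abs_square_le_1)
qed

lemma compact_unitary_group: "compact (unitary_group :: (complex^'n^'n) set)"
proof -
  have "bounded (unitary_group :: (complex^'n^'n) set)"
  proof (rule boundedI)
    fix A :: "complex^'n^'n" assume A: "A \<in> unitary_group"
    have "norm A \<le> (\<Sum>p\<in>UNIV. norm (A $ p))"
      unfolding norm_vec_def[of A] by (rule L2_set_le_sum) simp
    also have "\<dots> \<le> (\<Sum>p\<in>UNIV. \<Sum>q\<in>UNIV. norm (A $ p $ q))"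
      by (intro sum_mono) (unfold norm_vec_def[of "A $ _"], rule L2_set_le_sum, simp)
    also have "\<dots> \<le> (\<Sum>p\<in>(UNIV::'n set). \<Sum>q\<in>(UNIV::'n set). 1)"
      by (intro sum_mono norm_unitary_entry_le A)
    finally show "norm A \<le> (\<Sum>p\<in>(UNIV::'n set). \<Sum>q\<in>(UNIV::'n set). 1)" .
  qed
  moreover have "closed (unitary_group :: (complex^'n^'n) set)"
    unfolding unitary_group_def Collect_conj_eq
    by (intro closed_Int closed_Collect_eq continuous_intros)
  ultimately show ?thesis by (simp add: compact_eq_bounded_closed)
qed

lemma bounded_on_unitary:
  fixes F :: "complex^'n^'n \<Rightarrow> complex"
  assumes "continuous_on unitary_group F"
  obtains b where "\<And>A. A \<in> unitary_group \<Longrightarrow> norm (F A) \<le> b"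
proof -
  have "bounded (F ` unitary_group)"
    by (intro compact_imp_bounded compact_continuous_image assms compact_unitary_group)
  then show ?thesis using that by (auto simp: bounded_iff)
qed

subsection \<open>Haar averages\<close>

definition unitary_subgroup :: "(complex^'n^'n) set \<Rightarrow> bool" where
  "unitary_subgroup G \<longleftrightarrow> G \<subseteq> unitary_group \<and> (\<forall>A\<in>G. \<forall>B\<in>G. A ** B \<in> G) \<and> (\<forall>A\<in>G. conj_transpose A \<in> G)"

lemma unitary_subgroup_unitary_group: "unitary_subgroup unitary_group"
  and unitary_subgroup_special_unitary_group: "unitary_subgroup special_unitary_group"
  by (auto simp: unitary_subgroup_def unitary_group_mult unitary_group_conj_transpose
      special_unitary_group_mult special_unitary_group_conj_transpose)
     (simp add: special_unitary_group_def)

lemma haar_space: "normalized_haar_measure G \<mu> \<Longrightarrow> space \<mu> = G"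
  by (drule normalized_haar_measure_def[THEN iffD1])
     (auto dest!: sets_eq_imp_space_eq simp: space_restrict_space)

lemma haar_integrable:
  fixes F :: "complex^'n^'n \<Rightarrow> complex"
  assumes \<mu>: "normalized_haar_measure G \<mu>" and G: "unitary_subgroup G"
    and F: "continuous_on unitary_group F"
  shows "integrable \<mu> F"
proof -
  interpret prob_space \<mu> using \<mu> by (simp add: normalized_haar_measure_def)
  obtain b where b: "\<And>A. A \<in> unitary_group \<Longrightarrow> norm (F A) \<le> b"
    using bounded_on_unitary[OF F] by blast
  have sub: "G \<subseteq> unitary_group" using G by (simp add: unitary_subgroup_def)
  have "F \<in> borel_measurable (restrict_space borel G)"
    by (intro borel_measurable_continuous_on_restrict continuous_on_subset[OF F sub])
  then have "F \<in> borel_measurable \<mu>"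
    using \<mu> by (simp add: normalized_haar_measure_def cong: measurable_cong_sets)
  then show ?thesis
    by (rule integrable_const_bound[where B = b, rotated])
       (use b sub haar_space[OF \<mu>] in auto)
qed

lemma haar_integral_translate:
  fixes F :: "complex^'n^'n \<Rightarrow> complex"
  assumes \<mu>: "normalized_haar_measure G \<mu>" and G: "unitary_subgroup G"
    and F: "continuous_on unitary_group F" and g: "g \<in> G"
  shows "(LINT A|\<mu>. F (g ** A)) = (LINT A|\<mu>. F A)"
proof -
  have sets: "sets \<mu> = sets (restrict_space borel G)" and sp: "space \<mu> = G"
    using \<mu> haar_space[OF \<mu>] by (simp_all add: normalized_haar_measure_def)
  have sub: "G \<subseteq> unitary_group" using G by (simp add: unitary_subgroup_def)
  have g': "conj_transpose g \<in> G" using G g by (simp add: unitary_subgroup_def)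
  have inv: "g ** conj_transpose g = scalar_mat 1" "conj_transpose g ** g = scalar_mat 1"
    using sub g by (auto simp: unitary_group_def)
  have meas: "(\<lambda>h. g ** h) \<in> measurable \<mu> \<mu>"
  proof -
    have "(\<lambda>h :: complex^'n^'n. g ** h) \<in> measurable borel borel"
      by (intro borel_measurable_continuous_onI continuous_intros)
    then have "(\<lambda>h. g ** h) \<in> measurable (restrict_space borel G) (restrict_space borel G)"
      using G g by (intro measurable_restrict_space3) (auto simp: unitary_subgroup_def)
    then show ?thesis by (simp add: sets cong: measurable_cong_sets)
  qed
  have "distr \<mu> \<mu> (\<lambda>h. g ** h) = \<mu>"
  proof (rule measure_eqI)
    fix S assume "S \<in> sets (distr \<mu> \<mu> (\<lambda>h. g ** h))"
    then have S: "S \<in> sets \<mu>" by simp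
    then have SG: "S \<subseteq> G" using sets.sets_into_space[OF S] sp by simp
    \<comment> \<open>Invariance is stated for images of sets, whereas the pushforward involves
      preimages; the preimage under \<open>g\<close> is the image under its inverse
      \<open>conj_transpose g\<close>.\<close>
    have "(\<lambda>h. g ** h) -` S \<inter> space \<mu> = (\<lambda>h. conj_transpose g ** h) ` S"
    proof (intro equalityI subsetI)
      fix h assume "h \<in> (\<lambda>h. g ** h) -` S \<inter> space \<mu>"
      then have "g ** h \<in> S" "h = conj_transpose g ** (g ** h)"
        using inv by (auto simp: matrix_mul_assoc)
      then show "h \<in> (\<lambda>h. conj_transpose g ** h) ` S" by blast
    next
      fix h assume "h \<in> (\<lambda>h. conj_transpose g ** h) ` S"
      then obtain k where k: "k \<in> S" "h = conj_transpose g ** k" by blast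
      then have "g ** h = k" using inv by (simp add: matrix_mul_assoc)
      then show "h \<in> (\<lambda>h. g ** h) -` S \<inter> space \<mu>"
        using k SG g' G sp by (auto simp: unitary_subgroup_def)
    qed
    then show "emeasure (distr \<mu> \<mu> (\<lambda>h. g ** h)) S = emeasure \<mu> S"
      using \<mu> g' S by (simp add: emeasure_distr[OF meas S] normalized_haar_measure_def)
  qed simp
  moreover have "F \<in> borel_measurable \<mu>"
    using haar_integrable[OF \<mu> G F] by simp
  ultimately show ?thesis
    using integral_distr[OF meas, of F] by simp
qed

subsection \<open>One-parameter subgroups\<close>

text \<open>Rodrigues' formula: this is \<open>exp (s X)\<close> when
  \<open>X ** X ** X = - X\<close>, which is the only case in use. The parameter is complex so that
  complex derivatives apply, although the matrix is unitary only for real \<open>s\<close>.\<close>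

definition rot :: "complex^'n^'n \<Rightarrow> complex \<Rightarrow> complex^'n^'n" where
  "rot X s = scalar_mat 1 + scale_mat (sin s) X + scale_mat (1 - cos s) (X ** X)"

lemma rot_0 [simp]: "rot X 0 = scalar_mat 1"
  by (simp add: rot_def matrix_eq_iff)

lemma rot_has_derivative:
  assumes X: "X ** X ** X = - X"
  shows "((\<lambda>s. (rot X s ** A) $ p $ q) has_field_derivative (X ** (rot X s ** A)) $ p $ q) (at s)"
proof -
  have "X ** rot X s = scale_mat (cos s) X + scale_mat (sin s) (X ** X)"
    using X by (simp add: rot_def matrix_add_ldistrib scale_mat_mult_right matrix_mul_assoc
        matrix_eq_iff algebra_simps)
  moreover have "((\<lambda>s. rot X s $ p $ r) has_field_derivative (scale_mat (cos s) X + scale_mat (sin s) (X ** X)) $ p $ r) (at s)" for r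
    unfolding rot_def by (auto intro!: derivative_eq_intros)
  ultimately have "((\<lambda>s. rot X s $ p $ r) has_field_derivative (X ** rot X s) $ p $ r) (at s)" for r
    by simp
  then have "((\<lambda>s. \<Sum>r\<in>UNIV. rot X s $ p $ r * A $ r $ q) has_field_derivative
     (\<Sum>r\<in>UNIV. (X ** rot X s) $ p $ r * A $ r $ q)) (at s)"
    by (intro DERIV_sum DERIV_cmult_right)
  moreover have "(X ** (rot X s ** A)) $ p $ q = (\<Sum>r\<in>UNIV. (X ** rot X s) $ p $ r * A $ r $ q)"
    unfolding matrix_mul_assoc by (simp add: matrix_matrix_mult_def[of "X ** rot X s"])
  ultimately show ?thesis
    by (simp add: matrix_matrix_mult_def[of "rot X _"])
qed

lemma rot_special_unitary:
  assumes X: "X ** X ** X = - X" and skew: "conj_transpose X = - X" and tr: "trace X = 0"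
  shows "rot X (complex_of_real r) \<in> special_unitary_group"
proof -
  define a b where "a = complex_of_real (sin r)" and "b = complex_of_real (1 - cos r)"
  have rot: "rot X (complex_of_real r) = scalar_mat 1 + scale_mat a X + scale_mat b (X ** X)"
    by (simp add: rot_def a_def b_def sin_of_real cos_of_real)
  have X2: "conj_transpose (X ** X) = X ** X"
  proof -
    have "cnj (X $ q $ p) = - X $ p $ q" for p q
      using arg_cong[OF skew, of "\<lambda>Y. Y $ p $ q"] by simp
    then show ?thesis
      by (simp add: matrix_eq_iff matrix_matrix_mult_def mult.commute)
  qed
  have crot: "conj_transpose (rot X (complex_of_real r)) = scalar_mat 1 - scale_mat a X + scale_mat b (X ** X)"
  proof -
    have "cnj (X $ q $ p) = - X $ p $ q" "cnj ((X ** X) $ q $ p) = (X ** X) $ p $ q" for p q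
      using arg_cong[OF skew, of "\<lambda>Y. Y $ p $ q"] arg_cong[OF X2, of "\<lambda>Y. Y $ p $ q"] by simp_all
    then show ?thesis
      unfolding rot by (auto simp: matrix_eq_iff scalar_mat_def a_def b_def)
  qed
  \<comment> \<open>This is the coefficient of \<open>X ** X\<close> in the product with the
    conjugate transpose, once \<open>X ** X ** X ** X\<close> is rewritten as
    \<open>- (X ** X)\<close>.\<close>
  have ab: "2 * b - b * b - a * a = 0"
  proof -
    have "2 * (1 - cos r) - (1 - cos r) * (1 - cos r) - sin r * sin r = 0"
      using sin_cos_squared_add[of r] by (simp add: power2_eq_square algebra_simps)
    then have "complex_of_real (2 * (1 - cos r) - (1 - cos r) * (1 - cos r) - sin r * sin r) = 0" by simp
    then show ?thesis by (simp add: a_def b_def)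
  qed
  have X4: "X ** X ** X ** X = - (X ** X)"
    unfolding X by (simp add: matrix_eq_iff matrix_matrix_mult_def sum_negf)
  have prod: "(scalar_mat 1 + scale_mat c X + scale_mat b (X ** X)) ** (scalar_mat 1 - scale_mat c X + scale_mat b (X ** X))
     = scalar_mat 1" if c: "c * c = a * a" for c
  proof -
    have "(scalar_mat 1 + scale_mat c X + scale_mat b (X ** X)) ** (scalar_mat 1 - scale_mat c X + scale_mat b (X ** X))
      = scalar_mat 1 + scale_mat (2 * b - c * c) (X ** X) + scale_mat (b * b) (X ** X ** X ** X)"
      by (simp add: matrix_add_ldistrib matrix_add_rdist matrix_diff_ldist scale_mat_mult_left scale_mat_mult_right matrix_mul_assoc)
         (simp add: matrix_eq_iff algebra_simps)
    also have "\<dots> = scalar_mat 1 + scale_mat (2 * b - b * b - a * a) (X ** X)"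
      unfolding X4 c by (simp add: matrix_eq_iff algebra_simps)
    finally show ?thesis unfolding ab by (simp add: matrix_eq_iff)
  qed
  have "conj_transpose (rot X (complex_of_real r)) ** rot X (complex_of_real r) = scalar_mat 1"
  proof -
    have "scale_mat (- a) X = - scale_mat a X" by (simp add: matrix_eq_iff)
    then show ?thesis using prod[of "- a"] unfolding crot unfolding rot by simp
  qed
  moreover have "rot X (complex_of_real r) ** conj_transpose (rot X (complex_of_real r)) = scalar_mat 1"
    using prod[of a] unfolding crot unfolding rot by simp
  \<comment> \<open>The derivative of the determinant is \<open>trace X\<close> times the
    determinant, hence zero, so its value at \<open>s = 0\<close> persists.\<close>
  moreover have "cdet (rot X s) = 1" for s
  proof -
    have "((\<lambda>s. cdet (rot X s)) has_field_derivative 0) (at s)" for s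
    proof -
      have "((\<lambda>s. cdet (rot X s)) has_field_derivative
        (\<Sum>k\<in>UNIV. cdet (\<chi> a. if a = k then (X ** rot X s) $ a else rot X s $ a))) (at s)"
        by (rule has_field_derivative_det) (use rot_has_derivative[OF X, of "scalar_mat 1"] in simp)
      then show ?thesis
        unfolding det_replace_row_combination using tr
        by (simp add: sum_distrib_right[symmetric] Determinants.trace_def)
    qed
    then obtain c where "\<And>s. cdet (rot X s) = c"
      using has_field_derivative_zero_constant[of UNIV "\<lambda>s. cdet (rot X s)"] by auto
    from this[of 0] this[of s] show ?thesis by simp
  qed
  ultimately show ?thesis by (simp add: special_unitary_group_def unitary_group_def)
qed

text \<open>Translation by \<open>rot X \<epsilon>\<close> leaves the average of
  \<open>w * f\<close> unchanged and does not affect \<open>w\<close>, so the averages of the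
  difference quotients vanish; dominated convergence passes to the derivative. Continuity of
  \<open>w\<close> is asked only on \<open>unitary_group\<close> because \<open>w\<close> will be a
  power of the inverse determinant.\<close>

lemma haar_integral_derivative:
  fixes f f' w :: "complex^'n^'n \<Rightarrow> complex"
  assumes \<mu>: "normalized_haar_measure G \<mu>" and G: "unitary_subgroup G" and SG: "special_unitary_group \<subseteq> G"
    and X: "X ** X ** X = - X" "conj_transpose X = - X" "trace X = 0"
    and w: "continuous_on unitary_group w"
    and w_inv: "\<And>g A. g \<in> special_unitary_group \<Longrightarrow> A \<in> unitary_group \<Longrightarrow> w (g ** A) = w A"
    and f: "continuous_on UNIV f" and f': "continuous_on UNIV f'"
    and deriv: "\<And>A s. ((\<lambda>s. f (rot X s ** A)) has_field_derivative f' (rot X s ** A)) (at s)"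
  shows "(LINT A|\<mu>. w A * f' A) = 0"
proof -
  interpret prob_space \<mu> using \<mu> by (simp add: normalized_haar_measure_def)
  have sub: "G \<subseteq> unitary_group" using G by (simp add: unitary_subgroup_def)
  have sp: "space \<mu> = G" by (rule haar_space[OF \<mu>])
  have fU: "continuous_on unitary_group f" "continuous_on unitary_group f'"
    using f f' continuous_on_subset by blast+
  obtain b where b: "\<And>A. A \<in> unitary_group \<Longrightarrow> norm (f' A) \<le> b"
    using bounded_on_unitary[OF fU(2)] by blast
  obtain b' where b': "\<And>A. A \<in> unitary_group \<Longrightarrow> norm (w A) \<le> b'"
    using bounded_on_unitary[OF w] by blast
  define \<epsilon> where "\<epsilon> n = inverse (real (Suc n))" for n
  define u where "u n A = w A * ((f (rot X (complex_of_real (\<epsilon> n)) ** A) - f A) / complex_of_real (\<epsilon> n))" for n A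
  have \<epsilon>: "\<epsilon> n > 0" for n by (simp add: \<epsilon>_def)
  have rU: "rot X (complex_of_real r) \<in> special_unitary_group" for r
    using rot_special_unitary[OF X] by blast
  have rUU: "rot X (complex_of_real r) ** A \<in> unitary_group" if "A \<in> unitary_group" for r A
    using rU that by (auto simp: special_unitary_group_def intro: unitary_group_mult)
  have zero: "(LINT A|\<mu>. u n A) = 0" for n
  proof -
    let ?g = "rot X (complex_of_real (\<epsilon> n))"
    have c: "continuous_on unitary_group (\<lambda>A. w A * f A)"
      by (intro continuous_intros w fU)
    have "continuous_on unitary_group (\<lambda>A. w (?g ** A) * f (?g ** A))"
      by (rule continuous_on_compose2[OF c]) (auto intro!: continuous_intros rUU)
    then have i1: "integrable \<mu> (\<lambda>A. w (?g ** A) * f (?g ** A))"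
      by (rule haar_integrable[OF \<mu> G])
    have i2: "integrable \<mu> (\<lambda>A. w A * f A)" by (rule haar_integrable[OF \<mu> G c])
    have "(LINT A|\<mu>. u n A) = (LINT A|\<mu>. (w (?g ** A) * f (?g ** A) - w A * f A) / complex_of_real (\<epsilon> n))"
      by (rule Bochner_Integration.integral_cong)
         (use sp sub w_inv[OF rU] in \<open>auto simp: u_def algebra_simps diff_divide_distrib\<close>)
    also have "\<dots> = ((LINT A|\<mu>. w (?g ** A) * f (?g ** A)) - (LINT A|\<mu>. w A * f A)) / complex_of_real (\<epsilon> n)"
      using i1 i2 by simp
    also have "\<dots> = 0"
      using haar_integral_translate[OF \<mu> G c, of ?g] rU SG by auto
    finally show ?thesis .
  qed
  have "(\<lambda>n. LINT A|\<mu>. u n A) \<longlonglongrightarrow> (LINT A|\<mu>. w A * f' A)"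
  proof (rule integral_dominated_convergence[where w = "\<lambda>_. b' * b"])
    show "(\<lambda>A. w A * f' A) \<in> borel_measurable \<mu>"
      by (intro borel_measurable_integrable haar_integrable[OF \<mu> G] continuous_intros w fU)
    show "u n \<in> borel_measurable \<mu>" for n
      unfolding u_def
      by (intro borel_measurable_integrable haar_integrable[OF \<mu> G] continuous_intros w fU
          continuous_on_compose2[OF f]) (use \<epsilon>[of n] in auto)
    show "AE A in \<mu>. (\<lambda>n. u n A) \<longlonglongrightarrow> w A * f' A"
    proof (rule AE_I2)
      fix A
      have lim: "((\<lambda>s. (f (rot X s ** A) - f A) / s) \<longlongrightarrow> f' A) (at 0)"
        using deriv[of A 0] by (simp add: has_field_derivative_iff)
      have "filterlim (\<lambda>n. complex_of_real (\<epsilon> n)) (at 0) sequentially"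
        unfolding filterlim_at
        using \<epsilon> LIMSEQ_inverse_real_of_nat tendsto_of_real[of \<epsilon> 0]
        by (auto simp: \<epsilon>_def[abs_def] less_imp_neq[symmetric] simp del: of_real_inverse of_nat_Suc)
      from filterlim_compose[OF lim this] show "(\<lambda>n. u n A) \<longlonglongrightarrow> w A * f' A"
        unfolding u_def by (intro tendsto_intros)
    qed
    show "AE A in \<mu>. norm (u n A) \<le> b' * b" for n
    proof (rule AE_I2)
      fix A assume "A \<in> space \<mu>"
      then have A: "A \<in> unitary_group" using sp sub by auto
      \<comment> \<open>The mean value bound is taken along a real segment, where
        \<open>rot X z ** A\<close> stays unitary and the bound \<open>b\<close> for
        \<open>f'\<close> is available. It dominates all quotients at once.\<close>
      have "norm (f (rot X (complex_of_real (\<epsilon> n)) ** A) - f (rot X 0 ** A)) \<le> b * norm (complex_of_real (\<epsilon> n) - 0)"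
      proof (rule field_differentiable_bound[of "closed_segment 0 (complex_of_real (\<epsilon> n))"])
        show "((\<lambda>s. f (rot X s ** A)) has_field_derivative f' (rot X z ** A)) (at z within closed_segment 0 (complex_of_real (\<epsilon> n)))" for z
          by (rule has_field_derivative_at_within[OF deriv])
        fix z assume "z \<in> closed_segment 0 (complex_of_real (\<epsilon> n))"
        then obtain r where "z = complex_of_real r"
          by (auto simp: closed_segment_def scaleR_conv_of_real simp flip: of_real_mult)
        then show "norm (f' (rot X z ** A)) \<le> b" using b[OF rUU[OF A]] by simp
      qed auto
      then have "norm ((f (rot X (complex_of_real (\<epsilon> n)) ** A) - f A) / complex_of_real (\<epsilon> n)) \<le> b"
        using \<epsilon>[of n] by (simp add: norm_divide divide_le_eq)
      moreover have "norm (w A) \<le> b'" by (rule b'[OF A])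
      ultimately show "norm (u n A) \<le> b' * b"
        unfolding u_def norm_mult by (intro mult_mono) (auto intro: order_trans[OF norm_ge_zero])
    qed
  qed simp
  then show ?thesis unfolding zero by (simp add: LIMSEQ_const_iff)
qed

section \<open>The loop equation for Haar measure\<close>

text \<open>The derivative of \<open>newton_mat i A $ p $ q * newton_prod as A\<close> in direction
  \<open>X\<close>. Keeping \<open>X\<close> as an argument exposes its complex linearity, by which
  identities for skew-Hermitian directions extend to the matrix units.\<close>

definition sd_fun :: "nat \<Rightarrow> nat list \<Rightarrow> 'n \<Rightarrow> 'n \<Rightarrow> complex^'n^'n \<Rightarrow> complex^'n^'n \<Rightarrow> complex" where
  "sd_fun i as p q X A =
     newton_deriv i A X $ p $ q * newton_prod as A + newton_mat i A $ p $ q * newton_prod_deriv as A X"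

lemma newton_deriv_add: "newton_deriv i A (X + Y) = newton_deriv i A X + newton_deriv i A Y"
  by (induction i)
     (simp_all add: matrix_add_rdist matrix_add_ldistrib trace_add, simp add: matrix_eq_iff algebra_simps)

lemma newton_deriv_scale: "newton_deriv i A (scale_mat c X) = scale_mat c (newton_deriv i A X)"
  by (induction i)
     (simp_all add: scale_mat_mult_left scale_mat_mult_right trace_scale_mat, simp_all add: matrix_eq_iff algebra_simps)

lemma newton_prod_deriv_add: "newton_prod_deriv as A (X + Y) = newton_prod_deriv as A X + newton_prod_deriv as A Y"
  by (induction as) (auto simp: matrix_add_rdist trace_add algebra_simps)

lemma newton_prod_deriv_scale: "newton_prod_deriv as A (scale_mat c X) = c * newton_prod_deriv as A X"
  by (induction as) (auto simp: scale_mat_mult_left trace_scale_mat algebra_simps)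

lemma sd_fun_add: "sd_fun i as p q (X + Y) A = sd_fun i as p q X A + sd_fun i as p q Y A"
  by (simp add: sd_fun_def newton_deriv_add newton_prod_deriv_add algebra_simps)

lemma sd_fun_scale: "sd_fun i as p q (scale_mat c X) A = c * sd_fun i as p q X A"
  by (simp add: sd_fun_def newton_deriv_scale newton_prod_deriv_scale algebra_simps)

lemma sd_fun_0: "sd_fun i as p q 0 (A :: complex^'n^'n) = 0"
proof -
  have "scale_mat 0 (0 :: complex^'n^'n) = 0" by (simp add: matrix_eq_iff)
  then show ?thesis using sd_fun_scale[of i as p q 0 "0 :: complex^'n^'n" A] by simp
qed

lemma sd_fun_sum: "finite S \<Longrightarrow> sd_fun i as p q (\<Sum>s\<in>S. X s) A = (\<Sum>s\<in>S. sd_fun i as p q (X s) A)"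
  by (induction S rule: finite_induct) (auto simp: sd_fun_add sd_fun_0)

lemma mat_1_eq_sum: "(scalar_mat 1 :: complex^'n^'n) = (\<Sum>r\<in>UNIV. unit_mat r r)"
  by (auto simp: matrix_eq_iff scalar_mat_def unit_mat_def sum_component
      intro!: sum.neutral)

lemma sd_term_eq_sd_fun:
  fixes A :: "complex^'n^'n"
  shows "sd_term i as A = (\<Sum>p\<in>UNIV. \<Sum>q\<in>UNIV. sd_fun i as p q (unit_mat p q) A)
     - (\<Sum>p\<in>UNIV. \<Sum>r\<in>UNIV. sd_fun i as p p (unit_mat r r) A) / of_nat CARD('n)"
proof -
  have "(\<Sum>p\<in>UNIV. \<Sum>r\<in>UNIV. sd_fun i as p p (unit_mat r r) A)
     = (\<Sum>p\<in>UNIV. sd_fun i as p p (scalar_mat 1) A)"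
    by (simp add: mat_1_eq_sum sd_fun_sum)
  also have "\<dots> = trace (newton_deriv i A (scalar_mat 1)) * newton_prod as A
        + trace (newton_mat i A) * newton_prod_deriv as A (scalar_mat 1)"
    by (simp add: sd_fun_def sum.distrib sum_distrib_right Determinants.trace_def)
  finally show ?thesis by (simp add: sd_term_def sd_fun_def)
qed

lemma continuous_on_sd_fun [continuous_intros]:
  fixes F :: "'a::topological_space \<Rightarrow> complex^'n^'n"
  assumes "continuous_on S F"
  shows "continuous_on S (\<lambda>x. sd_fun i as p q X (F x))"
  unfolding sd_fun_def by (intro continuous_intros assms)

lemma unit_mat_mult_unit_mat: "unit_mat p q ** unit_mat r s = (if q = r then unit_mat p s else 0)"
  by (auto simp: matrix_eq_iff unit_mat_mult) (auto simp: unit_mat_def)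

lemma conj_transpose_unit_mat: "conj_transpose (unit_mat p q) = unit_mat q p"
  by (auto simp: matrix_eq_iff unit_mat_def)

lemma trace_unit_mat: "trace (unit_mat p q) = (if p = q then 1 else 0)"
  using trace_unit_mat_mult[of p q "scalar_mat 1"] by (simp only: matrix_mul_rid) (simp add: scalar_mat_def)

lemma conj_transpose_add: "conj_transpose (A + B) = conj_transpose A + conj_transpose B"
  and conj_transpose_scale_mat: "conj_transpose (scale_mat c A) = scale_mat (cnj c) (conj_transpose A)"
  by (simp_all add: matrix_eq_iff)

lemma scale_mat_scale_mat: "scale_mat c (scale_mat d A) = scale_mat (c * d) A"
  and scale_mat_add_right: "scale_mat c (A + B) = scale_mat c A + scale_mat c B"
  and scale_mat_one [simp]: "scale_mat 1 A = A"
  and scale_mat_zero [simp]: "scale_mat 0 A = 0" "scale_mat c 0 = 0"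
  by (simp_all add: matrix_eq_iff algebra_simps)

lemma uminus_eq_scale_mat: "- A = scale_mat (-1) A"
  by (simp add: matrix_eq_iff)

lemmas unit_mat_calculus = matrix_add_rdist matrix_add_ldistrib scale_mat_mult_left
  scale_mat_mult_right unit_mat_mult_unit_mat conj_transpose_add conj_transpose_scale_mat
  conj_transpose_unit_mat trace_add trace_scale_mat trace_unit_mat scale_mat_scale_mat
  scale_mat_add_right uminus_eq_scale_mat add.commute

text \<open>Invariance yields zero for traceless skew-Hermitian \<open>X\<close> with
  \<open>X ** X ** X = - X\<close>. Complex combinations of such \<open>X\<close> span the traceless
  matrices: the averaged derivative vanishes on off-diagonal matrix units and is the same on all
  diagonal ones. The trace correction in \<open>sd_term\<close> cancels the common value on the
  diagonal.\<close>

theorem haar_sd_term: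
  fixes w :: "complex^'n^'n \<Rightarrow> complex"
  assumes \<mu>: "normalized_haar_measure G \<mu>" and G: "unitary_subgroup G" and SG: "special_unitary_group \<subseteq> G"
    and w: "continuous_on unitary_group w"
    and w_inv: "\<And>g A. g \<in> special_unitary_group \<Longrightarrow> A \<in> unitary_group \<Longrightarrow> w (g ** A) = w A"
  shows "(LINT A|\<mu>. w A * sd_term i as A) = 0"
proof -
  define I where "I p q X = (LINT A|\<mu>. w A * sd_fun i as p q X A)" for p q X
  have int: "integrable \<mu> (\<lambda>A. w A * sd_fun i as p q X A)" for p q X
    by (intro haar_integrable[OF \<mu> G] continuous_intros w)
  have I_add: "I p q (X + Y) = I p q X + I p q Y" for p q X Y
    by (simp add: I_def sd_fun_add distrib_left int)
  have I_scale: "I p q (scale_mat c X) = c * I p q X" for p q c X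
    unfolding I_def sd_fun_scale mult.left_commute[of _ c] by simp
  have I_0: "I p q X = 0" if X: "X ** X ** X = - X" "conj_transpose X = - X" "trace X = 0" for p q X
    unfolding I_def
  proof (rule haar_integral_derivative[OF \<mu> G SG X w w_inv])
    show "continuous_on UNIV (\<lambda>A. newton_mat i A $ p $ q * newton_prod as A)" "continuous_on UNIV (sd_fun i as p q X)"
      by (intro continuous_intros)+
    show "((\<lambda>s. newton_mat i (rot X s ** A) $ p $ q * newton_prod as (rot X s ** A)) has_field_derivative
         sd_fun i as p q X (rot X s ** A)) (at s)" for A s
      unfolding sd_fun_def
      by (rule DERIV_cong[OF DERIV_mult[OF newton_has_derivative(1)[OF rot_has_derivative[OF X(1)]]
            newton_prod_has_derivative[OF rot_has_derivative[OF X(1)]]]]) simp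
  qed
  have off: "I a b (unit_mat p q) = 0" if pq: "p \<noteq> q" for a b p q
  proof -
    \<comment> \<open>One real antisymmetric and one imaginary symmetric direction give equality and
      opposite signs for the values at \<open>unit_mat p q\<close> and \<open>unit_mat q p\<close>,
      so both are zero.\<close>
    let ?X = "unit_mat p q + scale_mat (-1) (unit_mat q p) :: complex^'n^'n"
    let ?Y = "scale_mat \<i> (unit_mat p q) + scale_mat \<i> (unit_mat q p) :: complex^'n^'n"
    have "I a b ?X = 0"
      by (rule I_0) (use pq in \<open>simp_all add: unit_mat_calculus\<close>)
    moreover have "I a b ?Y = 0"
      by (rule I_0) (use pq in \<open>simp_all add: unit_mat_calculus\<close>)
    ultimately have "I a b (unit_mat p q) = I a b (unit_mat q p)" "I a b (unit_mat p q) = - I a b (unit_mat q p)"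
      by (simp_all add: I_add I_scale add_eq_0_iff2)
    then show ?thesis by simp
  qed
  have diag: "I a b (unit_mat p p) = I a b (unit_mat q q)" for a b p q
  proof (cases "p = q")
    case False
    have "I a b (scale_mat \<i> (unit_mat p p) + scale_mat (- \<i>) (unit_mat q q)) = 0"
      by (rule I_0) (use False in \<open>simp_all add: unit_mat_calculus\<close>)
    then show ?thesis by (simp add: I_add I_scale)
  qed simp
  have "(LINT A|\<mu>. w A * sd_term i as A) = (\<Sum>p\<in>UNIV. \<Sum>q\<in>UNIV. I p q (unit_mat p q))
     - (\<Sum>p\<in>UNIV. \<Sum>r\<in>UNIV. I p p (unit_mat r r)) / of_nat CARD('n)"
    by (simp add: sd_term_eq_sd_fun I_def right_diff_distrib sum_distrib_left int)
  also have "(\<Sum>p\<in>UNIV. \<Sum>r\<in>UNIV. I p p (unit_mat r r)) = (\<Sum>p\<in>UNIV. \<Sum>r\<in>(UNIV::'n set). I p p (unit_mat p p))"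
    using diag by (intro sum.cong refl)
  also have "(\<Sum>p\<in>UNIV. \<Sum>q\<in>UNIV. I p q (unit_mat p q)) = (\<Sum>p\<in>UNIV. \<Sum>q\<in>UNIV. if q = p then I p p (unit_mat p p) else 0)"
    using off by (intro sum.cong refl) auto
  finally show ?thesis by (simp add: sum_distrib_left[symmetric])
qed

section \<open>Comparing two solutions of the loop equation\<close>

lemma newton_coeff_CARD: "newton_coeff CARD('n) (A :: complex^'n^'n) = (-1) ^ CARD('n) * cdet A"
proof -
  have "newton_coeff CARD('n) A = (\<Sum>i\<le>CARD('n). if i = CARD('n) then newton_coeff i A else 0)"
    by simp
  also have "\<dots> = poly (charpoly A) 0"
    unfolding charpoly_eq_sum poly_sum poly_monom by (intro sum.cong) (auto simp: power_0_left)
  also have "\<dots> = cdet (scale_mat (-1) A)"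
    by (simp add: poly_charpoly uminus_eq_scale_mat[symmetric])
  finally show ?thesis by (simp add: det_scale_mat)
qed

section \<open>Averages that solve the loop equation\<close>

definition avg :: "'b measure \<Rightarrow> ('b \<Rightarrow> complex) \<Rightarrow> ('b \<Rightarrow> complex^'n^'n) \<Rightarrow> (complex^'n^'n \<Rightarrow> complex) \<Rightarrow> complex" where
  "avg \<nu> W B h = (LINT x|\<nu>. W x * h (B x))"

text \<open>A common interface for Haar averages, where \<open>B\<close> is the identity and
  \<open>W\<close> a power of the inverse determinant, and for torus integrals, where
  \<open>B\<close> is a diagonal matrix and \<open>W\<close> a complex weight.\<close>

definition sd_average :: "'b measure \<Rightarrow> ('b \<Rightarrow> complex) \<Rightarrow> ('b \<Rightarrow> complex^'n^'n) \<Rightarrow> bool" where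
  "sd_average \<nu> W B \<longleftrightarrow>
     (\<forall>h. continuous_on UNIV h \<longrightarrow> integrable \<nu> (\<lambda>x. W x * h (B x))) \<and>
     (\<forall>i as. avg \<nu> W B (sd_term i as) = 0)"

lemma avg_cmult: "avg \<nu> W B (\<lambda>A. c * h A) = c * avg \<nu> W B h"
  unfolding avg_def mult.left_commute[of _ c] by simp

lemma avg_sum:
  assumes "sd_average \<nu> W B" "\<And>s. s \<in> S \<Longrightarrow> continuous_on UNIV (h s)"
  shows "avg \<nu> W B (\<lambda>A. \<Sum>s\<in>S. h s A) = (\<Sum>s\<in>S. avg \<nu> W B (h s))"
  using assms unfolding avg_def sd_average_def sum_distrib_left
  by (intro Bochner_Integration.integral_sum) auto

lemma avg_newton_prod_rec:
  fixes B :: "'b \<Rightarrow> complex^'n^'n"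
  assumes avg: "sd_average \<nu> W B"
  shows "of_nat i * (of_nat CARD('n) + of_nat (Suc (length as)) - of_nat i
        - of_nat (i + sum_list as) / of_nat CARD('n)) * avg \<nu> W B (newton_prod (i # as))
      = (\<Sum>j<length as. \<Sum>r=1..i. (of_nat (as ! j) - of_nat i + 2 * of_nat r)
          * avg \<nu> W B (newton_prod ((i - r) # as[j := as ! j + r])))"
    (is "?a * _ = ?R")
proof -
  have int: "integrable \<nu> (\<lambda>x. W x * newton_prod as (B x))" for as
    using avg continuous_on_newton_prod[OF continuous_on_id] unfolding sd_average_def by blast
  have "0 = (LINT x|\<nu>. W x * sd_term i as (B x))"
    using avg by (simp add: sd_average_def avg_def)
  also have "\<dots> = (LINT x|\<nu>. - ?a * (W x * newton_prod (i # as) (B x))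
     + (\<Sum>j<length as. \<Sum>r=1..i. (of_nat (as ! j) - of_nat i + 2 * of_nat r)
        * (W x * newton_prod ((i - r) # as[j := as ! j + r]) (B x))))"
    unfolding sd_term_eq distrib_left sum_distrib_left mult.left_commute[of "W _"] ..
  also have "\<dots> = - ?a * avg \<nu> W B (newton_prod (i # as)) + ?R"
    unfolding avg_def by (simp add: int del: newton_prod_Cons)
  finally show ?thesis by simp
qed

text \<open>By \<open>det'\<close> the weights \<open>W' m\<close> are dual to the powers of the
  determinant. Hence the difference of the two sides solves the homogeneous recursion and vanishes
  on the lists with all entries \<open>N\<close>, where \<open>newton_prod\<close> is a signed power
  of the determinant. The list length bounds the powers involved, which is the role of
  \<open>K\<close>.\<close>

theorem avg_newton_prod_eq:
  fixes B :: "'b \<Rightarrow> complex^'n^'n" and B' :: "'c \<Rightarrow> complex^'n^'n"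
  assumes avg: "sd_average \<nu> W B" and avg': "\<And>m. m \<le> K \<Longrightarrow> sd_average \<nu>' (W' m) B'"
    and det': "\<And>m n. m \<le> K \<Longrightarrow> n \<le> K \<Longrightarrow>
      avg \<nu>' (W' m) B' (\<lambda>A. cdet A ^ n) = (if m = n then 1 else 0)"
    and len: "length as \<le> K"
  shows "avg \<nu> W B (newton_prod as) =
    (\<Sum>m\<le>K. avg \<nu> W B (\<lambda>A. cdet A ^ m) * avg \<nu>' (W' m) B' (newton_prod as))"
proof -
  let ?co = "\<lambda>as (i::nat) j r. of_nat (as ! j) - of_nat i + 2 * of_nat r :: complex"
  define c where "c as = avg \<nu> W B (newton_prod as) -
    (\<Sum>m\<le>K. avg \<nu> W B (\<lambda>A. cdet A ^ m) * avg \<nu>' (W' m) B' (newton_prod as))" for as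
  have "c as = 0"
  proof (rule recursion_unique[of "CARD('n)" K])
    show "1 \<le> CARD('n)" by (simp add: Suc_leI)
    show "c (0 # as) = c as" for as
    proof -
      have "newton_prod (0 # as) = (newton_prod as :: complex^'n^'n \<Rightarrow> complex)"
        by (simp add: fun_eq_iff)
      then show ?thesis by (simp only: c_def)
    qed
    have 0: "newton_prod as (A :: complex^'n^'n) = 0" if ex: "\<exists>a\<in>set as. CARD('n) < a" for as A
    proof -
      obtain a where "a \<in> set as" "CARD('n) < a" using ex by blast
      then have "0 \<in> (\<lambda>a. newton_coeff a A) ` set as"
        using newton_coeff_eq_0[of a A] by (metis image_eqI)
      then show ?thesis by (simp add: newton_prod_def prod_list_zero_iff)
    qed
    show "c as = 0" if "\<exists>a\<in>set as. CARD('n) < a" for as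
      using 0[OF that] by (simp add: c_def avg_def)
    show "of_nat i * (of_nat CARD('n) + of_nat (Suc (length as)) - of_nat i
        - of_nat (i + sum_list as) / of_nat CARD('n)) * c (i # as)
      = (\<Sum>j<length as. \<Sum>r=1..i. ?co as i j r
          * c ((i - r) # as[j := as ! j + r]))" (is "?a * _ = ?R") for i as
    proof -
      let ?t = "\<lambda>m. avg \<nu> W B (\<lambda>A. cdet A ^ m)"
      have "?a * c (i # as) = ?a * avg \<nu> W B (newton_prod (i # as))
         - (\<Sum>m\<le>K. ?t m * (?a * avg \<nu>' (W' m) B' (newton_prod (i # as))))"
        by (simp only: c_def right_diff_distrib sum_distrib_left mult.left_commute)
      also have "\<dots> = (\<Sum>j<length as. \<Sum>r=1..i. ?co as i j r
          * avg \<nu> W B (newton_prod ((i - r) # as[j := as ! j + r])))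
        - (\<Sum>m\<le>K. ?t m * (\<Sum>j<length as. \<Sum>r=1..i. ?co as i j r
          * avg \<nu>' (W' m) B' (newton_prod ((i - r) # as[j := as ! j + r]))))"
        unfolding avg_newton_prod_rec[OF avg]
        by (intro arg_cong2[where f = "(-)"] refl sum.cong) (simp only: avg_newton_prod_rec[OF avg'] atMost_iff)
      also have "(\<Sum>m\<le>K. ?t m * (\<Sum>j<length as. \<Sum>r=1..i. ?co as i j r
          * avg \<nu>' (W' m) B' (newton_prod ((i - r) # as[j := as ! j + r]))))
        = (\<Sum>j<length as. \<Sum>r=1..i. ?co as i j r
          * (\<Sum>m\<le>K. ?t m * avg \<nu>' (W' m) B' (newton_prod ((i - r) # as[j := as ! j + r]))))"
      proof -
        have "(\<Sum>m\<le>K. ?t m * (\<Sum>j<length as. \<Sum>r=1..i. ?co as i j r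
          * avg \<nu>' (W' m) B' (newton_prod ((i - r) # as[j := as ! j + r]))))
          = (\<Sum>m\<le>K. \<Sum>j<length as. \<Sum>r=1..i. ?co as i j r
          * (?t m * avg \<nu>' (W' m) B' (newton_prod ((i - r) # as[j := as ! j + r]))))"
          by (simp only: sum_distrib_left mult.left_commute)
        also have "\<dots> = (\<Sum>j<length as. \<Sum>m\<le>K. \<Sum>r=1..i. ?co as i j r
          * (?t m * avg \<nu>' (W' m) B' (newton_prod ((i - r) # as[j := as ! j + r]))))"
          by (rule sum.swap)
        also have "\<dots> = (\<Sum>j<length as. \<Sum>r=1..i. \<Sum>m\<le>K. ?co as i j r
          * (?t m * avg \<nu>' (W' m) B' (newton_prod ((i - r) # as[j := as ! j + r]))))"
          by (intro sum.cong refl sum.swap)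
        finally show ?thesis by (simp only: sum_distrib_left)
      qed
      finally show ?thesis
        by (simp only: c_def right_diff_distrib sum_subtractf)
    qed
    show "c (replicate n CARD('n)) = 0" if "n \<le> K" for n
    proof -
      have "newton_prod (replicate n CARD('n)) = (\<lambda>A :: complex^'n^'n. ((-1) ^ CARD('n)) ^ n * cdet A ^ n)"
        by (simp add: fun_eq_iff newton_prod_def newton_coeff_CARD power_mult_distrib)
      then show ?thesis
        using that by (simp add: c_def avg_cmult det' if_distrib[of "\<lambda>x. _ * x"] cong: if_cong)
    qed
  qed (fact len)
  then show ?thesis by (simp add: c_def)
qed

lemma continuous_on_poly_charpoly [continuous_intros]:
  fixes F :: "'a::topological_space \<Rightarrow> complex^'n^'n"
  assumes "continuous_on S F"
  shows "continuous_on S (\<lambda>x. poly (charpoly (F x)) u)"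
  unfolding charpoly_eq_sum poly_sum poly_monom by (intro continuous_intros assms)

lemma continuous_on_prod_list_charpoly [continuous_intros]:
  fixes F :: "'a::topological_space \<Rightarrow> complex^'n^'n"
  assumes "continuous_on S F"
  shows "continuous_on S (\<lambda>x. \<Prod>u\<leftarrow>us. poly (charpoly (F x)) u)"
  by (induction us) (auto intro!: continuous_intros assms)

text \<open>Expanding one factor \<open>det (u - A)\<close> in powers of \<open>u\<close> moves one
  coefficient into the list \<open>as\<close>, so the sum of the two lengths, and with it the same
  \<open>K\<close>, is preserved in the induction.\<close>

theorem avg_prod_charpoly_eq:
  fixes B :: "'b \<Rightarrow> complex^'n^'n" and B' :: "'c \<Rightarrow> complex^'n^'n"
  assumes avg: "sd_average \<nu> W B" and avg': "\<And>m. m \<le> K \<Longrightarrow> sd_average \<nu>' (W' m) B'"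
    and det': "\<And>m n. m \<le> K \<Longrightarrow> n \<le> K \<Longrightarrow>
      avg \<nu>' (W' m) B' (\<lambda>A. cdet A ^ n) = (if m = n then 1 else 0)"
    and len: "length us + length as \<le> K"
  shows "avg \<nu> W B (\<lambda>A. (\<Prod>u\<leftarrow>us. poly (charpoly A) u) * newton_prod as A) =
    (\<Sum>m\<le>K. avg \<nu> W B (\<lambda>A. cdet A ^ m)
      * avg \<nu>' (W' m) B' (\<lambda>A. (\<Prod>u\<leftarrow>us. poly (charpoly A) u) * newton_prod as A))"
  using len
proof (induction us arbitrary: as)
  case Nil
  then show ?case using avg_newton_prod_eq[OF avg avg' det', where as = as] by simp
next
  case (Cons u us)
  let ?h = "\<lambda>i (A :: complex^'n^'n). (\<Prod>u\<leftarrow>us. poly (charpoly A) u) * newton_prod (i # as) A"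
  have h: "(\<lambda>A :: complex^'n^'n. (\<Prod>u\<leftarrow>u # us. poly (charpoly A) u) * newton_prod as A)
    = (\<lambda>A. \<Sum>i\<le>CARD('n). u ^ (CARD('n) - i) * ?h i A)"
  proof
    fix A :: "complex^'n^'n"
    have "poly (charpoly A) u = (\<Sum>i\<le>CARD('n). newton_coeff i A * u ^ (CARD('n) - i))"
      by (simp add: charpoly_eq_sum poly_sum poly_monom)
    then show "(\<Prod>u\<leftarrow>u # us. poly (charpoly A) u) * newton_prod as A
      = (\<Sum>i\<le>CARD('n). u ^ (CARD('n) - i) * ?h i A)"
      by (simp add: sum_distrib_left sum_distrib_right mult_ac)
  qed
  have cont: "continuous_on UNIV (\<lambda>A. u ^ (CARD('n) - i) * ?h i A)" for i
    by (intro continuous_intros)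
  have IH: "avg \<nu> W B (?h i) = (\<Sum>m\<le>K. avg \<nu> W B (\<lambda>A. cdet A ^ m) * avg \<nu>' (W' m) B' (?h i))" for i
    using Cons.prems by (intro Cons.IH) simp
  have rhs: "avg \<nu>' (W' m) B' (\<lambda>A. \<Sum>i\<le>CARD('n). u ^ (CARD('n) - i) * ?h i A) =
      (\<Sum>i\<le>CARD('n). u ^ (CARD('n) - i) * avg \<nu>' (W' m) B' (?h i))" if "m \<le> K" for m
    by (simp only: avg_sum[OF avg'[OF that] cont] avg_cmult)
  show ?case
    unfolding h avg_sum[OF avg cont] avg_cmult IH sum_distrib_left
    by (subst sum.swap, intro sum.cong refl, subst rhs)
       (simp_all only: atMost_iff sum_distrib_left mult.left_commute)
qed

section \<open>Vandermonde determinants\<close>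

definition vandermonde :: "nat \<Rightarrow> (nat \<Rightarrow> complex) \<Rightarrow> complex" where
  "vandermonde n z = Determinant.det (Matrix.mat n n (\<lambda>(i, j). z i ^ j))"

text \<open>As polynomials in the last variable both sides have degree at most \<open>n\<close>, the
  same coefficient of degree \<open>n\<close>, and the earlier nodes as zeros. Repeated nodes are
  treated separately, since counting these zeros needs them to be distinct.\<close>

lemma vandermonde_eq_prod: "vandermonde n z = (\<Prod>j<n. \<Prod>i<j. z j - z i)"
proof (induction n)
  case 0
  then show ?case by (simp add: vandermonde_def)
next
  case (Suc n)
  show ?case
  proof (cases "inj_on z {..<Suc n}")
    case False
    then obtain i j where ij: "i < j" "j < Suc n" "z i = z j"
      unfolding inj_on_def by (metis lessThan_iff linorder_neqE_nat)
    have "Determinant.det (Matrix.mat (Suc n) (Suc n) (\<lambda>(i, j). z i ^ j)) = 0"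
      by (rule Determinant.det_identical_rows[of _ "Suc n" i j]) (use ij in auto)
    moreover have "(\<Prod>j<Suc n. \<Prod>i<j. z j - z i) = 0"
    proof -
      have "(\<Prod>i<j. z j - z i) = 0" using ij by (intro prod_zero) (auto intro!: bexI[of _ i])
      then show ?thesis using ij by (auto simp: prod_zero_iff simp del: prod.lessThan_Suc)
    qed
    ultimately show ?thesis by (simp add: vandermonde_def)
  next
    case True
    define M where "M x = Matrix.mat (Suc n) (Suc n) (\<lambda>(i, j). (if i = n then x else z i) ^ j)" for x :: complex
    define P where "P = (\<Sum>j<Suc n. monom (Determinant.cofactor (M 0) n j) j)"
    have cof: "Determinant.cofactor (M x) n j = Determinant.cofactor (M 0) n j" if "j < Suc n" for x j
      unfolding Determinant.cofactor_def
      by (rule arg_cong[where f = "\<lambda>A. (-1) ^ (n + j) * Determinant.det A"])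
         (auto simp: M_def mat_delete_def)
    have detM: "Determinant.det (M x) = poly P x" for x
    proof -
      have "Determinant.det (M x) = (\<Sum>j<Suc n. M x $$ (n, j) * Determinant.cofactor (M x) n j)"
        by (rule laplace_expansion_row) (auto simp: M_def)
      also have "\<dots> = (\<Sum>j<Suc n. Determinant.cofactor (M 0) n j * x ^ j)"
        by (intro sum.cong refl) (simp add: cof[where x = x], simp add: M_def)
      finally show ?thesis by (simp add: P_def poly_sum poly_monom del: sum.lessThan_Suc)
    qed
    have lead: "coeff P n = vandermonde n z"
    proof -
      have "coeff P n = Determinant.cofactor (M 0) n n"
        by (simp add: P_def coeff_sum)
      also have "mat_delete (M 0) n n = Matrix.mat n n (\<lambda>(i, j). z i ^ j)"
        by (auto simp: M_def mat_delete_def)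
      then have "Determinant.cofactor (M 0) n n = vandermonde n z"
        by (simp add: Determinant.cofactor_def vandermonde_def)
      finally show ?thesis .
    qed
    define R where "R = Polynomial.smult (vandermonde n z) (\<Prod>i<n. [:- z i, 1:])"
    have degP: "degree P \<le> n"
      unfolding P_def by (intro degree_sum_le) (auto intro: order_trans[OF degree_monom_le])
    have degprod: "degree (\<Prod>i<n. [:- z i, 1:]) = n"
      by (subst degree_prod_sum_eq) auto
    have degR: "degree R \<le> n" unfolding R_def using degprod by (simp add: degree_smult_le order_trans)
    have leadR: "coeff R n = vandermonde n z"
      using lead_coeff_prod[of "\<lambda>i. [:- z i, 1:]" "{..<n}"] by (simp add: R_def degprod)
    have "P = R"
    proof -
      have "P - R = 0"
      proof (rule ccontr)
        assume nz: "P - R \<noteq> 0"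
        have "degree (P - R) \<le> n" using degP degR by (rule degree_diff_le)
        moreover have "coeff (P - R) n = 0" using lead leadR by simp
        ultimately have dlt: "degree (P - R) < n"
          using nz by (metis le_neq_implies_less leading_coeff_0_iff)
        have "z ` {..<n} \<subseteq> {x. poly (P - R) x = 0}"
        proof (intro subsetI)
          fix x assume "x \<in> z ` {..<n}"
          then obtain i where i: "i < n" "x = z i" by auto
          have "poly P x = Determinant.det (M (z i))" using i detM by simp
          also have "\<dots> = 0"
            by (rule Determinant.det_identical_rows[of _ "Suc n" i n]) (use i in \<open>auto simp: M_def\<close>)
          finally have "poly P x = 0" .
          moreover have "poly R x = 0" using i by (auto simp: R_def poly_prod prod_zero_iff)
          ultimately show "x \<in> {x. poly (P - R) x = 0}" by simp
        qed
        then have "card (z ` {..<n}) \<le> card {x. poly (P - R) x = 0}"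
          by (intro card_mono poly_roots_finite nz)
        also have "\<dots> \<le> degree (P - R)" by (rule card_poly_roots_bound[OF nz])
        finally show False
          using dlt True by (simp add: card_image inj_on_subset[of z "{..<Suc n}" "{..<n}"])
      qed
      then show ?thesis by simp
    qed
    moreover have "vandermonde (Suc n) z = Determinant.det (M (z n))"
      unfolding vandermonde_def M_def by (rule arg_cong[where f = Determinant.det]) auto
    ultimately show ?thesis
      by (simp add: detM R_def poly_prod Suc.IH)
  qed
qed

lemma vandermonde_eq_sum:
  "vandermonde n z = (\<Sum>\<sigma> | \<sigma> permutes {0..<n}. of_int (sign \<sigma>) * (\<Prod>i\<in>{0..<n}. z i ^ \<sigma> i))"
proof -
  have "(\<Prod>i = 0..<n. Matrix.mat n n (\<lambda>(i, j). z i ^ j) $$ (i, \<sigma> i)) = (\<Prod>i\<in>{0..<n}. z i ^ \<sigma> i)"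
    if "\<sigma> permutes {0..<n}" for \<sigma>
    using that by (intro prod.cong refl) (auto simp: permutes_in_image[OF that, of _, simplified])
  then show ?thesis
    unfolding vandermonde_def Determinant.det_def by (auto intro!: sum.cong simp: sign_def)
qed

text \<open>On the unit torus this is the product of \<open>|z\<^sub>i - z\<^sub>j|\<^sup>2\<close>.
  Written without conjugation it is a Laurent polynomial, hence holomorphic in the logarithm of each
  coordinate.\<close>

definition vand_sq :: "nat \<Rightarrow> (nat \<Rightarrow> complex) \<Rightarrow> complex" where
  "vand_sq n z = (\<Prod>(i, j) \<in> {(i, j). i < j \<and> j < n}. 2 - z i / z j - z j / z i)"

lemma finite_pairs: "finite {(i, j). i < j \<and> j < (n::nat)}"
  by (rule finite_subset[of _ "{..<n} \<times> {..<n}"]) auto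

lemma vand_sq_eq:
  assumes "\<And>i. i < n \<Longrightarrow> z i \<noteq> 0"
  shows "vand_sq n z = vandermonde n z * vandermonde n (\<lambda>i. inverse (z i))"
proof -
  have pairs: "{(i, j). i < j \<and> j < n} = (\<lambda>(j, i). (i, j)) ` (SIGMA j:{..<n}. {..<j})" by auto
  have "vand_sq n z = (\<Prod>(j, i) \<in> (SIGMA j:{..<n}. {..<j}). 2 - z i / z j - z j / z i)"
    unfolding vand_sq_def pairs by (subst prod.reindex) (auto simp: inj_on_def intro!: prod.cong)
  also have "\<dots> = (\<Prod>j<n. \<Prod>i<j. 2 - z i / z j - z j / z i)"
    by (subst prod.Sigma) auto
  also have "\<dots> = (\<Prod>j<n. \<Prod>i<j. (z j - z i) * (inverse (z j) - inverse (z i)))"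
    using assms by (intro prod.cong refl) (auto simp: field_simps)
  finally show ?thesis by (simp add: vandermonde_eq_prod prod.distrib)
qed

section \<open>The torus\<close>

definition torus :: "nat \<Rightarrow> (nat \<Rightarrow> real) measure" where
  "torus n = (\<Pi>\<^sub>M i\<in>{..<n}. restrict_space lborel {0..1})"

definition angle :: "(nat \<Rightarrow> real) \<Rightarrow> nat \<Rightarrow> complex" where
  "angle \<theta> i = cis (2 * pi * \<theta> i)"

lemma prob_space_unit_interval: "prob_space (restrict_space lborel {0..1::real})"
  by (intro prob_spaceI) (simp add: emeasure_restrict_space space_restrict_space)

interpretation unit_interval: product_prob_space "\<lambda>_. restrict_space lborel {0..1::real}" I for I :: "nat set"
  by (simp add: product_prob_space_def product_prob_space_axioms_def product_sigma_finite_def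
      prob_space_unit_interval prob_space_imp_sigma_finite)

lemma prob_space_torus: "prob_space (torus n)"
proof -
  interpret finite_product_prob_space "\<lambda>_. restrict_space lborel {0..1::real}" "{..<n}"
    by unfold_locales auto
  show ?thesis unfolding torus_def by (rule prob_space_axioms)
qed

lemma norm_angle [simp]: "norm (angle \<theta> i) = 1"
  and angle_nonzero [simp]: "angle \<theta> i \<noteq> 0"
  by (simp_all add: angle_def)

lemma measurable_angle: "i < n \<Longrightarrow> (\<lambda>\<theta>. angle \<theta> i) \<in> borel_measurable (torus n)"
proof -
  assume i: "i < n"
  have "(\<lambda>\<theta>. \<theta> i) \<in> measurable (torus n) (restrict_space lborel {0..1})"
    unfolding torus_def using i by (intro measurable_component_singleton) simp
  moreover have "(\<lambda>t. cis (2 * pi * t)) \<in> borel_measurable (restrict_space lborel {0..1})"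
    by (intro measurable_restrict_space1) (auto intro!: borel_measurable_continuous_onI continuous_intros)
  ultimately show ?thesis
    unfolding angle_def using measurable_compose by blast
qed

text \<open>Functions of the angles that are bounded and measurable, packaged so that integrability
  follows structurally.\<close>

definition torus_nice :: "nat \<Rightarrow> ((nat \<Rightarrow> complex) \<Rightarrow> complex) \<Rightarrow> bool" where
  "torus_nice n F \<longleftrightarrow> (\<lambda>\<theta>. F (angle \<theta>)) \<in> borel_measurable (torus n) \<and> (\<exists>b. \<forall>\<theta>. norm (F (angle \<theta>)) \<le> b)"

lemma torus_nice_integrable: "torus_nice n F \<Longrightarrow> integrable (torus n) (\<lambda>\<theta>. F (angle \<theta>))"
proof -
  assume F: "torus_nice n F"
  interpret prob_space "torus n" by (rule prob_space_torus)
  show ?thesis using F unfolding torus_nice_def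
    by (auto intro!: integrable_const_bound)
qed

lemma torus_nice_const: "torus_nice n (\<lambda>_. c)"
  by (auto simp: torus_nice_def)

lemma torus_nice_coord: "i < n \<Longrightarrow> torus_nice n (\<lambda>z. z i)"
  by (auto simp: torus_nice_def measurable_angle intro!: exI[of _ 1])

lemma torus_nice_inverse_coord: "i < n \<Longrightarrow> torus_nice n (\<lambda>z. inverse (z i))"
  by (auto simp: torus_nice_def norm_inverse intro!: exI[of _ 1] borel_measurable_inverse measurable_angle)

lemma torus_nice_add: "torus_nice n F \<Longrightarrow> torus_nice n G \<Longrightarrow> torus_nice n (\<lambda>z. F z + G z)"
proof -
  assume F: "torus_nice n F" and G: "torus_nice n G"
  obtain b c where "\<And>\<theta>. norm (F (angle \<theta>)) \<le> b" "\<And>\<theta>. norm (G (angle \<theta>)) \<le> c"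
    using F G unfolding torus_nice_def by blast
  then have "norm (F (angle \<theta>) + G (angle \<theta>)) \<le> b + c" for \<theta>
    by (intro norm_triangle_le add_mono)
  then show ?thesis using F G by (auto simp: torus_nice_def intro!: borel_measurable_add)
qed

lemma torus_nice_mult: "torus_nice n F \<Longrightarrow> torus_nice n G \<Longrightarrow> torus_nice n (\<lambda>z. F z * G z)"
proof -
  assume F: "torus_nice n F" and G: "torus_nice n G"
  obtain b c where b: "\<And>\<theta>. norm (F (angle \<theta>)) \<le> b" and c: "\<And>\<theta>. norm (G (angle \<theta>)) \<le> c"
    using F G unfolding torus_nice_def by blast
  have "norm (F (angle \<theta>) * G (angle \<theta>)) \<le> b * c" for \<theta>
    unfolding norm_mult using b[of \<theta>] c[of \<theta>] by (intro mult_mono) (auto intro: order_trans[OF norm_ge_zero])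
  then show ?thesis using F G by (auto simp: torus_nice_def intro!: borel_measurable_times)
qed

lemma torus_nice_minus: "torus_nice n F \<Longrightarrow> torus_nice n (\<lambda>z. - F z)"
  using torus_nice_mult[OF torus_nice_const[of n "-1"]] by simp

lemma torus_nice_diff: "torus_nice n F \<Longrightarrow> torus_nice n G \<Longrightarrow> torus_nice n (\<lambda>z. F z - G z)"
  using torus_nice_add[OF _ torus_nice_minus] by simp

lemma torus_nice_divide: "torus_nice n F \<Longrightarrow> i < n \<Longrightarrow> torus_nice n (\<lambda>z. F z / z i)"
  unfolding divide_inverse by (intro torus_nice_mult torus_nice_inverse_coord)

lemma torus_nice_sum: "(\<And>x. x \<in> S \<Longrightarrow> torus_nice n (F x)) \<Longrightarrow> torus_nice n (\<lambda>z. \<Sum>x\<in>S. F x z)"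
  by (induction S rule: infinite_finite_induct) (auto intro: torus_nice_const torus_nice_add)

lemma torus_nice_prod: "(\<And>x. x \<in> S \<Longrightarrow> torus_nice n (F x)) \<Longrightarrow> torus_nice n (\<lambda>z. \<Prod>x\<in>S. F x z)"
  by (induction S rule: infinite_finite_induct) (auto intro: torus_nice_const torus_nice_mult)

lemma torus_nice_power: "torus_nice n F \<Longrightarrow> torus_nice n (\<lambda>z. F z ^ m)"
  by (induction m) (auto intro: torus_nice_const torus_nice_mult)

lemma torus_nice_if: "torus_nice n F \<Longrightarrow> torus_nice n G \<Longrightarrow> torus_nice n (\<lambda>z. if P then F z else G z)"
  by (cases P) auto

lemmas torus_nice_intros = torus_nice_const torus_nice_coord torus_nice_inverse_coord torus_nice_add
  torus_nice_diff torus_nice_minus torus_nice_mult torus_nice_divide torus_nice_sum torus_nice_prod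
  torus_nice_power torus_nice_if

text \<open>Here \<open>s\<close> is the logarithm of coordinate \<open>a\<close>. One turn of the
  circle moves \<open>s\<close> from \<open>0\<close> to \<open>2 \<pi> \<i>\<close> and returns
  \<open>exp s\<close> to its start, so the integral over this angle vanishes; Fubini handles the
  other angles.\<close>

lemma torus_integral_derivative:
  fixes F D :: "(nat \<Rightarrow> complex) \<Rightarrow> complex"
  assumes a: "a < n"
    and deriv: "\<And>z s. ((\<lambda>s. F (z(a := exp s))) has_field_derivative D (z(a := exp s))) (at s)"
    and cont: "\<And>z. continuous_on UNIV (\<lambda>s. D (z(a := exp s)))"
    and nice: "torus_nice n D"
  shows "(LINT \<theta>|torus n. D (angle \<theta>)) = 0"
proof -
  have ins: "insert a ({..<n} - {a}) = {..<n}" using a by auto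
  have upd: "angle (\<theta>(a := t)) = (angle \<theta>)(a := exp (2 * complex_of_real pi * \<i> * complex_of_real t))" for \<theta> t
    by (auto simp: angle_def fun_eq_iff cis_conv_exp mult_ac)
  have "(LINT t|restrict_space lborel {0..1}. D (z(a := exp (2 * complex_of_real pi * \<i> * complex_of_real t)))) = 0" for z
  proof -
    let ?c = "2 * complex_of_real pi * \<i>"
    have c: "?c \<noteq> 0" by simp
    have "(LINT t|lborel. indicator {0..1} t *\<^sub>R D (z(a := exp (?c * complex_of_real t))))
       = F (z(a := exp (?c * complex_of_real 1))) / ?c - F (z(a := exp (?c * complex_of_real 0))) / ?c"
    proof (rule integral_FTC_Icc)
      show "((\<lambda>t. F (z(a := exp (?c * complex_of_real t))) / ?c) has_vector_derivative
          D (z(a := exp (?c * complex_of_real t)))) (at t within {0..1})" for t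
      proof -
        have "((\<lambda>s. F (z(a := exp (?c * s)))) has_field_derivative D (z(a := exp (?c * complex_of_real t))) * ?c) (at (complex_of_real t))"
          by (rule DERIV_chain'[OF _ deriv]) (auto intro!: derivative_eq_intros)
        then have "((\<lambda>s. F (z(a := exp (?c * s))) / ?c) has_field_derivative D (z(a := exp (?c * complex_of_real t)))) (at (complex_of_real t))"
          using DERIV_cdivide[of _ _ _ _ ?c] c by fastforce
        then show ?thesis by (rule has_vector_derivative_real_field)
      qed
      show "continuous_on {0..1} (\<lambda>t. D (z(a := exp (?c * complex_of_real t))))"
        by (rule continuous_on_compose2[OF cont]) (auto intro!: continuous_intros)
    qed simp
    also have "\<dots> = 0"
      using exp_two_pi_i by (simp add: mult_ac)
    finally show ?thesis by (simp add: integral_restrict_space)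
  qed
  note inner = this
  have "integrable (\<Pi>\<^sub>M i\<in>insert a ({..<n} - {a}). restrict_space lborel {0..1}) (\<lambda>\<theta>. D (angle \<theta>))"
    using torus_nice_integrable[OF nice] by (simp only: ins torus_def)
  then have "(LINT \<theta>|(\<Pi>\<^sub>M i\<in>insert a ({..<n} - {a}). restrict_space lborel {0..1}). D (angle \<theta>)) = 0"
    by (subst unit_interval.product_integral_insert) (simp_all add: upd inner)
  then show ?thesis by (simp only: ins torus_def)
qed

subsection \<open>The Toeplitz determinant as a torus integral\<close>

text \<open>On the circle \<open>z = exp (2 \<pi> \<i> t)\<close> one has
  \<open>dz / z = 2 \<pi> \<i> dt\<close>, which cancels the prefactor of
  \<open>fourier_coeff\<close>.\<close>

lemma integral_unit_interval_eq_fourier: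
  assumes f: "continuous_on (sphere 0 1) f"
  shows "(LINT t|restrict_space lborel {0..1}. cis (2 * pi * t) powi (- k) * f (cis (2 * pi * t))) = fourier_coeff f k"
    and "integrable (restrict_space lborel {0..1}) (\<lambda>t. cis (2 * pi * t) powi (- k) * f (cis (2 * pi * t)))"
proof -
  let ?h = "\<lambda>t. cis (2 * pi * t) powi (- k) * f (cis (2 * pi * t))"
  have cont: "continuous_on {0..1} ?h"
    by (intro continuous_intros continuous_on_compose2[OF f]) (auto intro!: continuous_intros)
  have int: "set_integrable lborel {0..1} ?h"
    by (rule borel_integrable_atLeastAtMost'[OF cont])
  then show "integrable (restrict_space lborel {0..1}) ?h"
    by (simp add: integrable_restrict_space set_integrable_def)
  have "(LINT t|restrict_space lborel {0..1}. ?h t) = integral {0..1} ?h"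
    using set_borel_integral_eq_integral(2)[OF int]
    by (simp add: integral_restrict_space set_lebesgue_integral_def)
  also have "\<dots> = fourier_coeff f k"
  proof -
    have "contour_integral (circlepath 0 1) (\<lambda>z. z powi (- k) * f z / z) =
      integral {0..1} (\<lambda>t. 2 * of_real pi * \<i> * ?h t)"
    proof -
      have c: "circlepath 0 1 t = cis (2 * pi * t)" for t
        by (simp add: circlepath cis_conv_exp mult_ac)
      have v: "vector_derivative (circlepath 0 1) (at t) = 2 * of_real pi * \<i> * cis (2 * pi * t)" for t
        by (simp add: vector_derivative_circlepath cis_conv_exp mult_ac)
      have "w powi (- k) * f w / w * (2 * of_real pi * \<i> * w) = 2 * of_real pi * \<i> * (w powi (- k) * f w)"
        if "w \<noteq> 0" for w
        using that by simp
      note eq = this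
      show ?thesis
        unfolding contour_integral_integral c v
        by (rule Henstock_Kurzweil_Integration.integral_cong, rule eq) simp
    qed
    then show ?thesis by (simp add: fourier_coeff_def)
  qed
  finally show "(LINT t|restrict_space lborel {0..1}. ?h t) = fourier_coeff f k" .
qed

lemma torus_nice_vand_sq: "torus_nice n (vand_sq n)"
  unfolding vand_sq_def case_prod_beta
  by (intro torus_nice_intros) auto

text \<open>This is Heine's identity. The two Vandermonde determinants become sums over
  permutations, after which the integral factors into Fourier coefficients.\<close>

theorem torus_integral_vand_sq:
  assumes f: "continuous_on (sphere 0 1) f"
  shows "(LINT \<theta>|torus n. vand_sq n (angle \<theta>) * (\<Prod>i<n. f (angle \<theta> i))) = fact n * toeplitz_det n f"
proof -
  let ?S = "{\<sigma>. \<sigma> permutes {0..<n}}"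
  let ?sg = "\<lambda>\<sigma>. of_int (sign \<sigma>) :: complex"
  let ?p = "\<lambda>\<tau> \<sigma> \<theta>. \<Prod>i\<in>{..<n}. angle \<theta> i powi (- (int (\<tau> i) - int (\<sigma> i))) * f (angle \<theta> i)"
  have fin: "finite ?S" by (rule finite_permutations) simp
  have eq: "vand_sq n (angle \<theta>) * (\<Prod>i<n. f (angle \<theta> i)) =
     (\<Sum>\<tau>\<in>?S. \<Sum>\<sigma>\<in>?S. ?sg \<tau> * ?sg \<sigma> *
        ?p \<tau> \<sigma> \<theta>)" for \<theta>
  proof -
    have "vand_sq n (angle \<theta>) = (\<Sum>\<sigma>\<in>?S. ?sg \<sigma> * (\<Prod>i\<in>{0..<n}. angle \<theta> i ^ \<sigma> i))
       * (\<Sum>\<tau>\<in>?S. ?sg \<tau> * (\<Prod>i\<in>{0..<n}. inverse (angle \<theta> i) ^ \<tau> i))"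
      by (simp add: vand_sq_eq vandermonde_eq_sum)
    also have "\<dots> = (\<Sum>\<tau>\<in>?S. \<Sum>\<sigma>\<in>?S. ?sg \<tau> * ?sg \<sigma> *
        (\<Prod>i\<in>{..<n}. angle \<theta> i ^ \<sigma> i * inverse (angle \<theta> i) ^ \<tau> i))"
      unfolding sum_product by (subst sum.swap) (simp add: prod.distrib atLeast0LessThan mult_ac)
    also have "\<dots> = (\<Sum>\<tau>\<in>?S. \<Sum>\<sigma>\<in>?S. ?sg \<tau> * ?sg \<sigma> *
        (\<Prod>i\<in>{..<n}. angle \<theta> i powi (- (int (\<tau> i) - int (\<sigma> i)))))"
    proof -
      have "w ^ k * inverse w ^ l = w powi (- (int l - int k))" if "w \<noteq> 0" for w :: complex and k l
        using that by (simp add: power_int_diff power_inverse divide_inverse)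
      then show ?thesis by simp
    qed
    finally show ?thesis
      by (simp only: sum_distrib_right prod.distrib mult.assoc)
  qed
  have int: "integrable (restrict_space lborel {0..1}) (\<lambda>t. cis (2 * pi * t) powi (- k) * f (cis (2 * pi * t)))" for k
    by (rule integral_unit_interval_eq_fourier(2)[OF f])
  have inte: "integrable (torus n) (\<lambda>\<theta>. ?p \<tau> \<sigma> \<theta>)" for \<tau> \<sigma>
    unfolding torus_def angle_def by (rule unit_interval.product_integrable_prod[OF finite_lessThan int])
  have prod: "(LINT \<theta>|torus n. ?p \<tau> \<sigma> \<theta>)
     = (\<Prod>i\<in>{..<n}. fourier_coeff f (int (\<tau> i) - int (\<sigma> i)))" for \<tau> \<sigma>
    unfolding torus_def angle_def unit_interval.product_integral_prod[OF finite_lessThan int]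
      integral_unit_interval_eq_fourier(1)[OF f] ..
  have "(LINT \<theta>|torus n. vand_sq n (angle \<theta>) * (\<Prod>i<n. f (angle \<theta> i))) =
     (\<Sum>\<tau>\<in>?S. \<Sum>\<sigma>\<in>?S. ?sg \<tau> * ?sg \<sigma> * (\<Prod>i\<in>{..<n}. fourier_coeff f (int (\<tau> i) - int (\<sigma> i))))"
  proof -
    have "(LINT \<theta>|torus n. (\<Sum>\<tau>\<in>?S. \<Sum>\<sigma>\<in>?S. ?sg \<tau> * ?sg \<sigma> *
        ?p \<tau> \<sigma> \<theta>))
      = (\<Sum>\<tau>\<in>?S. \<Sum>\<sigma>\<in>?S. ?sg \<tau> * ?sg \<sigma> * (LINT \<theta>|torus n.
        ?p \<tau> \<sigma> \<theta>))"
      by (simp only: Bochner_Integration.integral_sum Bochner_Integration.integrable_sum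
          Bochner_Integration.integrable_mult_right inte integral_mult_right_zero)
    then show ?thesis by (simp only: eq prod)
  qed
  also have "\<dots> = (\<Sum>\<tau>\<in>?S. toeplitz_det n f)"
  proof (rule sum.cong[OF refl])
    fix \<tau> assume "\<tau> \<in> ?S"
    then have \<tau>: "\<tau> permutes {0..<n}" by simp
    have p\<tau>: "permutation \<tau>" using \<tau> by (auto simp: permutation_permutes)
    \<comment> \<open>Writing the second permutation as \<open>\<pi> \<circ> \<tau>\<close> and
      relabelling the product removes \<open>\<tau>\<close>, whose sign occurs squared; each
      \<open>\<tau>\<close> thus contributes one copy of the determinant, giving
      \<open>fact n\<close>.\<close>
    have "(\<Sum>\<sigma>\<in>?S. ?sg \<tau> * ?sg \<sigma> * (\<Prod>i\<in>{..<n}. fourier_coeff f (int (\<tau> i) - int (\<sigma> i))))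
       = (\<Sum>\<pi>\<in>?S. ?sg \<tau> * ?sg (\<pi> \<circ> \<tau>) * (\<Prod>i\<in>{..<n}. fourier_coeff f (int (\<tau> i) - int ((\<pi> \<circ> \<tau>) i))))"
      by (rule sum_permutations_compose_right[OF \<tau>])
    also have "\<dots> = (\<Sum>\<pi>\<in>?S. ?sg \<pi> * (\<Prod>j\<in>{0..<n}. fourier_coeff f (int j - int (\<pi> j))))"
    proof (rule sum.cong[OF refl])
      fix \<pi> assume "\<pi> \<in> ?S"
      then have \<pi>: "permutation \<pi>" by (auto simp: permutation_permutes)
      have "?sg \<tau> * ?sg (\<pi> \<circ> \<tau>) = ?sg \<pi>"
        unfolding sign_compose[OF \<pi> p\<tau>] by (simp add: sign_def)
      moreover have "(\<Prod>i\<in>{..<n}. fourier_coeff f (int (\<tau> i) - int ((\<pi> \<circ> \<tau>) i))) = (\<Prod>j\<in>{0..<n}. fourier_coeff f (int j - int (\<pi> j)))"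
        using prod.permute[OF \<tau>, of "\<lambda>j. fourier_coeff f (int j - int (\<pi> j))"]
        by (simp add: o_def atLeast0LessThan)
      ultimately show "?sg \<tau> * ?sg (\<pi> \<circ> \<tau>) * (\<Prod>i\<in>{..<n}. fourier_coeff f (int (\<tau> i) - int ((\<pi> \<circ> \<tau>) i)))
         = ?sg \<pi> * (\<Prod>j\<in>{0..<n}. fourier_coeff f (int j - int (\<pi> j)))" by simp
    qed
    also have "\<dots> = toeplitz_det n f"
      unfolding toeplitz_det_def Determinant.det_def
      by (auto intro!: sum.cong prod.cong simp: sign_def permutes_in_image[THEN iffD2])
    finally show "(\<Sum>\<sigma>\<in>?S. ?sg \<tau> * ?sg \<sigma> * (\<Prod>i\<in>{..<n}. fourier_coeff f (int (\<tau> i) - int (\<sigma> i)))) = toeplitz_det n f" .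
  qed
  also have "\<dots> = fact n * toeplitz_det n f"
    by (simp add: card_permutations[of "{0..<n}" n])
  finally show ?thesis .
qed

section \<open>The loop equation on the torus\<close>

definition diag_matrix :: "('n \<Rightarrow> nat) \<Rightarrow> (nat \<Rightarrow> complex) \<Rightarrow> complex^'n^'n" where
  "diag_matrix e z = (\<chi> p q. if p = q then z (e p) else 0)"

lemma diag_matrix_nth: "diag_matrix e z $ p $ q = (if p = q then z (e p) else 0)"
  by (simp add: diag_matrix_def)

lemma diag_matrix_mult: "(diag_matrix e z ** Z) $ p $ q = z (e p) * Z $ p $ q"
  by (simp add: matrix_matrix_mult_def diag_matrix_nth if_distrib[of "\<lambda>x. x * _"] cong: if_cong)

lemma newton_mat_diag_off: "p \<noteq> q \<Longrightarrow> newton_mat i (diag_matrix e z) $ p $ q = 0"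
  by (induction i) (auto simp: newton_mat_Suc diag_matrix_mult diag_matrix_nth)

lemma newton_mat_diag_Suc:
  "newton_mat (Suc i) (diag_matrix e z) $ p $ p = z (e p) * (newton_coeff i (diag_matrix e z) + newton_mat i (diag_matrix e z) $ p $ p)"
  by (simp add: newton_mat_Suc diag_matrix_mult diag_matrix_nth algebra_simps)

text \<open>The off-diagonal derivative at a diagonal matrix is a divided difference of diagonal
  entries, stated with the denominator cleared. This ties the directions that leave the torus to
  differences \<open>z (e p) - z (e q)\<close>, as they occur in the Vandermonde factor.\<close>

lemma newton_deriv_diag_off:
  assumes pq: "p \<noteq> q"
  shows "(z (e p) - z (e q)) * newton_deriv i (diag_matrix e z) (unit_mat p q) $ p $ q
    = z (e q) * (newton_mat i (diag_matrix e z) $ p $ p - newton_mat i (diag_matrix e z) $ q $ q)"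
proof (induction i)
  case (Suc i)
  have "newton_deriv (Suc i) (diag_matrix e z) (unit_mat p q) $ p $ q
    = newton_mat (Suc i) (diag_matrix e z) $ q $ q + z (e p) * newton_deriv i (diag_matrix e z) (unit_mat p q) $ p $ q"
    using pq by (simp add: unit_mat_mult diag_matrix_mult diag_matrix_nth)
  then have "(z (e p) - z (e q)) * newton_deriv (Suc i) (diag_matrix e z) (unit_mat p q) $ p $ q
    = (z (e p) - z (e q)) * newton_mat (Suc i) (diag_matrix e z) $ q $ q
      + z (e p) * ((z (e p) - z (e q)) * newton_deriv i (diag_matrix e z) (unit_mat p q) $ p $ q)"
    by (simp add: algebra_simps)
  then show ?case
    unfolding Suc newton_mat_diag_Suc by (simp add: algebra_simps)
qed simp

lemma diag_matrix_unitary: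
  assumes "\<And>i. norm (z i) = 1"
  shows "diag_matrix e z \<in> unitary_group"
proof -
  have zz: "z i * cnj (z i) = 1" for i
    using assms[of i] by (simp add: complex_norm_square[symmetric])
  have "diag_matrix e z ** conj_transpose (diag_matrix e z) = scalar_mat 1"
    by (auto simp: matrix_eq_iff diag_matrix_mult diag_matrix_nth zz scalar_mat_def)
  moreover have c: "conj_transpose (diag_matrix e z) = diag_matrix e (\<lambda>i. cnj (z i))"
    by (auto simp: matrix_eq_iff diag_matrix_nth)
  have "conj_transpose (diag_matrix e z) ** diag_matrix e z = scalar_mat 1"
    unfolding c using zz by (auto simp: matrix_eq_iff diag_matrix_mult diag_matrix_nth scalar_mat_def mult.commute)
  ultimately show ?thesis by (simp add: unitary_group_def)
qed

lemma diag_matrix_eq_sum: "diag_matrix e z = (\<Sum>p\<in>UNIV. scale_mat (z (e p)) (unit_mat p p))"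
proof -
  have "(\<Sum>r\<in>UNIV. scale_mat (z (e r)) (unit_mat r r) $ p $ q) = (if p = q then z (e p) else 0)" for p q
  proof -
    have "(\<Sum>r\<in>UNIV. scale_mat (z (e r)) (unit_mat r r) $ p $ q) = (\<Sum>r\<in>UNIV. if r = p then if p = q then z (e p) else 0 else 0)"
      by (intro sum.cong) (auto simp: unit_mat_def)
    then show ?thesis by simp
  qed
  then show ?thesis
    by (simp add: matrix_eq_iff sum_component diag_matrix_nth)
qed

lemma torus_nice_diag_matrix:
  fixes h :: "complex^'n^'n \<Rightarrow> complex"
  assumes e: "\<And>p. e p < n" and h: "continuous_on UNIV h"
  shows "torus_nice n (\<lambda>z. h (diag_matrix e z))"
proof -
  have "(\<lambda>\<theta>. scale_mat (angle \<theta> (e p)) (unit_mat p p :: complex^'n^'n)) \<in> borel_measurable (torus n)" for p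
    by (rule measurable_compose[OF measurable_angle[OF e[of p]], of "\<lambda>c. scale_mat c (unit_mat p p :: complex^'n^'n)"])
       (intro borel_measurable_continuous_onI continuous_intros)
  then have "(\<lambda>\<theta>. diag_matrix e (angle \<theta>) :: complex^'n^'n) \<in> borel_measurable (torus n)"
    unfolding diag_matrix_eq_sum by (intro borel_measurable_sum)
  then have "(\<lambda>\<theta>. h (diag_matrix e (angle \<theta>))) \<in> borel_measurable (torus n)"
    by (rule measurable_compose[OF _ borel_measurable_continuous_onI[OF h]])
  moreover obtain b where "\<And>A. A \<in> unitary_group \<Longrightarrow> norm (h A) \<le> b"
    using bounded_on_unitary[OF continuous_on_subset[OF h]] by blast
  ultimately show ?thesis
    by (auto simp: torus_nice_def diag_matrix_unitary intro!: exI[of _ b])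
qed

text \<open>\<open>zeta u v\<close> is the logarithmic derivative of \<open>2 - u / v - v / u\<close> in \<open>u\<close>; both it and the
  derivative vanish for \<open>u = v\<close>, where the quotient takes the junk value \<open>0\<close>.\<close>

definition zeta :: "complex \<Rightarrow> complex \<Rightarrow> complex" where
  "zeta u v = (u + v) / (u - v)"

lemma zeta_commute: "zeta v u = - zeta u v"
  by (simp add: zeta_def add.commute) (metis minus_diff_eq minus_divide_right)

lemma zeta_mult:
  assumes "u \<noteq> 0" "v \<noteq> 0"
  shows "(2 - u / v - v / u) * zeta u v = v / u - u / v"
proof (cases "u = v")
  case False
  have "(2 - u / v - v / u) = - ((u - v) * (u - v)) / (u * v)" "v / u - u / v = - ((u - v) * (u + v)) / (u * v)"
    using assms by (simp_all add: field_simps)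
  then show ?thesis using False by (simp add: zeta_def)
qed (simp add: zeta_def)

section \<open>Derivatives of the torus weight in logarithmic coordinates\<close>

abbreviation pairs :: "nat \<Rightarrow> (nat \<times> nat) set" where
  "pairs n \<equiv> {(i, j). i < j \<and> j < n}"

text \<open>Written by the product rule as a Laurent polynomial, so that it stays bounded and
  continuous where coordinates collide; the logarithmic derivative alone is unbounded there.\<close>

definition vand_sq_deriv :: "nat \<Rightarrow> nat \<Rightarrow> (nat \<Rightarrow> complex) \<Rightarrow> complex" where
  "vand_sq_deriv n a z = (\<Sum>(i, j)\<in>pairs n.
     (if i = a then z j / z i - z i / z j else if j = a then z i / z j - z j / z i else 0)
     * (\<Prod>(k, l)\<in>pairs n - {(i, j)}. 2 - z k / z l - z l / z k))"

definition log_deriv :: "nat \<Rightarrow> (nat \<Rightarrow> complex) \<Rightarrow> nat \<times> nat \<Rightarrow> complex" where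
  "log_deriv a z = (\<lambda>(i, j). if i = a then zeta (z i) (z j) else if j = a then zeta (z j) (z i) else 0)"

lemma vand_sq_deriv_eq:
  assumes nz: "\<And>i. i < n \<Longrightarrow> z i \<noteq> 0"
  shows "vand_sq_deriv n a z = vand_sq n z * (\<Sum>x\<in>pairs n. log_deriv a z x)"
  unfolding vand_sq_deriv_def sum_distrib_left
proof (rule sum.cong[OF refl], clarify)
  fix i j assume ij: "i < j" "j < n"
  have g: "(if i = a then z j / z i - z i / z j else if j = a then z i / z j - z j / z i else 0)
     = (2 - z i / z j - z j / z i) * log_deriv a z (i, j)"
    using zeta_mult[of "z i" "z j"] zeta_mult[of "z j" "z i"] nz[of i] nz[of j] ij
    by (auto simp: log_deriv_def algebra_simps)
  have "vand_sq n z = (2 - z i / z j - z j / z i) * (\<Prod>(k, l)\<in>pairs n - {(i, j)}. 2 - z k / z l - z l / z k)"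
    unfolding vand_sq_def by (subst prod.remove[of _ "(i, j)"]) (use ij finite_pairs in auto)
  then show "(if i = a then z j / z i - z i / z j else if j = a then z i / z j - z j / z i else 0)
     * (\<Prod>(k, l)\<in>pairs n - {(i, j)}. 2 - z k / z l - z l / z k) = vand_sq n z * log_deriv a z (i, j)"
    unfolding g by (simp add: mult_ac)
qed

lemma vand_sq_has_derivative:
  "((\<lambda>s. vand_sq n (z(a := exp s))) has_field_derivative vand_sq_deriv n a (z(a := exp s))) (at s)"
proof -
  have 1: "((\<lambda>s. 2 - (z(a := exp s)) i / (z(a := exp s)) j - (z(a := exp s)) j / (z(a := exp s)) i) has_field_derivative
      (if i = a then (z(a := exp s)) j / (z(a := exp s)) i - (z(a := exp s)) i / (z(a := exp s)) j
       else if j = a then (z(a := exp s)) i / (z(a := exp s)) j - (z(a := exp s)) j / (z(a := exp s)) i else 0)) (at s)"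
    if "i < j" for i j
  proof -
    have "((\<lambda>s. 2 - exp s / c - c / exp s) has_field_derivative (c / exp s - exp s / c)) (at s)" for c
    proof -
      have "((\<lambda>s. 2 - exp s * inverse c - c * exp (- s)) has_field_derivative (c * exp (- s) - exp s * inverse c)) (at s)"
        by (auto intro!: derivative_eq_intros)
      then show ?thesis by (simp add: exp_minus divide_inverse)
    qed
    moreover have "((\<lambda>s. 2 - c / exp s - exp s / c) has_field_derivative (c / exp s - exp s / c)) (at s)" for c
    proof -
      have "((\<lambda>s. 2 - c * exp (- s) - exp s * inverse c) has_field_derivative (c * exp (- s) - exp s * inverse c)) (at s)"
        by (auto intro!: derivative_eq_intros)
      then show ?thesis by (simp add: exp_minus divide_inverse)
    qed
    ultimately show ?thesis using that by auto
  qed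
  show ?thesis
    unfolding vand_sq_def vand_sq_deriv_def case_prod_beta prod.collapse
    by (rule has_field_derivative_prod) (use 1 in auto)
qed

lemma torus_nice_vand_sq_deriv: "torus_nice n (vand_sq_deriv n a)"
  unfolding vand_sq_deriv_def case_prod_beta
  by (intro torus_nice_intros) auto

lemma continuous_on_divide_upd: "continuous_on UNIV (\<lambda>s. (z(a := exp s)) i / (z(a := exp s)) j :: complex)"
  by (cases "i = a"; cases "j = a") (auto simp: divide_inverse exp_minus[symmetric] intro!: continuous_intros)

lemma continuous_on_vand_sq: "continuous_on UNIV (\<lambda>s. vand_sq n (z(a := exp s)))"
  unfolding vand_sq_def case_prod_beta by (intro continuous_intros continuous_on_divide_upd)

lemma continuous_on_vand_sq_deriv: "continuous_on UNIV (\<lambda>s. vand_sq_deriv n a (z(a := exp s)))"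
proof -
  have "continuous_on UNIV (\<lambda>s. if i = a then F s else if j = a then G s else (0::complex))"
    if "continuous_on UNIV F" "continuous_on UNIV G" for F G :: "complex \<Rightarrow> complex" and i j
    using that by (cases "i = a"; cases "j = a") auto
  note [continuous_intros] = this
  show ?thesis
    unfolding vand_sq_deriv_def case_prod_beta by (intro continuous_intros continuous_on_divide_upd)
qed

definition inv_prod :: "nat \<Rightarrow> nat \<Rightarrow> (nat \<Rightarrow> complex) \<Rightarrow> complex" where
  "inv_prod n m z = (\<Prod>i<n. inverse (z i)) ^ m"

lemma torus_nice_inv_prod: "torus_nice n (inv_prod n m)"
  unfolding inv_prod_def by (intro torus_nice_intros) auto

lemma inv_prod_upd: "a < n \<Longrightarrow> inv_prod n m (z(a := exp s)) = exp (- s) ^ m * (\<Prod>i\<in>{..<n} - {a}. inverse (z i)) ^ m"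
  unfolding inv_prod_def
  by (subst prod.remove[of _ a]) (auto simp: power_mult_distrib exp_minus intro!: arg_cong2[where f = "(*)"] arg_cong[where f = "\<lambda>x. x ^ m"] prod.cong)

lemma inv_prod_has_derivative:
  assumes "a < n"
  shows "((\<lambda>s. inv_prod n m (z(a := exp s))) has_field_derivative - of_nat m * inv_prod n m (z(a := exp s))) (at s)"
proof -
  have "((\<lambda>s. exp (- s) ^ m * c) has_field_derivative - of_nat m * (exp (- s) ^ m * c)) (at s)" for c :: complex
  proof -
    have "exp (- s) ^ m = exp (- of_nat m * s)" for s :: complex
      by (simp add: exp_of_nat_mult[symmetric])
    then show ?thesis by (auto intro!: derivative_eq_intros)
  qed
  then show ?thesis unfolding inv_prod_upd[OF assms] by simp
qed

lemma continuous_on_inv_prod: "a < n \<Longrightarrow> continuous_on UNIV (\<lambda>s. inv_prod n m (z(a := exp s)))"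
  unfolding inv_prod_upd by (intro continuous_intros)

lemma continuous_on_diag_matrix: "continuous_on UNIV (\<lambda>s. diag_matrix e (z(a := exp s)))"
proof (rule continuous_on_matrix)
  fix p q
  show "continuous_on UNIV (\<lambda>s. diag_matrix e (z(a := exp s)) $ p $ q)"
    by (cases "p = q"; cases "e p = a") (auto simp: diag_matrix_nth intro!: continuous_intros)
qed

lemma diag_matrix_has_derivative:
  assumes e: "inj e"
  shows "((\<lambda>s. diag_matrix e (z(e p := exp s)) $ r $ q) has_field_derivative
     (unit_mat p p ** diag_matrix e (z(e p := exp s))) $ r $ q) (at s)"
  using inj_eq[OF e] by (cases "r = q"; cases "r = p") (auto simp: diag_matrix_nth unit_mat_mult intro!: derivative_eq_intros)

definition torus_weight :: "nat \<Rightarrow> nat \<Rightarrow> (nat \<Rightarrow> complex) \<Rightarrow> complex" where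
  "torus_weight n m z = vand_sq n z * inv_prod n m z / fact n"

lemma sum_pairs:
  fixes y :: "nat \<Rightarrow> nat \<Rightarrow> complex"
  shows "(\<Sum>(i, j)\<in>pairs n. y i j + y j i) = (\<Sum>a<n. \<Sum>b\<in>{..<n} - {a}. y a b)"
proof -
  have "(\<Sum>a<n. \<Sum>b\<in>{..<n} - {a}. y a b) = (\<Sum>(a, b)\<in>(SIGMA a:{..<n}. {..<n} - {a}). y a b)"
    by (rule sum.Sigma) auto
  also have "(SIGMA a:{..<n}. {..<n} - {a}) = pairs n \<union> prod.swap ` pairs n"
    by (force simp: image_iff)
  also have "(\<Sum>(a, b)\<in>pairs n \<union> prod.swap ` pairs n. y a b)
     = (\<Sum>(a, b)\<in>pairs n. y a b) + (\<Sum>(a, b)\<in>prod.swap ` pairs n. y a b)"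
    by (rule sum.union_disjoint) (auto simp: finite_pairs)
  also have "(\<Sum>(a, b)\<in>prod.swap ` pairs n. y a b) = (\<Sum>(a, b)\<in>pairs n. y b a)"
    by (subst sum.reindex) (auto simp: inj_on_def intro!: sum.cong)
  also have "(\<Sum>(a, b)\<in>pairs n. y a b) + (\<Sum>(a, b)\<in>pairs n. y b a) = (\<Sum>(i, j)\<in>pairs n. y i j + y j i)"
    unfolding sum.distrib[symmetric] by (intro sum.cong refl) auto
  finally show ?thesis ..
qed

text \<open>A pair factor depends on \<open>z i\<close> and \<open>z j\<close> only, and
  \<open>zeta\<close> is antisymmetric. For constant \<open>c\<close> the sum vanishes, which
  reflects that \<open>vand_sq\<close> depends only on ratios of coordinates.\<close>

lemma sum_log_deriv:
  assumes "i < j" "j < n"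
  shows "(\<Sum>a<n. log_deriv a z (i, j) * c a) = zeta (z i) (z j) * (c i - c j)"
proof -
  have "(\<Sum>a<n. log_deriv a z (i, j) * c a) =
    (\<Sum>a<n. (if a = i then zeta (z i) (z j) * c i else 0) + (if a = j then zeta (z j) (z i) * c j else 0))"
    using assms by (intro sum.cong) (auto simp: log_deriv_def)
  also have "\<dots> = zeta (z i) (z j) * c i + zeta (z j) (z i) * c j"
    using assms by (simp add: sum.distrib)
  finally show ?thesis by (simp add: zeta_commute[of "z j"] algebra_simps)
qed

lemma vand_sq_eq_0:
  assumes "i < j" "j < n" "z i = z j" "z i \<noteq> 0"
  shows "vand_sq n z = 0"
  unfolding vand_sq_def
  by (rule prod_zero[OF finite_pairs], rule bexI[of _ "(i, j)"]) (use assms in auto)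

text \<open>For each pair the two divided differences add up to \<open>zeta\<close> times the
  difference of the diagonal entries, which is the contribution of that pair to the logarithmic
  derivative. The force exerted by the Vandermonde factor therefore equals the off-diagonal part of
  the loop equation.\<close>

lemma vand_sq_interaction:
  fixes e :: "'n::finite \<Rightarrow> nat"
  assumes e: "bij_betw e UNIV {..<n}" and nz: "\<And>i. i < n \<Longrightarrow> z i \<noteq> 0"
  shows "vand_sq n z * (\<Sum>p\<in>UNIV. (\<Sum>x\<in>pairs n. log_deriv (e p) z x) * newton_mat i (diag_matrix e z) $ p $ p)
    = vand_sq n z * (\<Sum>p\<in>UNIV. \<Sum>q\<in>UNIV - {p}. newton_deriv i (diag_matrix e z) (unit_mat p q) $ p $ q)"
proof (cases "vand_sq n z = 0")
  case False
  define e' where "e' = the_inv_into UNIV e"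
  have inj: "inj e" using e by (simp add: bij_betw_def)
  have e'e: "e' (e p) = p" for p by (simp add: e'_def the_inv_into_f_f[OF inj])
  have ee': "e (e' a) = a" if "a < n" for a
    using e that by (auto simp: e'_def bij_betw_def intro!: f_the_inv_into_f[OF inj])
  let ?A = "diag_matrix e z"
  define c where "c a = newton_mat i ?A $ e' a $ e' a" for a
  define y where "y a b = newton_deriv i ?A (unit_mat (e' a) (e' b)) $ e' a $ e' b" for a b
  have "(\<Sum>p\<in>UNIV. (\<Sum>x\<in>pairs n. log_deriv (e p) z x) * newton_mat i ?A $ p $ p)
     = (\<Sum>p\<in>UNIV. (\<lambda>a. (\<Sum>x\<in>pairs n. log_deriv a z x) * c a) (e p))"
    by (simp add: c_def e'e)
  also have "\<dots> = (\<Sum>a<n. (\<Sum>x\<in>pairs n. log_deriv a z x) * c a)"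
    by (rule sum.reindex_bij_betw[OF e])
  also have "\<dots> = (\<Sum>x\<in>pairs n. \<Sum>a<n. log_deriv a z x * c a)"
    unfolding sum_distrib_right by (rule sum.swap)
  also have "\<dots> = (\<Sum>(i, j)\<in>pairs n. y i j + y j i)"
  proof (rule sum.cong[OF refl], clarify)
    fix k l assume kl: "k < l" "l < n"
    \<comment> \<open>Coinciding coordinates would make \<open>vand_sq\<close> vanish, and that case
      has been set aside; the division by \<open>z k - z l\<close> below is thus legitimate.\<close>
    have ne: "z k \<noteq> z l" using vand_sq_eq_0[of k l n z] kl nz[of k] False by auto
    have ne': "e' k \<noteq> e' l" using ee'[of k] ee'[of l] kl by force
    have 1: "(z k - z l) * y k l = z l * (c k - c l)"
      using newton_deriv_diag_off[OF ne', of z e i] kl by (simp add: y_def c_def ee')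
    have 2: "(z l - z k) * y l k = z k * (c l - c k)"
      using newton_deriv_diag_off[OF ne'[symmetric], of z e i] kl by (simp add: y_def c_def ee')
    \<comment> \<open>The two orders of the pair carry \<open>z l\<close> and \<open>z k\<close>;
      together they give \<open>z k + z l\<close>, the numerator of \<open>zeta\<close>.\<close>
    have "(z k - z l) * (y k l + y l k) = (z k + z l) * (c k - c l)"
    proof -
      have "(z k - z l) * (y k l + y l k) = (z k - z l) * y k l - (z l - z k) * y l k"
        by (simp add: algebra_simps)
      then show ?thesis unfolding 1 2 by (simp add: algebra_simps)
    qed
    then have "y k l + y l k = (z k + z l) * (c k - c l) / (z k - z l)"
      using ne by (simp add: nonzero_eq_divide_eq mult.commute)
    then show "(\<Sum>a<n. log_deriv a z (k, l) * c a) = y k l + y l k"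
      unfolding sum_log_deriv[OF kl] zeta_def by simp
  qed
  also have "\<dots> = (\<Sum>a<n. \<Sum>b\<in>{..<n} - {a}. y a b)" by (rule sum_pairs)
  also have "\<dots> = (\<Sum>p\<in>UNIV. (\<lambda>a. \<Sum>b\<in>{..<n} - {a}. y a b) (e p))"
    by (rule sum.reindex_bij_betw[OF e, symmetric])
  also have "\<dots> = (\<Sum>p\<in>UNIV. \<Sum>q\<in>UNIV - {p}. newton_deriv i ?A (unit_mat p q) $ p $ q)"
  proof (rule sum.cong[OF refl])
    fix p
    have "bij_betw e (UNIV - {p}) ({..<n} - {e p})"
      using e by (auto simp: bij_betw_def inj_on_def)
    from sum.reindex_bij_betw[OF this, of "y (e p)"]
    show "(\<Sum>b\<in>{..<n} - {e p}. y (e p) b) = (\<Sum>q\<in>UNIV - {p}. newton_deriv i ?A (unit_mat p q) $ p $ q)"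
      by (simp add: y_def e'e)
  qed
  finally show ?thesis by simp
qed simp

text \<open>The function \<open>D p q\<close> is the derivative, in the logarithm of coordinate
  \<open>e q\<close>, of the unnormalised weight times a diagonal entry of \<open>newton_mat\<close>
  times \<open>newton_prod\<close>, and so integrates to zero. A combination of these derivatives
  reproduces the full loop equation.\<close>

theorem sd_average_torus:
  fixes e :: "'n::finite \<Rightarrow> nat"
  assumes e: "bij_betw e UNIV {..<CARD('n)}"
  shows "sd_average (torus CARD('n)) (\<lambda>\<theta>. torus_weight CARD('n) m (angle \<theta>)) (\<lambda>\<theta>. diag_matrix e (angle \<theta>))"
proof -
  let ?n = "CARD('n)"
  let ?Y = "\<lambda>i z p q. newton_deriv i (diag_matrix e z) (unit_mat p q) $ p $ q"
  have en: "e p < ?n" for p using e by (auto simp: bij_betw_def)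
  have inj: "inj e" using e by (simp add: bij_betw_def)
  have nice_w: "torus_nice ?n (torus_weight ?n m)"
    unfolding torus_weight_def divide_inverse
    by (intro torus_nice_mult torus_nice_const torus_nice_vand_sq torus_nice_inv_prod)
  have nice_h: "torus_nice ?n (\<lambda>z. h (diag_matrix e z))" if "continuous_on UNIV h" for h :: "complex^'n^'n \<Rightarrow> complex"
    by (rule torus_nice_diag_matrix[OF en that])
  have int: "integrable (torus ?n) (\<lambda>\<theta>. torus_weight ?n m (angle \<theta>) * h (diag_matrix e (angle \<theta>)))"
    if "continuous_on UNIV h" for h :: "complex^'n^'n \<Rightarrow> complex"
    using torus_nice_integrable[OF torus_nice_mult[OF nice_w nice_h[OF that]]] .
  have "avg (torus ?n) (\<lambda>\<theta>. torus_weight ?n m (angle \<theta>)) (\<lambda>\<theta>. diag_matrix e (angle \<theta>)) (sd_term i as) = 0" for i as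
  proof -
    define Q where "Q z = newton_prod as (diag_matrix e z)" for z
    define C where "C p z = newton_mat i (diag_matrix e z) $ p $ p" for p z
    define S where "S p q z = sd_fun i as p p (unit_mat q q) (diag_matrix e z)" for p q z
    define D where "D p q z =
      (vand_sq_deriv ?n (e q) z * inv_prod ?n m z - of_nat m * vand_sq ?n z * inv_prod ?n m z) * (C p z * Q z)
      + vand_sq ?n z * inv_prod ?n m z * S p q z" for p q z
    have nice_D: "torus_nice ?n (D p q)" for p q
      unfolding D_def C_def Q_def S_def
      by (intro torus_nice_add torus_nice_diff torus_nice_mult torus_nice_const torus_nice_vand_sq
          torus_nice_vand_sq_deriv torus_nice_inv_prod nice_h continuous_intros)
    have D0: "(LINT \<theta>|torus ?n. D p q (angle \<theta>)) = 0" for p q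
    proof (rule torus_integral_derivative[OF en[of q], where F = "\<lambda>z. vand_sq ?n z * inv_prod ?n m z * (C p z * Q z)"])
      fix z s
      note B = diag_matrix_has_derivative[OF inj, of z q]
      show "((\<lambda>s. vand_sq ?n (z(e q := exp s)) * inv_prod ?n m (z(e q := exp s)) * (C p (z(e q := exp s)) * Q (z(e q := exp s))))
        has_field_derivative D p q (z(e q := exp s))) (at s)"
        unfolding C_def Q_def D_def S_def sd_fun_def
        by (rule DERIV_cong[OF DERIV_mult[OF DERIV_mult[OF vand_sq_has_derivative inv_prod_has_derivative[OF en]]
              DERIV_mult[OF newton_has_derivative(1)[OF B] newton_prod_has_derivative[OF B]]]])
           (simp add: algebra_simps)
      show "continuous_on UNIV (\<lambda>s. D p q (z(e q := exp s)))"
        unfolding D_def C_def Q_def S_def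
        by (intro continuous_intros continuous_on_vand_sq continuous_on_vand_sq_deriv
            continuous_on_inv_prod continuous_on_diag_matrix en)
    qed (rule nice_D)
    \<comment> \<open>The exponent \<open>m\<close> drops out: the double sum contains its
      contribution \<open>N\<close> times, and after division by \<open>N\<close> it cancels the one
      in the single sum.\<close>
    have key: "fact ?n * (torus_weight ?n m z * sd_term i as (diag_matrix e z))
       = (\<Sum>p\<in>UNIV. D p p z) - (\<Sum>p\<in>UNIV. \<Sum>q\<in>UNIV. D p q z) / of_nat ?n"
      if nz: "\<And>i. z i \<noteq> 0" for z
    proof -
      define v w where "v = vand_sq ?n z" and "w = inv_prod ?n m z"
      define L where "L q = (\<Sum>x\<in>pairs ?n. log_deriv (e q) z x)" for q
      have D: "D p q z = v * w * (L q * C p z * Q z) - of_nat m * (v * w * (C p z * Q z)) + v * w * S p q z" for p q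
        by (simp add: D_def vand_sq_deriv_eq nz v_def w_def L_def algebra_simps)
      \<comment> \<open>Rotating all coordinates by a common phase leaves \<open>vand_sq\<close>
        unchanged, so the total logarithmic derivative is zero.\<close>
      have L0: "(\<Sum>q\<in>UNIV. L q) = 0"
      proof -
        have "(\<Sum>q\<in>UNIV. L q) = (\<Sum>a<?n. \<Sum>x\<in>pairs ?n. log_deriv a z x)"
          unfolding L_def by (rule sum.reindex_bij_betw[OF e])
        also have "\<dots> = (\<Sum>x\<in>pairs ?n. \<Sum>a<?n. log_deriv a z x)" by (rule sum.swap)
        also have "\<dots> = 0"
          using sum_log_deriv[of _ _ ?n z "\<lambda>_. 1"] by (intro sum.neutral) auto
        finally show ?thesis .
      qed
      have int: "v * (\<Sum>p\<in>UNIV. L p * C p z) = v * (\<Sum>p\<in>UNIV. \<Sum>q\<in>UNIV - {p}. ?Y i z p q)"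
        unfolding v_def L_def C_def by (rule vand_sq_interaction[OF e nz])
      define T where "T = (\<Sum>p\<in>UNIV. C p z)"
      define Y where "Y = (\<Sum>p\<in>UNIV. \<Sum>q\<in>UNIV - {p}. ?Y i z p q)"
      have "(\<Sum>p\<in>UNIV. \<Sum>q\<in>UNIV. sd_fun i as p q (unit_mat p q) (diag_matrix e z))
        = (\<Sum>p\<in>UNIV. S p p z + (\<Sum>q\<in>UNIV - {p}. ?Y i z p q * Q z))"
      proof (rule sum.cong[OF refl])
        fix p
        have "(\<Sum>q\<in>UNIV. sd_fun i as p q (unit_mat p q) (diag_matrix e z))
          = S p p z + (\<Sum>q\<in>UNIV - {p}. sd_fun i as p q (unit_mat p q) (diag_matrix e z))"
          by (subst sum.remove[of _ p]) (auto simp: S_def)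
        \<comment> \<open>At a diagonal matrix the off-diagonal entries of \<open>newton_mat\<close>
          vanish, so no derivative of \<open>newton_prod\<close> survives for
          \<open>q \<noteq> p\<close>.\<close>
        also have "(\<Sum>q\<in>UNIV - {p}. sd_fun i as p q (unit_mat p q) (diag_matrix e z))
          = (\<Sum>q\<in>UNIV - {p}. ?Y i z p q * Q z)"
          by (intro sum.cong refl) (simp add: sd_fun_def newton_mat_diag_off Q_def)
        finally show "(\<Sum>q\<in>UNIV. sd_fun i as p q (unit_mat p q) (diag_matrix e z))
          = S p p z + (\<Sum>q\<in>UNIV - {p}. ?Y i z p q * Q z)" .
      qed
      then have sd: "sd_term i as (diag_matrix e z) = (\<Sum>p\<in>UNIV. S p p z) + Y * Q z
         - (\<Sum>p\<in>UNIV. \<Sum>q\<in>UNIV. S p q z) / of_nat ?n"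
        by (simp add: sd_term_eq_sd_fun S_def sum.distrib Y_def sum_distrib_right)
      have "(\<Sum>p\<in>UNIV. D p p z) = w * Q z * (v * (\<Sum>p\<in>UNIV. L p * C p z)) - of_nat m * (v * w * (T * Q z)) + v * w * (\<Sum>p\<in>UNIV. S p p z)"
        unfolding D T_def by (simp add: sum.distrib sum_subtractf sum_distrib_left sum_distrib_right mult_ac)
      also have "\<dots> = w * Q z * (v * Y) - of_nat m * (v * w * (T * Q z)) + v * w * (\<Sum>p\<in>UNIV. S p p z)"
        unfolding int Y_def ..
      finally have 1: "(\<Sum>p\<in>UNIV. D p p z) = \<dots>" .
      have "(\<Sum>q\<in>UNIV. D p q z) = v * w * C p z * Q z * (\<Sum>q\<in>UNIV. L q) - of_nat ?n * (of_nat m * (v * w * (C p z * Q z))) + v * w * (\<Sum>q\<in>UNIV. S p q z)" for p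
        unfolding D by (simp add: sum.distrib sum_subtractf sum_distrib_left mult_ac)
      then have 2: "(\<Sum>p\<in>UNIV. \<Sum>q\<in>UNIV. D p q z) = - (of_nat ?n * (of_nat m * (v * w * (T * Q z)))) + v * w * (\<Sum>p\<in>UNIV. \<Sum>q\<in>UNIV. S p q z)"
        unfolding L0 T_def by (simp add: sum.distrib sum_subtractf sum_negf sum_distrib_left sum_distrib_right mult_ac)
      show ?thesis
        unfolding 1 2 sd torus_weight_def v_def[symmetric] w_def[symmetric]
        by (simp add: add_divide_distrib diff_divide_distrib algebra_simps)
    qed
    have intD: "integrable (torus ?n) (\<lambda>\<theta>. D p q (angle \<theta>))" for p q
      by (rule torus_nice_integrable[OF nice_D])
    have "fact ?n * avg (torus ?n) (\<lambda>\<theta>. torus_weight ?n m (angle \<theta>)) (\<lambda>\<theta>. diag_matrix e (angle \<theta>)) (sd_term i as)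
      = (LINT \<theta>|torus ?n. (\<Sum>p\<in>UNIV. D p p (angle \<theta>)) - (\<Sum>p\<in>UNIV. \<Sum>q\<in>UNIV. D p q (angle \<theta>)) / of_nat ?n)"
      unfolding avg_def integral_mult_right_zero[symmetric] by (subst key) simp_all
    also have "\<dots> = 0" by (simp add: intD D0)
    finally show ?thesis by simp
  qed
  then show ?thesis using int unfolding sd_average_def by blast
qed

lemma charpoly_diag_matrix:
  fixes e :: "'n::finite \<Rightarrow> nat"
  assumes e: "bij_betw e UNIV {..<CARD('n)}"
  shows "poly (charpoly (diag_matrix e z)) u = (\<Prod>i<CARD('n). u - z i)"
    and "cdet (diag_matrix e z) = (\<Prod>i<CARD('n). z i)"
proof -
  have "cdet (scalar_mat u - diag_matrix e z) = (\<Prod>p\<in>UNIV. (scalar_mat u - diag_matrix e z) $ p $ p)"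
    by (rule Determinants.det_diagonal) (simp add: diag_matrix_nth scalar_mat_def)
  also have "\<dots> = (\<Prod>p\<in>UNIV. (\<lambda>i. u - z i) (e p))"
    by (simp add: diag_matrix_nth scalar_mat_def)
  also have "\<dots> = (\<Prod>i<CARD('n). u - z i)"
    by (rule prod.reindex_bij_betw[OF e])
  finally show "poly (charpoly (diag_matrix e z)) u = (\<Prod>i<CARD('n). u - z i)"
    by (simp add: poly_charpoly)
  have "cdet (diag_matrix e z) = (\<Prod>p\<in>UNIV. diag_matrix e z $ p $ p)"
    by (rule Determinants.det_diagonal) (simp add: diag_matrix_nth)
  also have "\<dots> = (\<Prod>p\<in>UNIV. z (e p))" by (simp add: diag_matrix_nth)
  also have "\<dots> = (\<Prod>i<CARD('n). z i)" by (rule prod.reindex_bij_betw[OF e])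
  finally show "cdet (diag_matrix e z) = (\<Prod>i<CARD('n). z i)" .
qed

section \<open>Averages of functions of the eigenvalues\<close>

lemma fourier_coeff_cong:
  assumes "\<And>z. norm z = 1 \<Longrightarrow> f z = g z"
  shows "fourier_coeff f k = fourier_coeff g k"
proof -
  have "contour_integral (circlepath 0 1) (\<lambda>z. z powi (- k) * f z / z) = contour_integral (circlepath 0 1) (\<lambda>z. z powi (- k) * g z / z)"
    by (rule contour_integral_eq) (use assms in auto)
  then show ?thesis by (simp add: fourier_coeff_def)
qed

lemma toeplitz_det_cong:
  assumes "\<And>z. norm z = 1 \<Longrightarrow> f z = g z"
  shows "toeplitz_det n f = toeplitz_det n g"
  unfolding toeplitz_det_def by (simp add: fourier_coeff_cong[OF assms])

lemma fourier_coeff_monomial: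
  fixes r k :: int
  shows "fourier_coeff (\<lambda>z. z powi r) k = (if k = r then 1 else 0)"
proof -
  have cont: "continuous_on (sphere 0 1) (\<lambda>z::complex. z powi r)"
    by (intro continuous_intros) auto
  have "fourier_coeff (\<lambda>z. z powi r) k = (LINT t|restrict_space lborel {0..1}. cis (2 * pi * t) powi (- k) * cis (2 * pi * t) powi r)"
    using integral_unit_interval_eq_fourier(1)[OF cont] by simp
  also have "\<dots> = (LINT t|restrict_space lborel {0..1}. exp (2 * complex_of_real pi * \<i> * of_int (r - k) * complex_of_real t))"
  proof (rule Bochner_Integration.integral_cong[OF refl])
    fix t :: real
    have "cis (2 * pi * t) powi (- k) * cis (2 * pi * t) powi r = cis (2 * pi * t) powi (r - k)"
      by (simp add: power_int_add[symmetric])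
    also have "\<dots> = exp (of_int (r - k) * (\<i> * complex_of_real (2 * pi * t)))"
      unfolding cis_conv_exp by (rule exp_power_int[symmetric, THEN sym])
    finally show "cis (2 * pi * t) powi (- k) * cis (2 * pi * t) powi r = exp (2 * complex_of_real pi * \<i> * of_int (r - k) * complex_of_real t)"
      by (simp add: mult_ac)
  qed
  also have "\<dots> = (if k = r then 1 else 0)"
  proof (cases "k = r")
    case True
    have "measure (restrict_space lborel {0..1::real}) (space (restrict_space lborel {0..1})) = 1"
      using prob_space.prob_space[OF prob_space_unit_interval] .
    then show ?thesis using True by simp
  next
    case False
    let ?c = "2 * complex_of_real pi * \<i> * of_int (r - k)"
    have c: "?c \<noteq> 0" using False by simp
    have "(LINT t|lborel. indicator {0..1} t *\<^sub>R exp (?c * complex_of_real t))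
       = exp (?c * complex_of_real 1) / ?c - exp (?c * complex_of_real 0) / ?c"
    proof (rule integral_FTC_Icc)
      show "((\<lambda>t. exp (?c * complex_of_real t) / ?c) has_vector_derivative exp (?c * complex_of_real t)) (at t within {0..1})" for t
      proof -
        have "((\<lambda>s. exp (?c * s) / ?c) has_field_derivative exp (?c * complex_of_real t)) (at (complex_of_real t))"
          using c by (auto intro!: derivative_eq_intros simp del: of_int_diff)
        then show ?thesis by (rule has_vector_derivative_real_field)
      qed
    qed (auto intro!: continuous_intros)
    also have "exp (?c * complex_of_real 1) = 1"
      using exp_integer_2pi[of "of_int (r - k)"] by (simp add: mult_ac del: of_int_diff)
    finally show ?thesis using False by (simp add: integral_restrict_space)
  qed
  finally show ?thesis .
qed

lemma toeplitz_det_monomial: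
  assumes n: "n > 0"
  shows "toeplitz_det n (\<lambda>z. z powi r) = (if r = 0 then 1 else 0)"
proof -
  define A where "A = Matrix.mat n n (\<lambda>(j, k). if int j - int k = r then 1 else 0 :: complex)"
  have D: "toeplitz_det n (\<lambda>z. z powi r) = Determinant.det A"
    by (simp only: toeplitz_det_def fourier_coeff_monomial A_def)
  show ?thesis
  proof (cases "r = 0")
    case True
    have "A = 1\<^sub>m n" using True by (auto simp: A_def)
    then show ?thesis using True D by simp
  next
    case False
    \<comment> \<open>A Toeplitz matrix with one nonzero diagonal of offset \<open>r\<close> has an
      empty first row if \<open>r > 0\<close> and an empty last row if \<open>r < 0\<close>.\<close>
    define i where "i = (if r > 0 then 0 else n - 1)"
    have i: "i < n" using n by (simp add: i_def)
    have 0: "A $$ (i, k) = 0" if "k < n" for k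
      using that False i by (auto simp: A_def i_def)
    have "A \<in> carrier_mat n n" by (simp add: A_def)
    moreover have "(\<Prod>j = 0..<n. A $$ (j, \<sigma> j)) = 0" if "\<sigma> permutes {0..<n}" for \<sigma>
      using 0[of "\<sigma> i"] i permutes_in_image[OF that, of i] by (intro prod_zero) (auto intro!: bexI[of _ i])
    ultimately have "Determinant.det A = 0"
      by (auto simp: Determinant.det_def intro!: sum.neutral)
    then show ?thesis using False D by simp
  qed
qed

abbreviation eig_prod :: "(complex \<Rightarrow> complex) \<Rightarrow> complex^'n^'n \<Rightarrow> complex" where
  "eig_prod f A \<equiv> (\<Prod>z\<in>#eigenvalues A. f z)"

lemma poly_charpoly_eigenvalues: "poly (charpoly A) u = (\<Prod>z\<in>#eigenvalues A. u - z)"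
  by (subst charpoly_eq_prod) (simp add: poly_prod_mset image_mset.compositionality o_def)

lemma prod_mset_prod_list_swap:
  fixes c :: complex
  shows "(\<Prod>z\<in>#M. c * (\<Prod>u\<leftarrow>us. z - u)) = c ^ size M * (\<Prod>u\<leftarrow>us. (-1) ^ size M * (\<Prod>z\<in>#M. u - z))"
proof -
  have swap: "(\<Prod>z\<in>#M. z - u) = (-1) ^ size M * (\<Prod>z\<in>#M. u - z)" for u
    by (induction M) (auto simp: algebra_simps)
  show ?thesis
  proof (induction us)
    case Nil
    then show ?case by (simp add: prod_mset_constant)
  next
    case (Cons u us)
    have "(\<Prod>z\<in>#M. c * (\<Prod>u\<leftarrow>u # us. z - u)) = (\<Prod>z\<in>#M. (z - u) * (c * (\<Prod>u\<leftarrow>us. z - u)))"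
      by (simp add: mult_ac)
    also have "\<dots> = (\<Prod>z\<in>#M. z - u) * (\<Prod>z\<in>#M. c * (\<Prod>u\<leftarrow>us. z - u))"
      by (rule prod_mset.distrib)
    finally show ?case unfolding Cons.IH swap by (simp add: mult_ac)
  qed
qed

lemma complex_poly_factor_list:
  fixes P :: "complex poly"
  obtains us where "length us = degree P" "\<And>z. poly P z = lead_coeff P * (\<Prod>u\<leftarrow>us. z - u)"
proof -
  obtain us where us: "mset us = proots P" using ex_mset by blast
  have "length us = degree P"
    using size_proots_complex[of P] us by (metis size_mset)
  moreover have "poly P z = lead_coeff P * (\<Prod>u\<leftarrow>us. z - u)" for z
  proof -
    have "poly P z = poly (Polynomial.smult (lead_coeff P) (\<Prod>x\<in>#proots P. [:- x, 1:])) z"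
      by (simp only: complex_poly_decompose_multiset)
    also have "\<dots> = lead_coeff P * (\<Prod>u\<in>#mset us. z - u)"
      by (simp add: poly_prod_mset us image_mset.compositionality o_def)
    also have "(\<Prod>u\<in>#mset us. z - u) = (\<Prod>u\<leftarrow>us. z - u)"
      by (simp only: mset_map[symmetric] prod_mset_prod_list)
    finally show ?thesis .
  qed
  ultimately show ?thesis by (rule that)
qed

text \<open>The constant and the roots are the same for all multisets of size \<open>n\<close>, so
  one choice serves every matrix and can be taken out of an average.\<close>

lemma prod_mset_poly_eq:
  fixes P :: "complex poly"
  obtains c us where "length us = degree P"
    "\<And>M. size M = n \<Longrightarrow> (\<Prod>z\<in>#M. poly P z) = c * (\<Prod>u\<leftarrow>us. \<Prod>z\<in>#M. u - z)"
proof -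
  obtain us where len: "length us = degree P" and us: "\<And>z. poly P z = lead_coeff P * (\<Prod>u\<leftarrow>us. z - u)"
    by (rule complex_poly_factor_list[of P], rule that)
  have "(\<Prod>u\<leftarrow>us. k * g u) = k ^ length us * (\<Prod>u\<leftarrow>us. g u)" for k :: complex and g
    by (induction us) auto
  then have "(\<Prod>z\<in>#M. poly P z) = (lead_coeff P ^ n * ((-1) ^ n) ^ length us) * (\<Prod>u\<leftarrow>us. \<Prod>z\<in>#M. u - z)"
    if "size M = n" for M
    unfolding us prod_mset_prod_list_swap using that by (simp add: mult_ac)
  then show ?thesis using that[OF len] by blast
qed

lemma continuous_on_prod_eigenvalues_poly [continuous_intros]:
  fixes F :: "'a::topological_space \<Rightarrow> complex^'n^'n"
  assumes "continuous_on S F"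
  shows "continuous_on S (\<lambda>x. \<Prod>z\<in>#eigenvalues (F x). poly P z)"
proof -
  obtain c us where "\<And>M. size M = CARD('n) \<Longrightarrow> (\<Prod>z\<in>#M. poly P z) = c * (\<Prod>u\<leftarrow>us. \<Prod>z\<in>#M. u - z)"
    by (rule prod_mset_poly_eq[of P "CARD('n)"]) blast
  from this[OF size_eigenvalues] show ?thesis
    unfolding poly_charpoly_eigenvalues[symmetric] by (simp only:) (intro continuous_intros assms)
qed

lemma torus_avg_prod:
  fixes e :: "'n::finite \<Rightarrow> nat" and h :: "complex^'n^'n \<Rightarrow> complex"
  assumes f: "continuous_on (sphere 0 1) f"
    and h: "\<And>z. h (diag_matrix e z) = (\<Prod>i<CARD('n). f (z i))"
  shows "avg (torus CARD('n)) (\<lambda>\<theta>. torus_weight CARD('n) m (angle \<theta>)) (\<lambda>\<theta>. diag_matrix e (angle \<theta>)) h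
    = toeplitz_det CARD('n) (\<lambda>z. inverse z ^ m * f z)"
proof -
  have "continuous_on (sphere 0 1) (\<lambda>z. inverse z ^ m * f z)"
    by (intro continuous_intros f) auto
  note * = torus_integral_vand_sq[OF this, of "CARD('n)"]
  have "avg (torus CARD('n)) (\<lambda>\<theta>. torus_weight CARD('n) m (angle \<theta>)) (\<lambda>\<theta>. diag_matrix e (angle \<theta>)) h
    = (LINT \<theta>|torus CARD('n). (vand_sq CARD('n) (angle \<theta>) * (\<Prod>i<CARD('n). inverse (angle \<theta> i) ^ m * f (angle \<theta> i))) / fact CARD('n))"
    unfolding avg_def h torus_weight_def inv_prod_def
    by (simp add: prod.distrib prod_power_distrib mult_ac)
  also have "\<dots> = toeplitz_det CARD('n) (\<lambda>z. inverse z ^ m * f z)"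
    unfolding integral_divide_zero * by simp
  finally show ?thesis .
qed

text \<open>Factoring \<open>P\<close> turns the eigenvalue product into one characteristic
  polynomial per root, so \<open>degree P\<close> bounds the determinant powers that can occur. The
  torus averages serve as the dual family and are evaluated by Heine's identity.\<close>

theorem avg_prod_eigenvalues_poly:
  fixes B :: "'b \<Rightarrow> complex^'n^'n"
  assumes avg: "sd_average \<nu> W B" and K: "degree P \<le> K"
  shows "avg \<nu> W B (\<lambda>A. \<Prod>z\<in>#eigenvalues A. poly P z) =
    (\<Sum>m\<le>K. avg \<nu> W B (\<lambda>A. cdet A ^ m) * toeplitz_det CARD('n) (\<lambda>z. inverse z ^ m * poly P z))"
proof -
  obtain e :: "'n \<Rightarrow> nat" where e: "bij_betw e UNIV {..<CARD('n)}"
    using ex_bij_betw_finite_nat[of "UNIV :: 'n set"] by (auto simp: atLeast0LessThan)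
  let ?T = "\<lambda>m. avg (torus CARD('n)) (\<lambda>\<theta>. torus_weight CARD('n) m (angle \<theta>)) (\<lambda>\<theta>. diag_matrix e (angle \<theta>))"
  obtain c us where len: "length us = degree P"
    and us: "\<And>M. size M = CARD('n) \<Longrightarrow> (\<Prod>z\<in>#M. poly P z) = c * (\<Prod>u\<leftarrow>us. \<Prod>z\<in>#M. u - z)"
    by (rule prod_mset_poly_eq[of P "CARD('n)"]) blast
  have eig: "eig_prod (poly P) A = c * (\<Prod>u\<leftarrow>us. poly (charpoly A) u)" for A :: "complex^'n^'n"
    unfolding poly_charpoly_eigenvalues by (rule us[OF size_eigenvalues])
  \<comment> \<open>Duality comes from orthogonality of monomials: weight \<open>m\<close> pairs
    with \<open>cdet A ^ n\<close> to the Toeplitz determinant of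
    \<open>z powi (n - m)\<close>.\<close>
  have det': "?T m (\<lambda>A. cdet A ^ n) = (if m = n then 1 else 0)" for m n
  proof -
    have "?T m (\<lambda>A. cdet A ^ n) = toeplitz_det CARD('n) (\<lambda>z. inverse z ^ m * z ^ n)"
      by (rule torus_avg_prod) (auto intro!: continuous_intros simp: charpoly_diag_matrix[OF e] prod_power_distrib)
    also have "\<dots> = toeplitz_det CARD('n) (\<lambda>z. z powi (int n - int m))"
      by (rule toeplitz_det_cong, subst power_int_diff) (auto simp: power_inverse divide_inverse mult.commute)
    finally show ?thesis by (auto simp: toeplitz_det_monomial)
  qed
  have T: "?T m (\<lambda>A. \<Prod>z\<in>#eigenvalues A. poly P z) = toeplitz_det CARD('n) (\<lambda>z. inverse z ^ m * poly P z)" for m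
  proof (rule torus_avg_prod)
    show "(\<Prod>w\<in>#eigenvalues (diag_matrix e z). poly P w) = (\<Prod>i<CARD('n). poly P (z i))" for z
    proof -
      \<comment> \<open>The eigenvalue multiset of the diagonal matrix is never identified with
        \<open>M\<close>; both products depend only on the values \<open>\<Prod>(u - w)\<close>, and
        these agree by the characteristic polynomial.\<close>
      define M where "M = image_mset z (mset_set {..<CARD('n)})"
      have "(\<Prod>i<CARD('n). g (z i)) = (\<Prod>w\<in>#M. g w)" for g :: "complex \<Rightarrow> complex"
        by (simp add: M_def image_mset.compositionality o_def prod_unfold_prod_mset)
      then have 1: "(\<Prod>i<CARD('n). poly P (z i)) = (\<Prod>w\<in>#M. poly P w)"
        and 2: "(\<Prod>i<CARD('n). u - z i) = (\<Prod>w\<in>#M. u - w)" for u by auto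
      have "size M = CARD('n)" by (simp add: M_def)
      from us[OF this]
      show ?thesis unfolding eig charpoly_diag_matrix(1)[OF e] 1 2 by simp
    qed
  qed (intro continuous_intros)
  have "avg \<nu> W B (\<lambda>A. \<Prod>u\<leftarrow>us. poly (charpoly A) u) =
    (\<Sum>m\<le>K. avg \<nu> W B (\<lambda>A. cdet A ^ m) * ?T m (\<lambda>A. \<Prod>u\<leftarrow>us. poly (charpoly A) u))"
    using avg_prod_charpoly_eq[OF avg sd_average_torus[OF e], where K = K and us = us and as = "[]"] K len by (simp add: det')
  then have "avg \<nu> W B (\<lambda>A. \<Prod>z\<in>#eigenvalues A. poly P z) =
    (\<Sum>m\<le>K. avg \<nu> W B (\<lambda>A. cdet A ^ m) * ?T m (\<lambda>A. \<Prod>z\<in>#eigenvalues A. poly P z))"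
    unfolding eig avg_cmult by (simp add: sum_distrib_left mult_ac)
  then show ?thesis unfolding T .
qed

text \<open>For an eigenvector \<open>v\<close> the squared norm of \<open>A v\<close> is both
  \<open>|z|\<^sup>2\<close> times that of \<open>v\<close> and, by unitarity, equal to it.
  Eigenvalues thus lie where the estimates for the symbol hold.\<close>

lemma norm_eigenvalue_unitary:
  fixes A :: "complex^'n^'n"
  assumes A: "A \<in> unitary_group" and z: "z \<in># eigenvalues A"
  shows "norm z = 1"
proof -
  have "charpoly A \<noteq> 0" using coeff_charpoly[of A] by auto
  then have "cdet (scalar_mat z - A) = 0"
    using z by (simp add: eigenvalues_def poly_charpoly[symmetric])
  then have "\<not> invertible (scalar_mat z - A)"
    by (simp add: invertible_det_nz)
  then obtain v where v: "v \<noteq> 0" "(scalar_mat z - A) *v v = 0"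
    using matrix_left_invertible_ker[of "scalar_mat z - A"]
    by (auto simp: invertible_left_inverse)
  have Av: "(\<Sum>q\<in>UNIV. A $ p $ q * v $ q) = z * v $ p" for p
  proof -
    have "(\<Sum>q\<in>UNIV. (if p = q then z else 0) * v $ q) = z * v $ p"
      by (simp add: if_distrib[of "\<lambda>x. x * _"] cong: if_cong)
    moreover have "((scalar_mat z - A) *v v) $ p = 0" using v(2) by simp
    ultimately show ?thesis
      by (simp add: matrix_vector_mult_def scalar_mat_def left_diff_distrib sum_subtractf)
  qed
  have orth: "(\<Sum>p\<in>UNIV. cnj (A $ p $ r) * A $ p $ q) = (if r = q then 1 else 0)" for r q
  proof -
    have "(conj_transpose A ** A) $ r $ q = (if r = q then 1 else 0)"
      using A by (simp add: unitary_group_def scalar_mat_def)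
    then show ?thesis by (simp add: matrix_matrix_mult_def)
  qed
  define S where "S = (\<Sum>p\<in>UNIV. (norm (v $ p))\<^sup>2)"
  have S: "complex_of_real S = (\<Sum>p\<in>UNIV. v $ p * cnj (v $ p))"
    by (simp only: S_def of_real_sum complex_norm_square)
  have "complex_of_real ((norm z)\<^sup>2 * S) = (\<Sum>p\<in>UNIV. (z * v $ p) * cnj (z * v $ p))"
    unfolding of_real_mult S complex_norm_square by (simp add: sum_distrib_left mult_ac)
  also have "\<dots> = (\<Sum>p\<in>UNIV. \<Sum>q\<in>UNIV. \<Sum>r\<in>UNIV. v $ q * cnj (v $ r) * (cnj (A $ p $ r) * A $ p $ q))"
    unfolding Av[symmetric] by (simp add: sum_product mult_ac)
  also have "\<dots> = (\<Sum>q\<in>UNIV. \<Sum>r\<in>UNIV. v $ q * cnj (v $ r) * (\<Sum>p\<in>UNIV. cnj (A $ p $ r) * A $ p $ q))"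
    unfolding sum_distrib_left
    by (subst sum.swap) (intro sum.cong refl sum.swap)
  also have "\<dots> = complex_of_real S"
    unfolding orth S by (simp add: if_distrib[of "\<lambda>x. _ * x"] cong: if_cong)
  finally have "(norm z)\<^sup>2 * S = S" by (simp only: of_real_eq_iff)
  moreover have "S \<noteq> 0"
  proof
    assume "S = 0"
    then have "v $ p = 0" for p
      unfolding S_def by (subst (asm) sum_nonneg_eq_0_iff) auto
    then show False using v(1) by (simp add: matrix_eq_iff)
  qed
  ultimately have "(norm z)\<^sup>2 = 1" by simp
  then show ?thesis using norm_ge_zero[of z] by (auto simp: power2_eq_1_iff)
qed

section \<open>Truncating the symbol\<close>

text \<open>Factors are exchanged one at a time. The bound on the product of \<open>g\<close> is
  proved alongside because the induction step multiplies it by the new error, and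
  \<open>1 \<le> b\<close> allows raising the exponent of \<open>b\<close>.\<close>

lemma norm_prod_mset_diff_le:
  fixes f g :: "'i \<Rightarrow> complex" and b \<epsilon> :: real
  assumes b: "1 \<le> b" and \<epsilon>: "0 \<le> \<epsilon>"
    and f: "\<And>z. z \<in># M \<Longrightarrow> norm (f z) \<le> b" and g: "\<And>z. z \<in># M \<Longrightarrow> norm (g z) \<le> b"
    and fg: "\<And>z. z \<in># M \<Longrightarrow> norm (f z - g z) \<le> \<epsilon>"
  shows "norm ((\<Prod>z\<in>#M. f z) - (\<Prod>z\<in>#M. g z)) \<le> size M * b ^ size M * \<epsilon> \<and> norm (\<Prod>z\<in>#M. g z) \<le> b ^ size M"
  using f g fg
proof (induction M)
  case (add x M)
  let ?F = "\<Prod>z\<in>#M. f z" and ?G = "\<Prod>z\<in>#M. g z" and ?n = "size M"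
  have IH: "norm (?F - ?G) \<le> ?n * b ^ ?n * \<epsilon>" "norm ?G \<le> b ^ ?n" using add by auto
  have x: "norm (f x) \<le> b" "norm (g x) \<le> b" "norm (f x - g x) \<le> \<epsilon>" using add by auto
  have "f x * ?F - g x * ?G = f x * (?F - ?G) + (f x - g x) * ?G" by (simp add: algebra_simps)
  also have "norm \<dots> \<le> norm (f x) * norm (?F - ?G) + norm (f x - g x) * norm ?G"
    by (rule norm_triangle_le) (simp add: norm_mult)
  also have "\<dots> \<le> b * (?n * b ^ ?n * \<epsilon>) + \<epsilon> * b ^ ?n"
    using IH x b \<epsilon> by (intro add_mono mult_mono) auto
  also have "\<epsilon> * b ^ ?n \<le> \<epsilon> * b ^ Suc ?n"
    using b \<epsilon> by (intro mult_left_mono power_increasing) auto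
  finally have "norm (f x * ?F - g x * ?G) \<le> Suc ?n * b ^ Suc ?n * \<epsilon>"
    by (simp add: algebra_simps)
  moreover have "norm (g x * ?G) \<le> b * b ^ ?n"
    unfolding norm_mult using IH x b by (intro mult_mono) auto
  ultimately show ?case by simp
qed auto

lemma norm_prod_diff_le:
  fixes f g :: "'i \<Rightarrow> complex" and b \<epsilon> :: real
  assumes "1 \<le> b" "0 \<le> \<epsilon>" "finite I"
    and "\<And>z. z \<in> I \<Longrightarrow> norm (f z) \<le> b" "\<And>z. z \<in> I \<Longrightarrow> norm (g z) \<le> b"
    and "\<And>z. z \<in> I \<Longrightarrow> norm (f z - g z) \<le> \<epsilon>"
  shows "norm ((\<Prod>z\<in>I. f z) - (\<Prod>z\<in>I. g z)) \<le> card I * b ^ card I * \<epsilon> \<and> norm (\<Prod>z\<in>I. g z) \<le> b ^ card I"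
  using norm_prod_mset_diff_le[of b \<epsilon> "mset_set I" f g] assms by (simp add: prod_unfold_prod_mset)

lemma torus_nice_continuous:
  assumes f: "continuous_on (sphere 0 1) f" and i: "i < n"
  shows "torus_nice n (\<lambda>z. f (z i))"
proof -
  have "(\<lambda>\<theta>. \<theta> i) \<in> measurable (torus n) (restrict_space lborel {0..1})"
    unfolding torus_def using i by (intro measurable_component_singleton) simp
  moreover have "(\<lambda>t. f (cis (2 * pi * t))) \<in> borel_measurable (restrict_space lborel {0..1})"
    by (intro measurable_restrict_space1)
       (auto intro!: borel_measurable_continuous_onI continuous_on_compose2[OF f] continuous_intros)
  ultimately have "(\<lambda>\<theta>. f (angle \<theta> i)) \<in> borel_measurable (torus n)"
    unfolding angle_def using measurable_compose by blast
  moreover have "bounded (f ` sphere 0 1)"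
    by (intro compact_imp_bounded compact_continuous_image f compact_sphere)
  then obtain b where "\<forall>z\<in>sphere 0 1. norm (f z) \<le> b"
    by (auto simp: bounded_iff)
  ultimately show ?thesis by (auto simp: torus_nice_def intro!: exI[of _ b])
qed

text \<open>The bound is read off Heine's identity: \<open>V\<close> is a bound for
  \<open>vand_sq\<close> on the torus, so it depends on \<open>n\<close> alone and only supremum
  norms of the symbols enter.\<close>

lemma toeplitz_det_diff_le:
  obtains V :: real where "\<And>f g b \<epsilon>. continuous_on (sphere 0 1) f \<Longrightarrow> continuous_on (sphere 0 1) g \<Longrightarrow> 1 \<le> b \<Longrightarrow> 0 \<le> \<epsilon> \<Longrightarrow>
      (\<And>z. norm z = 1 \<Longrightarrow> norm (f z) \<le> b) \<Longrightarrow> (\<And>z. norm z = 1 \<Longrightarrow> norm (g z) \<le> b) \<Longrightarrow>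
      (\<And>z. norm z = 1 \<Longrightarrow> norm (f z - g z) \<le> \<epsilon>) \<Longrightarrow>
      norm (toeplitz_det n f - toeplitz_det n g) \<le> V * (n * b ^ n * \<epsilon>)"
proof -
  interpret prob_space "torus n" by (rule prob_space_torus)
  obtain c where c: "\<And>\<theta>. norm (vand_sq n (angle \<theta>)) \<le> c"
    using torus_nice_vand_sq[of n] by (auto simp: torus_nice_def)
  have c0: "c \<ge> 0" using order_trans[OF norm_ge_zero c] .
  show ?thesis
  proof (rule that[of c])
    fix f g :: "complex \<Rightarrow> complex" and b \<epsilon> :: real
    assume f: "continuous_on (sphere 0 1) f" and g: "continuous_on (sphere 0 1) g" and b: "1 \<le> b" and \<epsilon>: "0 \<le> \<epsilon>"
      and bounds: "\<And>z. norm z = 1 \<Longrightarrow> norm (f z) \<le> b" "\<And>z. norm z = 1 \<Longrightarrow> norm (g z) \<le> b"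
        "\<And>z. norm z = 1 \<Longrightarrow> norm (f z - g z) \<le> \<epsilon>"
    let ?h = "\<lambda>f \<theta>. vand_sq n (angle \<theta>) * (\<Prod>i<n. f (angle \<theta> i))"
    have int: "integrable (torus n) (?h f)" if "continuous_on (sphere 0 1) f" for f
      using that by (intro torus_nice_integrable torus_nice_mult torus_nice_vand_sq torus_nice_prod torus_nice_continuous) auto
    have "fact n * (toeplitz_det n f - toeplitz_det n g) = (LINT \<theta>|torus n. ?h f \<theta> - ?h g \<theta>)"
      using int[OF f] int[OF g] by (simp add: torus_integral_vand_sq f g right_diff_distrib)
    also have "norm \<dots> \<le> (LINT \<theta>|torus n. norm (?h f \<theta> - ?h g \<theta>))"
      by (rule integral_norm_bound)
    also have "\<dots> \<le> (LINT \<theta>|torus n. c * (n * b ^ n * \<epsilon>))"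
    proof (rule integral_mono)
      show "norm (?h f \<theta> - ?h g \<theta>) \<le> c * (n * b ^ n * \<epsilon>)" for \<theta>
        unfolding right_diff_distrib[symmetric] norm_mult
        using norm_prod_diff_le[OF b \<epsilon> finite_lessThan[of n], of "\<lambda>i. f (angle \<theta> i)" "\<lambda>i. g (angle \<theta> i)"] bounds c[of \<theta>] c0
        by (intro mult_mono) auto
    qed (use int f g in auto)
    also have "\<dots> = c * (n * b ^ n * \<epsilon>)" using prob_space by simp
    finally have "fact n * norm (toeplitz_det n f - toeplitz_det n g) \<le> c * (n * b ^ n * \<epsilon>)"
      by (simp add: norm_mult)
    moreover have "1 * norm (toeplitz_det n f - toeplitz_det n g) \<le> fact n * norm (toeplitz_det n f - toeplitz_det n g)"
      by (intro mult_right_mono fact_ge_1) auto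
    ultimately show "norm (toeplitz_det n f - toeplitz_det n g) \<le> c * (n * b ^ n * \<epsilon>)" by simp
  qed
qed

definition symbol :: "nat \<Rightarrow> (nat \<Rightarrow> complex) \<Rightarrow> (nat \<Rightarrow> complex) \<Rightarrow> complex \<Rightarrow> complex" where
  "symbol n a b z = (\<Prod>i=1..n. 1 / (1 - a i * inverse z)) * (\<Prod>j=1..n. 1 / (1 - b j * z))"

definition trunc_symbol :: "nat \<Rightarrow> nat \<Rightarrow> (nat \<Rightarrow> complex) \<Rightarrow> (nat \<Rightarrow> complex) \<Rightarrow> complex \<Rightarrow> complex" where
  "trunc_symbol K n a b z = (\<Prod>i=1..n. \<Sum>k<K. (a i * inverse z) ^ k) * (\<Prod>j=1..n. \<Sum>k<K. (b j * z) ^ k)"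

lemma geometric_truncation:
  fixes w :: complex
  assumes w: "norm w \<le> r" and r: "r < 1"
  shows "norm (1 / (1 - w)) \<le> 1 / (1 - r)" "norm (\<Sum>k<K. w ^ k) \<le> 1 / (1 - r)"
    "norm ((\<Sum>k<K. w ^ k) - 1 / (1 - w)) \<le> r ^ K * (1 / (1 - r))"
proof -
  have r0: "0 \<le> r" using w norm_ge_zero order_trans by blast
  have ne: "1 - w \<noteq> 0" using w r by auto
  have "1 - r \<le> norm (1 - w)" using norm_triangle_ineq2[of 1 w] w by simp
  then show 1: "norm (1 / (1 - w)) \<le> 1 / (1 - r)"
    using r by (simp add: norm_divide frac_le)
  have "norm (\<Sum>k<K. w ^ k) \<le> (\<Sum>k<K. r ^ k)"
    by (rule sum_norm_le) (simp add: norm_power power_mono w)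
  also have "\<dots> = (1 - r ^ K) / (1 - r)"
    using r geometric_sum[of r K] by (simp add: field_simps)
  also have "\<dots> \<le> 1 / (1 - r)" using r r0 by (simp add: divide_right_mono)
  finally show "norm (\<Sum>k<K. w ^ k) \<le> 1 / (1 - r)" .
  have "(\<Sum>k<K. w ^ k) - 1 / (1 - w) = - (w ^ K * (1 / (1 - w)))"
    using ne geometric_sum[of w K] by (simp add: field_simps)
  then have "norm ((\<Sum>k<K. w ^ k) - 1 / (1 - w)) = norm w ^ K * norm (1 / (1 - w))"
    by (simp only: norm_minus_cancel norm_mult norm_power)
  also have "\<dots> \<le> r ^ K * (1 / (1 - r))"
    using 1 w r0 by (intro mult_mono power_mono) auto
  finally show "norm ((\<Sum>k<K. w ^ k) - 1 / (1 - w)) \<le> r ^ K * (1 / (1 - r))" .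
qed

lemma trunc_symbol_approx:
  assumes a: "\<And>i. i \<in> {1..n} \<Longrightarrow> norm (a i) \<le> r" and b: "\<And>i. i \<in> {1..n} \<Longrightarrow> norm (b i) \<le> r"
    and r: "0 \<le> r" "r < 1"
  obtains C c :: real where "1 \<le> c" "0 \<le> C"
    "\<And>z. norm z = 1 \<Longrightarrow> norm (symbol n a b z) \<le> c"
    "\<And>K z. norm z = 1 \<Longrightarrow> norm (trunc_symbol K n a b z) \<le> c"
    "\<And>K z. norm z = 1 \<Longrightarrow> norm (trunc_symbol K n a b z - symbol n a b z) \<le> C * r ^ K"
proof -
  define d where "d = 1 / (1 - r)"
  have d: "1 \<le> d" using r by (simp add: d_def)
  \<comment> \<open>The disjoint sum merges both products of the symbol into one, so a single
    perturbation estimate covers them; hence the exponent \<open>2 * n\<close>.\<close>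
  define I where "I = {1..n} <+> {1..n}"
  define w where "w z = case_sum (\<lambda>i. a i * inverse z) (\<lambda>j. b j * z)" for z
  have fin: "finite I" and card: "card I = 2 * n" by (simp_all add: I_def card_Plus)
  have sym: "symbol n a b z = (\<Prod>x\<in>I. 1 / (1 - w z x))" for z
    by (simp add: symbol_def I_def w_def prod.Plus)
  have tr: "trunc_symbol K n a b z = (\<Prod>x\<in>I. \<Sum>k<K. w z x ^ k)" for K z
    by (simp add: trunc_symbol_def I_def w_def prod.Plus)
  have w: "norm (w z x) \<le> r" if "norm z = 1" "x \<in> I" for z x
    using that a b by (auto simp: w_def I_def norm_mult norm_inverse)
  have main: "norm (trunc_symbol K n a b z - symbol n a b z) \<le> card I * d ^ card I * (r ^ K * d)"
    "norm (symbol n a b z) \<le> d ^ card I" if z: "norm z = 1" for K z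
    using norm_prod_diff_le[OF d _ fin, of "r ^ K * d" "\<lambda>x. \<Sum>k<K. w z x ^ k" "\<lambda>x. 1 / (1 - w z x)"]
      geometric_truncation[OF w[OF z] r(2)] r d
    unfolding sym tr d_def[symmetric] by auto
  \<comment> \<open>Comparing the truncation with itself at error \<open>0\<close> extracts the
    bound in the second half of the estimate.\<close>
  have "norm (trunc_symbol K n a b z) \<le> d ^ card I" if z: "norm z = 1" for K z
    using norm_prod_diff_le[OF d _ fin, of 0 "\<lambda>x. \<Sum>k<K. w z x ^ k" "\<lambda>x. \<Sum>k<K. w z x ^ k"]
      geometric_truncation(2)[OF w[OF z] r(2)]
    unfolding tr d_def[symmetric] by auto
  then show ?thesis
    using main d by (intro that[of "d ^ card I" "card I * d ^ card I * d"]) (auto simp: mult_ac)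
qed

lemma continuous_on_symbol:
  assumes a: "\<And>i. i \<in> {1..n} \<Longrightarrow> norm (a i) \<le> r" and b: "\<And>i. i \<in> {1..n} \<Longrightarrow> norm (b i) \<le> r" and r: "r < 1"
  shows "continuous_on (sphere 0 1) (symbol n a b)"
proof -
  have "1 - a i * inverse z \<noteq> 0" "1 - b i * z \<noteq> 0" if "norm z = 1" "i \<in> {1..n}" for i z
  proof -
    have "norm (a i * inverse z) < 1" "norm (b i * z) < 1"
      using that a[of i] b[of i] r by (auto simp: norm_mult norm_inverse)
    then show "1 - a i * inverse z \<noteq> 0" "1 - b i * z \<noteq> 0" by auto
  qed
  then show ?thesis
    unfolding symbol_def by (intro continuous_intros) auto
qed

lemma continuous_on_trunc_symbol: "continuous_on (sphere 0 1) (trunc_symbol K n a b)"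
  unfolding trunc_symbol_def by (intro continuous_intros) auto

text \<open>The power \<open>n * K\<close> already clears all negative exponents. Allowing any
  larger \<open>L\<close> decouples the range of determinant powers from the truncation order, and
  the degree bound \<open>2 * L\<close> makes the exponents \<open>L - m\<close> symmetric about
  \<open>0\<close>.\<close>

lemma trunc_symbol_poly:
  assumes L: "n * K \<le> L"
  obtains P where "degree P \<le> 2 * L" "\<And>z. z \<noteq> 0 \<Longrightarrow> poly P z = z ^ L * trunc_symbol K n a b z"
proof -
  define A where "A i = (\<Sum>k<K. monom (a i ^ k) (K - k))" for i
  define B where "B j = (\<Sum>k<K. monom (b j ^ k) k)" for j
  define P where "P = monom 1 (L - n * K) * ((\<Prod>i=1..n. A i) * (\<Prod>j=1..n. B j))"
  have dA: "degree (A i) \<le> K" and dB: "degree (B i) \<le> K" for i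
    unfolding A_def B_def by (auto intro!: degree_sum_le order_trans[OF degree_monom_le])
  have dp: "degree (\<Prod>i=1..n. F i) \<le> n * K" if "\<And>i. degree (F i) \<le> K" for F :: "nat \<Rightarrow> complex poly"
  proof -
    have "degree (\<Prod>i=1..n. F i) \<le> (\<Sum>i=1..n. degree (F i))"
      using degree_prod_sum_le[of "{1..n}" F] by (simp add: o_def)
    also have "\<dots> \<le> (\<Sum>i=1..n. K)" by (intro sum_mono that)
    finally show ?thesis by simp
  qed
  have "degree P \<le> (L - n * K) + (n * K + n * K)"
    unfolding P_def
    by (intro order_trans[OF degree_mult_le] add_mono degree_monom_le dp dA dB)
  then have "degree P \<le> 2 * L" using L by simp
  moreover have "poly P z = z ^ L * trunc_symbol K n a b z" if z: "z \<noteq> 0" for z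
  proof -
    have "poly (A i) z = z ^ K * (\<Sum>k<K. (a i * inverse z) ^ k)" for i
      unfolding A_def poly_sum poly_monom sum_distrib_left
      using z by (intro sum.cong refl) (simp add: power_diff power_mult_distrib power_inverse divide_inverse)
    moreover have "poly (B j) z = (\<Sum>k<K. (b j * z) ^ k)" for j
      by (simp add: B_def poly_sum poly_monom power_mult_distrib)
    ultimately have "poly P z = z ^ (L - n * K) * (z ^ K) ^ n * trunc_symbol K n a b z"
      by (simp add: P_def poly_monom poly_prod trunc_symbol_def prod.distrib)
    also have "z ^ (L - n * K) * (z ^ K) ^ n = z ^ L"
      using L by (simp add: power_mult[symmetric] power_add[symmetric] mult.commute)
    finally show ?thesis .
  qed
  ultimately show ?thesis by (rule that)
qed

section \<open>The truncated identity\<close>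

lemma det_eq_prod_eigenvalues: "cdet A = (\<Prod>z\<in>#eigenvalues A. z)"
  for A :: "complex^'n^'n"
proof -
  have neg: "(\<Prod>z\<in>#M. - z) = (-1) ^ size M * (\<Prod>z\<in>#M. z)" for M :: "complex multiset"
    by (induction M) auto
  have "(-1) ^ CARD('n) * cdet A = (\<Prod>z\<in>#eigenvalues A. - z)"
    using poly_charpoly_eigenvalues[of A 0] poly_charpoly[of A 0] det_scale_mat[of "-1" A]
    by (simp add: uminus_eq_scale_mat[symmetric])
  then show ?thesis unfolding neg size_eigenvalues by simp
qed

lemma prod_mset_power: "(\<Prod>z\<in>#M. z ^ L * f z) = (\<Prod>z\<in>#M. z) ^ L * (\<Prod>z\<in>#M. f z :: complex)"
  by (induction M) (auto simp: power_mult_distrib)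

lemma prod_eigenvalues_trunc_symbol:
  fixes A :: "complex^'n^'n"
  assumes A: "A \<in> unitary_group" and P: "\<And>z. z \<noteq> 0 \<Longrightarrow> poly P z = z ^ L * trunc_symbol K n a b z"
  shows "eig_prod (poly P) A = cdet A ^ L * eig_prod (trunc_symbol K n a b) A"
proof -
  have "eig_prod (poly P) A = (\<Prod>z\<in>#eigenvalues A. z ^ L * trunc_symbol K n a b z)"
  proof (intro arg_cong[where f = prod_mset] image_mset_cong P)
    show "z \<noteq> 0" if "z \<in># eigenvalues A" for z
      using norm_eigenvalue_unitary[OF A that] by auto
  qed
  then show ?thesis by (simp add: prod_mset_power det_eq_prod_eigenvalues)
qed

lemma continuous_on_det [continuous_intros]:
  fixes F :: "'a::topological_space \<Rightarrow> complex^'n^'n"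
  assumes "continuous_on S F"
  shows "continuous_on S (\<lambda>x. cdet (F x))"
  unfolding Determinants.det_def by (intro continuous_intros assms)

lemma det_unitary_nonzero: "A \<in> unitary_group \<Longrightarrow> cdet A \<noteq> 0"
  using norm_det_unitary[of A] by auto

lemma continuous_on_inverse_det: "continuous_on unitary_group (\<lambda>A. inverse (cdet A) ^ L)"
  by (intro continuous_intros) (auto simp: det_unitary_nonzero)

text \<open>Left multiplication by \<open>SU(N)\<close> preserves the determinant, so every power of
  its inverse is an admissible weight, on \<open>U(N)\<close> as well as on
  \<open>SU(N)\<close>.\<close>

lemma sd_average_haar:
  fixes \<mu> :: "(complex^'n^'n) measure"
  assumes \<mu>: "normalized_haar_measure G \<mu>" and G: "unitary_subgroup G" and SG: "special_unitary_group \<subseteq> G"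
  shows "sd_average \<mu> (\<lambda>A. inverse (cdet A) ^ L) (\<lambda>A. A)"
  unfolding sd_average_def avg_def
proof (intro conjI allI impI)
  fix h :: "complex^'n^'n \<Rightarrow> complex" assume h: "continuous_on UNIV h"
  show "integrable \<mu> (\<lambda>A. inverse (cdet A) ^ L * h A)"
    by (intro haar_integrable[OF \<mu> G] continuous_on_mult continuous_on_inverse_det continuous_on_subset[OF h]) auto
next
  fix i as
  show "(LINT A|\<mu>. inverse (cdet A) ^ L * sd_term i as A) = 0"
    by (rule haar_sd_term[OF \<mu> G SG continuous_on_inverse_det])
       (simp add: det_mul special_unitary_group_def)
qed

lemma fold_symmetric_sum:
  fixes g :: "int \<Rightarrow> complex"
  shows "(\<Sum>m\<le>2 * L. g (int L - int m)) = g 0 + (\<Sum>k<L. g (int (k + 1)) + g (- int (k + 1)))"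
proof (induction L)
  case (Suc L)
  have "(\<Sum>m\<le>2 * Suc L. g (int (Suc L) - int m)) = (\<Sum>m\<le>Suc (Suc (2 * L)). g (int (Suc L) - int m))"
    by simp
  also have "\<dots> = g (int (Suc L)) + (\<Sum>m\<le>Suc (2 * L). g (int (Suc L) - int (Suc m)))"
    by (subst sum.atMost_Suc_shift) simp
  also have "\<dots> = g (int (Suc L)) + ((\<Sum>m\<le>2 * L. g (int L - int m)) + g (- int (Suc L)))"
    by (simp add: algebra_simps)
  finally show ?case unfolding Suc by (simp add: algebra_simps)
qed simp

text \<open>The index is shifted: \<open>k\<close> stands for the exponents \<open>k + 1\<close> and
  \<open>- (k + 1)\<close>, so that a series starting at exponent \<open>1\<close> is indexed from
  \<open>0\<close>.\<close>

definition toeplitz_pair :: "nat \<Rightarrow> (complex \<Rightarrow> complex) \<Rightarrow> nat \<Rightarrow> complex" where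
  "toeplitz_pair N f k = toeplitz_det N (\<lambda>z. z powi int (k + 1) * f z)
     + toeplitz_det N (\<lambda>z. z powi (- int (k + 1)) * f z)"

text \<open>The determinant is \<open>1\<close> throughout, so multiplying the symbol by
  \<open>z ^ L\<close> changes nothing and all \<open>2 * L + 1\<close> determinant averages equal
  \<open>1\<close>. The exponents \<open>L - m\<close> then run from \<open>L\<close> down to
  \<open>- L\<close>.\<close>

lemma special_unitary_integral_trunc:
  fixes \<mu> :: "(complex^'n^'n) measure"
  assumes \<mu>: "normalized_haar_measure special_unitary_group \<mu>" and L: "n * K \<le> L"
  shows "(LINT A|\<mu>. eig_prod (trunc_symbol K n a b) A) =
    toeplitz_det CARD('n) (trunc_symbol K n a b) + (\<Sum>k<L. toeplitz_pair CARD('n) (trunc_symbol K n a b) k)"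
proof -
  interpret prob_space \<mu> using \<mu> by (simp add: normalized_haar_measure_def)
  obtain P where deg: "degree P \<le> 2 * L" and P: "\<And>z. z \<noteq> 0 \<Longrightarrow> poly P z = z ^ L * trunc_symbol K n a b z"
    by (rule trunc_symbol_poly[OF L]) blast
  have sp: "space \<mu> = special_unitary_group" by (rule haar_space[OF \<mu>])
  have avg: "sd_average \<mu> (\<lambda>A. inverse (cdet A) ^ 0) (\<lambda>A. A)"
    by (rule sd_average_haar[OF \<mu> unitary_subgroup_special_unitary_group]) simp
  let ?avg = "avg \<mu> (\<lambda>A. inverse (cdet A) ^ 0) (\<lambda>A. A)"
  have "(LINT A|\<mu>. eig_prod (trunc_symbol K n a b) A) = ?avg (\<lambda>A. \<Prod>z\<in>#eigenvalues A. poly P z)"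
    unfolding avg_def
    by (rule Bochner_Integration.integral_cong)
       (auto simp: sp special_unitary_group_def prod_eigenvalues_trunc_symbol[OF _ P])
  also have "\<dots> = (\<Sum>m\<le>2 * L. ?avg (\<lambda>A. cdet A ^ m) * toeplitz_det CARD('n) (\<lambda>z. inverse z ^ m * poly P z))"
    by (rule avg_prod_eigenvalues_poly[OF avg deg])
  also have "\<dots> = (\<Sum>m\<le>2 * L. toeplitz_det CARD('n) (\<lambda>z. z powi (int L - int m) * trunc_symbol K n a b z))"
  proof (rule sum.cong[OF refl])
    fix m
    have "?avg (\<lambda>A. cdet A ^ m) = (LINT A|\<mu>. 1)"
      unfolding avg_def by (rule Bochner_Integration.integral_cong) (auto simp: sp special_unitary_group_def)
    moreover have "toeplitz_det CARD('n) (\<lambda>z. inverse z ^ m * poly P z) = toeplitz_det CARD('n) (\<lambda>z. z powi (int L - int m) * trunc_symbol K n a b z)"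
    proof (rule toeplitz_det_cong)
      fix z :: complex assume "norm z = 1"
      then have "z \<noteq> 0" by auto
      then show "inverse z ^ m * poly P z = z powi (int L - int m) * trunc_symbol K n a b z"
        by (simp add: P power_int_diff power_inverse divide_inverse mult_ac)
    qed
    ultimately show "?avg (\<lambda>A. cdet A ^ m) * toeplitz_det CARD('n) (\<lambda>z. inverse z ^ m * poly P z) =
      toeplitz_det CARD('n) (\<lambda>z. z powi (int L - int m) * trunc_symbol K n a b z)"
      by (simp add: prob_space)
  qed
  also have "\<dots> = toeplitz_det CARD('n) (\<lambda>z. z powi 0 * trunc_symbol K n a b z) + (\<Sum>k<L. toeplitz_pair CARD('n) (trunc_symbol K n a b) k)"
    unfolding toeplitz_pair_def by (rule fold_symmetric_sum)
  finally show ?thesis by simp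
qed

lemma unitary_integral_det:
  fixes \<mu> :: "(complex^'n^'n) measure"
  assumes \<mu>: "normalized_haar_measure unitary_group \<mu>"
  shows "(LINT A|\<mu>. inverse (cdet A) ^ L * cdet A ^ m) = (if m = L then 1 else 0)"
proof -
  interpret prob_space \<mu> using \<mu> by (simp add: normalized_haar_measure_def)
  have sp: "space \<mu> = unitary_group" by (rule haar_space[OF \<mu>])
  let ?F = "\<lambda>A :: complex^'n^'n. inverse (cdet A) ^ L * cdet A ^ m"
  show ?thesis
  proof (cases "m = L")
    case True
    have "(LINT A|\<mu>. ?F A) = (LINT A|\<mu>. 1)"
      by (rule Bochner_Integration.integral_cong)
         (auto simp: sp True det_unitary_nonzero power_mult_distrib[symmetric])
    then show ?thesis using True by (simp add: prob_space)
  next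
    case False
    \<comment> \<open>Translation by the scalar matrix \<open>\<omega>\<close> multiplies the
      integrand by \<open>\<omega> powi d\<close>; the angle \<open>\<pi> / d\<close> makes this
      factor \<open>-1\<close>, which forces the integral to vanish.\<close>
    define d where "d = int CARD('n) * (int m - int L)"
    have d: "d \<noteq> 0" using False by (simp add: d_def)
    define \<omega> where "\<omega> = cis (pi / real_of_int d)"
    have \<omega>0: "\<omega> \<noteq> 0" by (simp add: \<omega>_def)
    let ?g = "scale_mat \<omega> (scalar_mat 1) :: complex^'n^'n"
    have \<omega>\<omega>: "\<omega> * cnj \<omega> = 1" by (simp add: \<omega>_def complex_norm_square[symmetric])
    have g: "?g \<in> unitary_group"
    proof -
      have "conj_transpose (scalar_mat 1 :: complex^'n^'n) = scalar_mat 1"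
        by (auto simp: matrix_eq_iff scalar_mat_def)
      moreover have "cnj \<omega> * \<omega> = 1" using \<omega>\<omega> by (simp only: mult.commute)
      ultimately show ?thesis
        by (simp add: unitary_group_def conj_transpose_scale_mat scale_mat_mult_left scale_mat_mult_right
            scale_mat_scale_mat \<omega>\<omega>)
    qed
    have F: "?F (?g ** A) = - ?F A" for A
    proof -
      have "cdet (?g ** A) = \<omega> ^ CARD('n) * cdet A"
        by (simp add: scale_mat_mult_left det_scale_mat)
      then have "?F (?g ** A) = (inverse (\<omega> ^ CARD('n)) ^ L * (\<omega> ^ CARD('n)) ^ m) * ?F A"
        by (simp add: power_mult_distrib mult_ac)
      also have "inverse (\<omega> ^ CARD('n)) ^ L * (\<omega> ^ CARD('n)) ^ m = \<omega> powi d"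
        using \<omega>0 by (simp add: d_def power_int_mult power_int_diff power_inverse divide_inverse mult.commute)
      also have "\<omega> powi d = -1"
        using d by (simp add: \<omega>_def Complex.cis_power_int)
      finally show ?thesis by simp
    qed
    have cont: "continuous_on unitary_group ?F"
      by (intro continuous_on_mult continuous_on_inverse_det continuous_intros)
    have "(LINT A|\<mu>. ?F A) = (LINT A|\<mu>. ?F (?g ** A))"
      by (rule haar_integral_translate[OF \<mu> unitary_subgroup_unitary_group cont g, symmetric])
    also have "\<dots> = - (LINT A|\<mu>. ?F A)" unfolding F by simp
    finally show ?thesis using False by simp
  qed
qed

text \<open>The weight \<open>inverse (cdet A) ^ L\<close> undoes the factor \<open>z ^ L\<close>,
  and against it only the determinant power \<open>m = L\<close> has a nonzero mean.\<close>

lemma unitary_integral_trunc: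
  fixes \<mu> :: "(complex^'n^'n) measure"
  assumes \<mu>: "normalized_haar_measure unitary_group \<mu>"
  shows "(LINT A|\<mu>. eig_prod (trunc_symbol K n a b) A) = toeplitz_det CARD('n) (trunc_symbol K n a b)"
proof -
  define L where "L = n * K"
  obtain P where deg: "degree P \<le> 2 * L" and P: "\<And>z. z \<noteq> 0 \<Longrightarrow> poly P z = z ^ L * trunc_symbol K n a b z"
    by (rule trunc_symbol_poly[of n K L]) (auto simp: L_def)
  have sp: "space \<mu> = unitary_group" by (rule haar_space[OF \<mu>])
  have avg: "sd_average \<mu> (\<lambda>A. inverse (cdet A) ^ L) (\<lambda>A. A)"
    by (rule sd_average_haar[OF \<mu> unitary_subgroup_unitary_group]) (auto simp: special_unitary_group_def)
  let ?avg = "avg \<mu> (\<lambda>A. inverse (cdet A) ^ L) (\<lambda>A. A)"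
  have "(LINT A|\<mu>. eig_prod (trunc_symbol K n a b) A) = ?avg (\<lambda>A. \<Prod>z\<in>#eigenvalues A. poly P z)"
    unfolding avg_def
    by (rule Bochner_Integration.integral_cong)
       (auto simp: sp prod_eigenvalues_trunc_symbol[OF _ P] power_inverse det_unitary_nonzero)
  also have "\<dots> = (\<Sum>m\<le>2 * L. ?avg (\<lambda>A. cdet A ^ m) * toeplitz_det CARD('n) (\<lambda>z. inverse z ^ m * poly P z))"
    by (rule avg_prod_eigenvalues_poly[OF avg deg])
  also have "\<dots> = (\<Sum>m\<le>2 * L. if m = L then toeplitz_det CARD('n) (\<lambda>z. inverse z ^ m * poly P z) else 0)"
    by (intro sum.cong refl) (simp add: avg_def unitary_integral_det[OF \<mu>])
  also have "\<dots> = toeplitz_det CARD('n) (\<lambda>z. inverse z ^ L * poly P z)" by simp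
  also have "\<dots> = toeplitz_det CARD('n) (trunc_symbol K n a b)"
  proof (rule toeplitz_det_cong)
    fix z :: complex assume "norm z = 1"
    then have "z \<noteq> 0" by auto
    then show "inverse z ^ L * poly P z = trunc_symbol K n a b z"
      by (simp add: P power_inverse)
  qed
  finally show ?thesis .
qed

section \<open>Passing to the limit\<close>

text \<open>On unitary matrices the truncated products are bounded uniformly in \<open>K\<close> and
  converge pointwise, so dominated convergence applies. Measurability for the full symbol is
  inherited as that of a pointwise limit.\<close>

lemma haar_integral_trunc_tendsto:
  fixes \<mu> :: "(complex^'n^'n) measure"
  assumes \<mu>: "normalized_haar_measure G \<mu>" and G: "unitary_subgroup G"
    and a: "\<And>i. i \<in> {1..n} \<Longrightarrow> norm (a i) \<le> r" and b: "\<And>i. i \<in> {1..n} \<Longrightarrow> norm (b i) \<le> r"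
    and r: "0 \<le> r" "r < 1"
  shows "(\<lambda>K. LINT A|\<mu>. eig_prod (trunc_symbol K n a b) A) \<longlonglongrightarrow> (LINT A|\<mu>. eig_prod (symbol n a b) A)"
proof -
  interpret prob_space \<mu> using \<mu> by (simp add: normalized_haar_measure_def)
  have sp: "space \<mu> \<subseteq> unitary_group" using haar_space[OF \<mu>] G by (simp add: unitary_subgroup_def)
  obtain C c :: real where c: "1 \<le> c" "0 \<le> C"
    "\<And>z. norm z = 1 \<Longrightarrow> norm (symbol n a b z) \<le> c"
    "\<And>K z. norm z = 1 \<Longrightarrow> norm (trunc_symbol K n a b z) \<le> c"
    "\<And>K z. norm z = 1 \<Longrightarrow> norm (trunc_symbol K n a b z - symbol n a b z) \<le> C * r ^ K"
    by (rule trunc_symbol_approx[of n a r b]) (use a b r in blast)+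
  let ?N = "CARD('n)"
  let ?F = "\<lambda>K A. \<Prod>z\<in>#eigenvalues (A :: complex^'n^'n). trunc_symbol K n a b z"
  \<comment> \<open>Eigenvalues enter only as a multiset, so measurability is obtained by rewriting
    the product as a determinant power times a symmetric polynomial expression continuous in the
    matrix.\<close>
  have meas: "?F K \<in> borel_measurable \<mu>" for K
  proof -
    obtain P where P: "\<And>z. z \<noteq> 0 \<Longrightarrow> poly P z = z ^ (n * K) * trunc_symbol K n a b z"
      by (rule trunc_symbol_poly[of n K "n * K"]) auto
    have "continuous_on unitary_group (\<lambda>A :: complex^'n^'n. inverse (cdet A) ^ (n * K) * eig_prod (poly P) A)"
      by (intro continuous_on_mult continuous_on_inverse_det continuous_intros)
    then have "(\<lambda>A :: complex^'n^'n. inverse (cdet A) ^ (n * K) * eig_prod (poly P) A) \<in> borel_measurable \<mu>"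
      by (intro borel_measurable_integrable haar_integrable[OF \<mu> G])
    also have "?this \<longleftrightarrow> ?F K \<in> borel_measurable \<mu>"
      by (rule measurable_cong)
         (use sp in \<open>auto simp: prod_eigenvalues_trunc_symbol[OF _ P] power_inverse det_unitary_nonzero\<close>)
    finally show ?thesis .
  qed
  have approx: "norm (?F K A - eig_prod (symbol n a b) A) \<le> ?N * c ^ ?N * (C * r ^ K)"
    "norm (?F K A) \<le> c ^ ?N" if A: "A \<in> space \<mu>" for K A
    using norm_prod_mset_diff_le[OF c(1), of "C * r ^ K" "eigenvalues A" "trunc_symbol K n a b" "symbol n a b"]
      norm_prod_mset_diff_le[OF c(1), of 0 "eigenvalues A" "trunc_symbol K n a b" "trunc_symbol K n a b"]
      c norm_eigenvalue_unitary[of A] A sp r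
    by (auto simp: size_eigenvalues)
  have lim: "(\<lambda>K. ?F K A) \<longlonglongrightarrow> eig_prod (symbol n a b) A" if A: "A \<in> space \<mu>" for A
  proof -
    have "(\<lambda>K. ?N * c ^ ?N * (C * r ^ K)) \<longlonglongrightarrow> ?N * c ^ ?N * (C * 0)"
      by (intro tendsto_intros LIMSEQ_power_zero) (use r in auto)
    then have "(\<lambda>K. ?N * c ^ ?N * (C * r ^ K)) \<longlonglongrightarrow> 0" by simp
    then have "(\<lambda>K. ?F K A - eig_prod (symbol n a b) A) \<longlonglongrightarrow> 0"
      by (rule Lim_null_comparison[rotated]) (use approx(1)[OF A] in auto)
    then show ?thesis by (simp add: LIM_zero_iff)
  qed
  show ?thesis
  proof (rule integral_dominated_convergence[where w = "\<lambda>_. c ^ ?N"])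
    show "(\<lambda>A. \<Prod>z\<in>#eigenvalues A. symbol n a b z) \<in> borel_measurable \<mu>"
      by (rule borel_measurable_LIMSEQ_metric[OF meas lim])
  qed (use meas lim approx(2) in auto)
qed

text \<open>The constant is independent of \<open>m\<close> because \<open>z powi m\<close> has
  modulus \<open>1\<close> on the circle and leaves all supremum norms unchanged. This uniformity
  permits adding up the errors for many \<open>m\<close>.\<close>

lemma toeplitz_trunc_diff:
  assumes a: "\<And>i. i \<in> {1..n} \<Longrightarrow> norm (a i) \<le> r" and b: "\<And>i. i \<in> {1..n} \<Longrightarrow> norm (b i) \<le> r"
    and r: "0 \<le> r" "r < 1"
  obtains V :: real where "\<And>(m::int) K. norm (toeplitz_det N (\<lambda>z. z powi m * trunc_symbol K n a b z)
      - toeplitz_det N (\<lambda>z. z powi m * symbol n a b z)) \<le> V * r ^ K"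
proof -
  obtain C c :: real where c: "1 \<le> c" "0 \<le> C"
    "\<And>z. norm z = 1 \<Longrightarrow> norm (symbol n a b z) \<le> c"
    "\<And>K z. norm z = 1 \<Longrightarrow> norm (trunc_symbol K n a b z) \<le> c"
    "\<And>K z. norm z = 1 \<Longrightarrow> norm (trunc_symbol K n a b z - symbol n a b z) \<le> C * r ^ K"
    by (rule trunc_symbol_approx[of n a r b]) (use a b r in blast)+
  obtain V :: real where V: "\<And>f g (b :: real) (\<epsilon> :: real). continuous_on (sphere 0 1) f \<Longrightarrow> continuous_on (sphere 0 1) g \<Longrightarrow> 1 \<le> b \<Longrightarrow> 0 \<le> \<epsilon> \<Longrightarrow>
      (\<And>z. norm z = 1 \<Longrightarrow> norm (f z) \<le> b) \<Longrightarrow> (\<And>z. norm z = 1 \<Longrightarrow> norm (g z) \<le> b) \<Longrightarrow>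
      (\<And>z. norm z = 1 \<Longrightarrow> norm (f z - g z) \<le> \<epsilon>) \<Longrightarrow>
      norm (toeplitz_det N f - toeplitz_det N g) \<le> V * (N * b ^ N * \<epsilon>)"
    by (rule toeplitz_det_diff_le[of N]) blast
  have powi: "continuous_on (sphere 0 1) (\<lambda>z :: complex. z powi m)" for m
    by (intro continuous_intros) auto
  have "norm (toeplitz_det N (\<lambda>z. z powi m * trunc_symbol K n a b z)
      - toeplitz_det N (\<lambda>z. z powi m * symbol n a b z)) \<le> V * (N * c ^ N * (C * r ^ K))" for m K
  proof (rule V)
    show "continuous_on (sphere 0 1) (\<lambda>z. z powi m * trunc_symbol K n a b z)"
      by (intro continuous_on_mult powi continuous_on_trunc_symbol)
    show "continuous_on (sphere 0 1) (\<lambda>z. z powi m * symbol n a b z)"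
      by (intro continuous_on_mult powi continuous_on_symbol[OF a b r(2)])
  qed (use c r in \<open>auto simp: norm_mult norm_power_int right_diff_distrib[symmetric]\<close>)
  then show ?thesis by (intro that[of "V * (N * c ^ N * C)"]) (simp add: mult_ac)
qed

text \<open>Partial sums for the truncated symbol converge to the difference of the integrals and
  differ from those of the true symbol by a null sequence. Convergence of the series is thus part of
  the conclusion.\<close>

theorem special_unitary_integral_sums:
  fixes \<mu>U \<mu>SU :: "(complex^'n^'n) measure"
  assumes \<mu>U: "normalized_haar_measure unitary_group \<mu>U"
    and \<mu>SU: "normalized_haar_measure special_unitary_group \<mu>SU"
    and a: "\<And>i. i \<in> {1..n} \<Longrightarrow> norm (a i) \<le> r" and b: "\<And>i. i \<in> {1..n} \<Longrightarrow> norm (b i) \<le> r"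
    and r: "0 \<le> r" "r < 1" and n: "n \<ge> 1"
  shows "toeplitz_pair CARD('n) (symbol n a b) sums
    ((LINT A|\<mu>SU. eig_prod (symbol n a b) A) - (LINT A|\<mu>U. eig_prod (symbol n a b) A))"
proof -
  let ?N = "CARD('n)"
  let ?I = "\<lambda>\<mu> f. LINT A|\<mu>. (\<Prod>z\<in>#eigenvalues (A :: complex^'n^'n). f z)"
  obtain V :: real where V: "\<And>(m::int) K. norm (toeplitz_det ?N (\<lambda>z. z powi m * trunc_symbol K n a b z)
      - toeplitz_det ?N (\<lambda>z. z powi m * symbol n a b z)) \<le> V * r ^ K"
    by (rule toeplitz_trunc_diff[of n a r b ?N]) (use a b r in blast)+
  \<comment> \<open>The truncation order is tied to the number of terms: this is the largest
    \<open>K\<close> with \<open>n * K \<le> L\<close>.\<close>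
  define K where "K L = L div n" for L
  have KL: "n * K L \<le> L" for L by (simp add: K_def)
  have K_top: "filterlim K at_top sequentially"
    unfolding filterlim_at_top
  proof
    fix Z
    have "\<forall>L\<ge>n * Z. Z \<le> K L" using n by (auto simp: K_def less_eq_div_iff_mult_less_eq mult.commute)
    then show "\<forall>\<^sub>F L in sequentially. Z \<le> K L" unfolding eventually_sequentially by blast
  qed
  have SU: "?I \<mu>SU (trunc_symbol (K L) n a b) - ?I \<mu>U (trunc_symbol (K L) n a b)
     = (\<Sum>k<L. toeplitz_pair ?N (trunc_symbol (K L) n a b) k)" for L
    unfolding special_unitary_integral_trunc[OF \<mu>SU KL] unitary_integral_trunc[OF \<mu>U] by simp
  have lim1: "(\<lambda>L. \<Sum>k<L. toeplitz_pair ?N (trunc_symbol (K L) n a b) k) \<longlonglongrightarrow> ?I \<mu>SU (symbol n a b) - ?I \<mu>U (symbol n a b)"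
    unfolding SU[symmetric]
    using filterlim_compose[OF haar_integral_trunc_tendsto[OF \<mu>SU unitary_subgroup_special_unitary_group a b r] K_top]
      filterlim_compose[OF haar_integral_trunc_tendsto[OF \<mu>U unitary_subgroup_unitary_group a b r] K_top]
    by (intro tendsto_diff)
  have diff: "norm ((\<Sum>k<L. toeplitz_pair ?N (trunc_symbol (K L) n a b) k) - (\<Sum>k<L. toeplitz_pair ?N (symbol n a b) k))
     \<le> 2 * V * n * ((real (K L) + 1) * r ^ K L)" for L
  proof -
    have V0: "V * r ^ K L \<ge> 0" using order_trans[OF norm_ge_zero V] .
    have "norm (toeplitz_pair ?N (trunc_symbol (K L) n a b) k - toeplitz_pair ?N (symbol n a b) k) \<le> 2 * (V * r ^ K L)" for k
    proof -
      have "norm (toeplitz_pair ?N (trunc_symbol (K L) n a b) k - toeplitz_pair ?N (symbol n a b) k)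
        \<le> V * r ^ K L + V * r ^ K L"
        unfolding toeplitz_pair_def add_diff_add by (intro norm_triangle_le add_mono V)
      then show ?thesis by simp
    qed
    then have "norm (\<Sum>k<L. toeplitz_pair ?N (trunc_symbol (K L) n a b) k - toeplitz_pair ?N (symbol n a b) k)
      \<le> (\<Sum>k<L. 2 * (V * r ^ K L))"
      by (intro sum_norm_le) auto
    also have "\<dots> = real L * (2 * (V * r ^ K L))" by simp
    \<comment> \<open>Since \<open>L\<close> is at most \<open>n * (K L + 1)\<close>, the
      accumulated error is of order \<open>(K + 1) * r ^ K\<close> and tends to zero.\<close>
    also have "\<dots> \<le> (real n * (real (K L) + 1)) * (2 * (V * r ^ K L))"
    proof (intro mult_right_mono)
      have "L = n * K L + L mod n" by (simp add: K_def)
      also have "\<dots> \<le> n * K L + n" using n by simp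
      finally show "real L \<le> real n * (real (K L) + 1)"
        by (metis of_nat_add of_nat_le_iff of_nat_mult distrib_left mult.right_neutral)
    qed (use V0 in auto)
    finally show ?thesis by (simp add: sum_subtractf algebra_simps)
  qed
  have "(\<lambda>k. (real k + 1) * r ^ k) \<longlonglongrightarrow> 0"
  proof -
    have "(\<lambda>k. real k * r ^ k + r ^ k) \<longlonglongrightarrow> 0 + 0"
      using powser_times_n_limit_0[of r] r by (intro tendsto_add LIMSEQ_power_zero) auto
    then show ?thesis by (simp add: algebra_simps)
  qed
  from filterlim_compose[OF this K_top]
  have "(\<lambda>L. 2 * V * n * ((real (K L) + 1) * r ^ K L)) \<longlonglongrightarrow> 0"
    by (rule tendsto_mult_right_zero)
  then have lim2: "(\<lambda>L. (\<Sum>k<L. toeplitz_pair ?N (trunc_symbol (K L) n a b) k) - (\<Sum>k<L. toeplitz_pair ?N (symbol n a b) k)) \<longlonglongrightarrow> 0"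
    by (rule Lim_null_comparison[rotated]) (use diff in auto)
  show ?thesis
    unfolding sums_def using tendsto_diff[OF lim1 lim2] by simp
qed

section \<open>Specialisation to the SQCD fugacities\<close>

lemma norm_fugacity_ratio:
  assumes x: "\<forall>i\<in>{1..N - 1}. norm (x i) = 1" and k: "k \<in> {1..N}"
  shows "norm (fugacity_ratio N x k) = 1"
proof -
  consider "N = 1" | "N \<noteq> 1" "k = 1" | "N \<noteq> 1" "k \<noteq> 1" "k = N" | "N \<noteq> 1" "k \<noteq> 1" "k \<noteq> N" by blast
  then show ?thesis
  proof cases
    case 2
    then have "1 \<in> {1..N - 1}" using k by auto
    then show ?thesis using x 2 by (simp add: fugacity_ratio_def)
  next
    case 3
    then have "N - 1 \<in> {1..N - 1}" using k by auto
    then show ?thesis using x 3 by (simp add: fugacity_ratio_def norm_divide)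
  next
    case 4
    then have "k \<in> {1..N - 1}" "k - 1 \<in> {1..N - 1}" using k by auto
    then show ?thesis using x 4 by (simp add: fugacity_ratio_def norm_divide)
  qed (simp add: fugacity_ratio_def)
qed

theorem mainTheorem2:
  fixes \<mu>U \<mu>SU :: "(complex^'n^'n) measure"
    and Nf :: nat and t t' :: real and x y :: "nat \<Rightarrow> complex"
  assumes "CARD('n) \<ge> 2" and "Nf \<ge> 1"
    and "0 \<le> t" and "t < 1" and "0 \<le> t'" and "t' < 1"
    and "\<forall>i\<in>{1..Nf - 1}. norm (x i) = 1"
    and "\<forall>i\<in>{1..Nf - 1}. norm (y i) = 1"
    and "normalized_haar_measure unitary_group \<mu>U"
    and "normalized_haar_measure special_unitary_group \<mu>SU"
  shows "summable (\<lambda>k.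
             toeplitz_det CARD('n) (\<lambda>z. z powi int (k + 1) * sqcd_symbol Nf t t' x y z) +
             toeplitz_det CARD('n) (\<lambda>z. z powi (- int (k + 1)) * sqcd_symbol Nf t t' x y z)) \<and>
         hilbert_series Nf \<mu>SU t t' x y =
           hilbert_series Nf \<mu>U t t' x y +
           (\<Sum>k.
             toeplitz_det CARD('n) (\<lambda>z. z powi int (k + 1) * sqcd_symbol Nf t t' x y z) +
             toeplitz_det CARD('n) (\<lambda>z. z powi (- int (k + 1)) * sqcd_symbol Nf t t' x y z))"
proof -
  define a where "a i = complex_of_real t * fugacity_ratio Nf x i" for i
  define b where "b j = complex_of_real t' * inverse (fugacity_ratio Nf y j)" for j
  have sym: "sqcd_symbol Nf t t' x y = symbol Nf a b"
    by (simp add: fun_eq_iff sqcd_symbol_def symbol_def a_def b_def)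
  have "toeplitz_pair CARD('n) (symbol Nf a b) sums
    ((LINT A|\<mu>SU. (\<Prod>z\<in>#eigenvalues A. symbol Nf a b z)) - (LINT A|\<mu>U. (\<Prod>z\<in>#eigenvalues A. symbol Nf a b z)))"
  \<comment> \<open>The common radius is \<open>max t t'\<close>: the fugacity ratios have modulus
    \<open>1\<close>, so only the two moduli \<open>t\<close> and \<open>t'\<close> remain.\<close>
  proof (rule special_unitary_integral_sums)
    show "norm (a i) \<le> max t t'" if "i \<in> {1..Nf}" for i
      using norm_fugacity_ratio[OF assms(7) that] assms(3) by (simp add: a_def norm_mult)
    show "norm (b i) \<le> max t t'" if "i \<in> {1..Nf}" for i
      using norm_fugacity_ratio[OF assms(8) that] assms(5) by (simp add: b_def norm_mult norm_inverse)
  qed (use assms in auto)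
  then show ?thesis
    unfolding sym[symmetric] toeplitz_pair_def[abs_def] hilbert_series_def
    by (auto simp: sums_iff)
qed

end
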